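(* Let $X$ and $Y$ be two (not necessarily bounded) normal operators on a Hilbert space $H$ that are monotonically independent (in this order) with respect to the unit vector $\Omega\in H$, and let $\mu=\mathcal{L}(X,\Omega)$, $\nu=\mathcal{L}(Y,\Omega)$. Then there exists an isometry $W:L^2(\mathbb{C}\times\mathbb{C},\mu\otimes\nu)\to H$ such that $$\big(W^*h(X)W\psi\big)(x,y)=\big(h(x)-h(0)\big)\int_{\mathbb{C}}\psi(x,y')\,\mathrm{d}\nu(y')+h(0)\psi(x,y),$$ $$\big(W^*h(Y)W\psi\big)(x,y)=h(y)\psi(x,y)$$ for $x,y\in\mathbb{C}$, all $\psi\in L^2(\mathbb{C}\times\mathbb{C},\mu\otimes\nu)$ and all $h\in C_b(\mathbb{C})$. Moreover, $$W L^2(\mathbb{C}\times\mathbb{C},\mu\otimes\nu)=\overline{\mathrm{alg}\{h(X),h(Y);\,h\in C_b(\mathbb{C})\}\,\Omega}.$$ If the vector $\Omega$ is cyclic for the algebra $\mathrm{alg}(X,Y)=\mathrm{alg}\{h(X),h(Y);\,h\in C_b(\mathbb{C})\}$ generated by $X$ and $Y$ (i.e. $\overline{\mathrm{alg}(X,Y)\Omega}=H$), then $W$ is unitary.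
   Context: Inner products are linear in the second argument. $C_b(\mathbb{C})$ denotes the bounded continuous functions $\mathbb{C}\to\mathbb{C}$. A densely defined closed operator $X$ on $H$ is normal if $XX^*$ and $X^*X$ have the same domain and coincide there; $h(X)\in\mathcal{B}(H)$, $h\in C_b(\mathbb{C})$, is given by the functional calculus. For a unit vector $\Omega\in H$, $\mathcal{L}(X,\Omega)$ (the distribution of $X$ w.r.t. $\Omega$) is the probability measure $\mu$ on $\mathbb{C}$ with $\langle\Omega,h(X)\Omega\rangle=\int_{\mathbb{C}}h\,\mathrm{d}\mu$ for all $h\in C_b(\mathbb{C})$. $\mathrm{alg}\{\cdots\}$ denotes the algebra generated by the listed operators. Monotone independence: let $\mathbb{A}_k$ be the set of $(\varepsilon_1,\dots,\varepsilon_k)\in\{1,2\}^k$ with $\varepsilon_1\neq\varepsilon_2\neq\cdots\neq\varepsilon_k$ (adjacent entries distinct). Two (not necessarily unital) $*$-algebras $\mathcal{A}_1,\mathcal{A}_2\subset\mathcal{B}(H)$ are monotonically independent w.r.t. a unit vector $\Omega\in H$ if $$\langle\Omega,X_1X_2\cdots X_k\Omega\rangle=\Big\langle\Omega,\prod_{\kappa:\varepsilon_\kappa=1}X_\kappa\,\Omega\Big\rangle\prod_{\kappa:\varepsilon_\kappa=2}\langle\Omega,X_\kappa\Omega\rangle$$ for all $k\in\mathbb{N}$, $\varepsilon\in\mathbb{A}_k$, $X_1\in\mathcal{A}_{\varepsilon_1},\dots,X_k\in\mathcal{A}_{\varepsilon_k}$ (the operator product is in the order of the indices). The order of $\mathcal{A}_1,\mathcal{A}_2$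 matters. Two normal operators $X,Y$ are monotonically independent w.r.t. $\Omega$ if the $*$-algebras $\mathrm{alg}_0(X)=\{h(X);h\in C_b(\mathbb{C}),h(0)=0\}$ and $\mathrm{alg}_0(Y)=\{h(Y);h\in C_b(\mathbb{C}),h(0)=0\}$ are (in this order). *)

theory Defs
  imports "HOL-Probability.Probability"
begin

section \<open>Complex Hilbert spaces\<close>

text \<open>The underlying real Hilbert space supplies norm, topology and completeness; its inner product
  is the real part of the complex one, so that \<open>norm x ^ 2 = cinner x x\<close>.
  The complex inner product is linear in the second argument.\<close>

class complex_hilbert = real_inner + complete_space +
  fixes scaleC :: "complex \<Rightarrow> 'a \<Rightarrow> 'a"  (infixr \<open>*\<^sub>C\<close> 75)
    and cinner :: "'a \<Rightarrow> 'a \<Rightarrow> complex"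
  assumes scaleC_add_right: "a *\<^sub>C (x + y) = a *\<^sub>C x + a *\<^sub>C y"
    and scaleC_add_left: "(a + b) *\<^sub>C x = a *\<^sub>C x + b *\<^sub>C x"
    and scaleC_scaleC: "a *\<^sub>C (b *\<^sub>C x) = (a * b) *\<^sub>C x"
    and scaleR_scaleC: "r *\<^sub>R x = complex_of_real r *\<^sub>C x"
    and cinner_commute: "cinner x y = cnj (cinner y x)"
    and cinner_add_right: "cinner x (y + z) = cinner x y + cinner x z"
    and cinner_scaleC_right: "cinner x (a *\<^sub>C y) = a * cinner x y"
    and inner_eq_Re_cinner: "inner x y = Re (cinner x y)"

instantiation complex :: complex_hilbert
begin

definition scaleC_complex :: "complex \<Rightarrow> complex \<Rightarrow> complex"
  where "scaleC_complex a x = a * x"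

definition cinner_complex :: "complex \<Rightarrow> complex \<Rightarrow> complex"
  where "cinner_complex x y = cnj x * y"

instance
  by standard
    (auto simp: scaleC_complex_def cinner_complex_def inner_complex_def algebra_simps
      scaleR_conv_of_real)

end

definition bounded_clinear :: "('h::complex_hilbert \<Rightarrow> 'h) \<Rightarrow> bool" where
  "bounded_clinear B \<longleftrightarrow> bounded_linear B \<and> (\<forall>c v. B (c *\<^sub>C v) = c *\<^sub>C B v)"


section \<open>Unbounded operators\<close>

text \<open>A (partially defined) operator is identified with its graph, a subset of the Hilbert space
  \<open>'h \<times> 'h\<close>; its domain is \<^const>\<open>Domain\<close>, and it is closed iff its graph is.\<close>

definition linear_operator :: "('h::complex_hilbert \<times> 'h) set \<Rightarrow> bool" where
  "linear_operator X \<longleftrightarrow> single_valued X \<and> (0, 0) \<in> X \<and>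
     (\<forall>p\<in>X. \<forall>q\<in>X. p + q \<in> X) \<and> (\<forall>c. \<forall>(v, w)\<in>X. (c *\<^sub>C v, c *\<^sub>C w) \<in> X)"

definition adj :: "('h::complex_hilbert \<times> 'h) set \<Rightarrow> ('h \<times> 'h) set" where
  "adj X = {(u, w). \<forall>(v, x)\<in>X. cinner u x = cinner w v}"

text \<open>Relational composition \<open>R O S\<close> applies \<open>R\<close> first, so \<open>adj X O X\<close> is the graph of
  $X X^*$ on its natural domain. Equality of the graphs includes equality of the domains.\<close>

definition normal_operator :: "('h::complex_hilbert \<times> 'h) set \<Rightarrow> bool" where
  "normal_operator X \<longleftrightarrow> linear_operator X \<and> closure (Domain X) = UNIV \<and> closed X \<and>
     adj X O X = X O adj X"


section \<open>Functional calculus of a normal operator\<close>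

text \<open>\<^const>\<open>bcontfun\<close> is the set of bounded continuous functions. The functional calculus of \<open>X\<close>
  on it is the unital $*$-homomorphism \<open>\<Phi>\<close> into the bounded operators that satisfies
  $X\, f(X) = (z f)(X)$ whenever both $f$ and $z f$ are bounded, and that turns
  bounded, locally uniform convergence of functions into strong convergence of operators. For
  normal \<open>X\<close> such a \<open>\<Phi>\<close> exists, namely integration against the spectral measure of \<open>X\<close>. It is
  unique on \<^const>\<open>bcontfun\<close>: by the continuity condition any such \<open>\<Phi>\<close> is integration
  against some spectral measure, the identity operator function integrates to a normal restriction
  of \<open>X\<close>, and normal operators have no proper normal extensions. Hence the choice
  operator below only leaves open the irrelevant values outside \<^const>\<open>bcontfun\<close>.\<close>

definition is_functional_calculus ::
  "('h::complex_hilbert \<times> 'h) set \<Rightarrow> ((complex \<Rightarrow> complex) \<Rightarrow> 'h \<Rightarrow> 'h) \<Rightarrow> bool" where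
  "is_functional_calculus X \<Phi> \<longleftrightarrow>
     (\<forall>f\<in>bcontfun. bounded_clinear (\<Phi> f)) \<and>
     \<Phi> (\<lambda>z. 1) = id \<and>
     (\<forall>f\<in>bcontfun. \<forall>g\<in>bcontfun. \<forall>v. \<Phi> (\<lambda>z. f z + g z) v = \<Phi> f v + \<Phi> g v) \<and>
     (\<forall>f\<in>bcontfun. \<forall>c v. \<Phi> (\<lambda>z. c * f z) v = c *\<^sub>C \<Phi> f v) \<and>
     (\<forall>f\<in>bcontfun. \<forall>g\<in>bcontfun. \<Phi> (\<lambda>z. f z * g z) = \<Phi> f \<circ> \<Phi> g) \<and>
     (\<forall>f\<in>bcontfun. \<forall>u v. cinner u (\<Phi> (\<lambda>z. cnj (f z)) v) = cinner (\<Phi> f u) v) \<and>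
     (\<forall>f\<in>bcontfun. (\<lambda>z. z * f z) \<in> bcontfun \<longrightarrow> (\<forall>v. (\<Phi> f v, \<Phi> (\<lambda>z. z * f z) v) \<in> X)) \<and>
     (\<forall>f g. (\<forall>n. f n \<in> bcontfun) \<and> g \<in> bcontfun \<and> (\<exists>C. \<forall>n z. cmod (f n z) \<le> C) \<and>
        (\<forall>K. compact K \<longrightarrow> uniform_limit K f g sequentially) \<longrightarrow>
        (\<forall>v. (\<lambda>n. \<Phi> (f n) v) \<longlonglongrightarrow> \<Phi> g v))"

definition fcalc ::
  "('h::complex_hilbert \<times> 'h) set \<Rightarrow> (complex \<Rightarrow> complex) \<Rightarrow> 'h \<Rightarrow> 'h" where
  "fcalc X = (SOME \<Phi>. is_functional_calculus X \<Phi>)"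

definition is_distribution ::
  "('h::complex_hilbert \<times> 'h) set \<Rightarrow> 'h \<Rightarrow> complex measure \<Rightarrow> bool" where
  "is_distribution X \<Omega> \<mu> \<longleftrightarrow> prob_space \<mu> \<and> sets \<mu> = sets borel \<and>
     (\<forall>h\<in>bcontfun. cinner \<Omega> (fcalc X h \<Omega>) = (\<integral>z. h z \<partial>\<mu>))"


section \<open>Monotone independence\<close>

definition op_prod :: "('h \<Rightarrow> 'h) list \<Rightarrow> 'h \<Rightarrow> 'h" where
  "op_prod Xs = foldr (\<circ>) Xs id"

text \<open>The tuples \<open>\<epsilon>\<close> and \<open>X\<close> of length \<open>k\<close> are lists; \<^const>\<open>distinct_adj\<close> says that adjacent
  entries differ.\<close>

definition monotone_independent ::
  "'h::complex_hilbert \<Rightarrow> ('h \<Rightarrow> 'h) set \<Rightarrow> ('h \<Rightarrow> 'h) set \<Rightarrow> bool" where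
  "monotone_independent \<Omega> A1 A2 \<longleftrightarrow>
     (\<forall>(\<epsilon>::nat list) Xs. set \<epsilon> \<subseteq> {1, 2} \<and> distinct_adj \<epsilon> \<and> length Xs = length \<epsilon> \<and>
        (\<forall>\<kappa><length \<epsilon>. Xs ! \<kappa> \<in> (if \<epsilon> ! \<kappa> = 1 then A1 else A2)) \<longrightarrow>
        cinner \<Omega> (op_prod Xs \<Omega>) =
          cinner \<Omega> (op_prod [X. (e, X) \<leftarrow> zip \<epsilon> Xs, e = 1] \<Omega>) *
          (\<Prod>\<kappa> | \<kappa> < length \<epsilon> \<and> \<epsilon> ! \<kappa> = 2. cinner \<Omega> ((Xs ! \<kappa>) \<Omega>)))"

definition alg0 :: "('h::complex_hilbert \<times> 'h) set \<Rightarrow> ('h \<Rightarrow> 'h) set" where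
  "alg0 X = {fcalc X h | h. h \<in> bcontfun \<and> h 0 = 0}"

definition monotone_independent_operators ::
  "'h::complex_hilbert \<Rightarrow> ('h \<times> 'h) set \<Rightarrow> ('h \<times> 'h) set \<Rightarrow> bool" where
  "monotone_independent_operators \<Omega> X Y \<longleftrightarrow> monotone_independent \<Omega> (alg0 X) (alg0 Y)"

inductive_set alg :: "('h::complex_hilbert \<Rightarrow> 'h) set \<Rightarrow> ('h \<Rightarrow> 'h) set"
  for S :: "('h \<Rightarrow> 'h) set" where
  gen: "A \<in> S \<Longrightarrow> A \<in> alg S"
| zero: "(\<lambda>v. 0) \<in> alg S"
| add: "A \<in> alg S \<Longrightarrow> B \<in> alg S \<Longrightarrow> (\<lambda>v. A v + B v) \<in> alg S"
| scale: "A \<in> alg S \<Longrightarrow> (\<lambda>v. c *\<^sub>C A v) \<in> alg S"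
| mult: "A \<in> alg S \<Longrightarrow> B \<in> alg S \<Longrightarrow> A \<circ> B \<in> alg S"

definition alg_of ::
  "('h::complex_hilbert \<times> 'h) set \<Rightarrow> ('h \<times> 'h) set \<Rightarrow> ('h \<Rightarrow> 'h) set" where
  "alg_of X Y = alg ({fcalc X h | h. h \<in> bcontfun} \<union> {fcalc Y h | h. h \<in> bcontfun})"


section \<open>Operators on square-integrable functions\<close>

text \<open>Elements of $L^2$ are represented by functions. An isometry \<open>W\<close> in the sense below
  is linear and norm preserving, so it identifies functions that agree almost everywhere.\<close>

definition L2 :: "'a measure \<Rightarrow> ('a \<Rightarrow> complex) set" where
  "L2 M = {f \<in> borel_measurable M. integrable M (\<lambda>x. (cmod (f x))\<^sup>2)}"

definition L2_isometry :: "'a measure \<Rightarrow> (('a \<Rightarrow> complex) \<Rightarrow> 'h::complex_hilbert) \<Rightarrow> bool" where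
  "L2_isometry M W \<longleftrightarrow>
     (\<forall>\<phi>\<in>L2 M. \<forall>\<psi>\<in>L2 M. W (\<lambda>x. \<phi> x + \<psi> x) = W \<phi> + W \<psi>) \<and>
     (\<forall>c. \<forall>\<psi>\<in>L2 M. W (\<lambda>x. c * \<psi> x) = c *\<^sub>C W \<psi>) \<and>
     (\<forall>\<psi>\<in>L2 M. (norm (W \<psi>))\<^sup>2 = (\<integral>x. (cmod (\<psi> x))\<^sup>2 \<partial>M))"

definition L2_unitary :: "'a measure \<Rightarrow> (('a \<Rightarrow> complex) \<Rightarrow> 'h::complex_hilbert) \<Rightarrow> bool" where
  "L2_unitary M W \<longleftrightarrow> L2_isometry M W \<and> W ` L2 M = UNIV"

text \<open>The adjoint $W^* u$ is an element of $L^2$, so the function representing it is only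
  determined up to equality almost everywhere.\<close>

definition L2_adjoint ::
  "'a measure \<Rightarrow> (('a \<Rightarrow> complex) \<Rightarrow> 'h::complex_hilbert) \<Rightarrow> 'h \<Rightarrow> 'a \<Rightarrow> complex" where
  "L2_adjoint M W u =
     (SOME \<phi>. \<phi> \<in> L2 M \<and> (\<forall>\<eta>\<in>L2 M. (\<integral>x. cnj (\<eta> x) * \<phi> x \<partial>M) = cinner (W \<eta>) u))"

end

theory Submission
  imports Defs
begin

text \<open>The map \<open>W\<close> is determined by sending a tensor $f \<otimes> g$ of bounded continuous functions to
  $g(Y) f(X) \<Omega>$. Monotone independence computes the expectations
  $\langle \<Omega>, f(X) g(Y) h(X) \<Omega> \rangle = \int f h \, d\<mu> \cdot \int g \, d\<nu>$
  (\<open>expectation_FEF\<close>), and these are the inner products of such vectors. Hence the assignment is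
  isometric, and it extends to all of $L^2$ because the tensors span a dense subspace
  (\<open>D_dense\<close>). That $g(Y)$ becomes multiplication by $g(y)$ is built into the definition. For \<open>X\<close>
  the decisive fact is \<open>F_E_F\<close>: if $h(0) = 0$, then
  $h(X) g(Y) f(X) \<Omega> = \int g \, d\<nu> \cdot h(X) f(X) \<Omega>$, since the squared norm of the
  difference is the expectation of a word in which letters of \<open>Y\<close> with mean 0 occur. So $h(X)$
  integrates out \<open>y\<close> and multiplies by $h(x)$, and a constant has to be treated separately. The range
  of \<open>W\<close> is closed, contains \<open>\<Omega>\<close> and is invariant under both operators; conversely it is
  the closed span of the vectors $g(Y) f(X) \<Omega>$. So it is the closure of the algebra applied to \<open>\<Omega>\<close>.

  All of this uses the algebraic laws of the functional calculus, hence its existence, which is the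
  spectral theorem for unbounded normal operators (\<open>is_functional_calculus_fcalc\<close>). The operators
  $T = (1 + X^* X)^{-1}$ and $S = X T$ are bounded, \<open>S\<close> is normal and commutes with \<open>T\<close>, and
  $S^* S = T - T^2$. So the real part of \<open>S\<close>, its imaginary part and \<open>T\<close> are commuting
  self-adjoint operators that satisfy the equation of the sphere of which $z \mapsto (z, 1) / (1 + |z|^2)$
  parametrises all points but one. A polynomial in them that is nonnegative on the plane is a
  positive operator (\<open>rep_pos\<close>): otherwise unit vectors that are approximate eigenvectors for all
  three operators would locate a point of the sphere where the polynomial is negative. This
  makes the polynomial calculus contractive for the supremum norm, and the Stone--Weierstrass theorem
  extends it to continuous functions on the sphere. A bounded continuous \<open>f\<close> on the plane need not extend
  continuously to the point at infinity, but $f(z) / (1 + |z|^2)$ does; the operator that belongs to this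
  product is $f(X) T$, which determines $f(X)$ because \<open>T\<close> has dense range.\<close>

section \<open>Orthogonal projection\<close>

text \<open>A minimising sequence is Cauchy by the parallelogram law, and varying the minimiser
  within the subspace yields orthogonality.\<close>

lemma closed_subspace_projection:
  fixes S :: "'a::{real_inner,complete_space} set"
  assumes "subspace S" "closed S"
  obtains p where "p \<in> S" "\<And>s. s \<in> S \<Longrightarrow> (x - p) \<bullet> s = 0"
proof -
  define D where "D = (INF s\<in>S. (norm (x - s))\<^sup>2)"
  have bdd: "bdd_below ((\<lambda>s. (norm (x - s))\<^sup>2) ` S)"
    by (rule bdd_belowI[of _ 0]) auto
  have ne: "S \<noteq> {}" using assms(1) subspace_0 by blast
  have D_le: "D \<le> (norm (x - s))\<^sup>2" if "s \<in> S" for s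
    unfolding D_def by (rule cINF_lower[OF bdd that])
  have "\<exists>s\<in>S. (norm (x - s))\<^sup>2 < D + inverse (real (Suc n))" for n
  proof -
    have "(INF s\<in>S. (norm (x - s))\<^sup>2) < D + inverse (real (Suc n))"
      unfolding D_def[symmetric] by (simp del: of_nat_Suc)
    then show ?thesis by (simp only: cINF_less_iff[OF ne bdd])
  qed
  then obtain q where q: "\<And>n. q n \<in> S" "\<And>n. (norm (x - q n))\<^sup>2 < D + inverse (real (Suc n))"
    by metis
  have mid: "(norm (q m - q n))\<^sup>2 \<le> 2 * inverse (real (Suc m)) + 2 * inverse (real (Suc n))" for m n
  proof -
    have "(1/2) *\<^sub>R (q m + q n) \<in> S"
      using q(1) assms(1) by (simp add: subspace_add subspace_mul)
    from D_le[OF this] have "4 * D \<le> 4 * (norm (x - (1/2) *\<^sub>R (q m + q n)))\<^sup>2" by simp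
    also have "\<dots> = 2 * (norm (x - q m))\<^sup>2 + 2 * (norm (x - q n))\<^sup>2 - (norm (q m - q n))\<^sup>2"
    proof -
      define a b where "a = x - q m" and "b = x - q n"
      have "a + b = 2 *\<^sub>R x - (q m + q n)" by (simp add: a_def b_def scaleR_2)
      then have 1: "x - (1/2) *\<^sub>R (q m + q n) = (1/2) *\<^sub>R (a + b)"
        by (simp add: scaleR_right_diff_distrib)
      have 2: "q m - q n = b - a" by (simp add: a_def b_def)
      show ?thesis unfolding 1 2 a_def[symmetric] b_def[symmetric]
        by (simp add: power2_norm_eq_inner inner_simps power_divide inner_commute)
    qed
    finally show ?thesis using q(2)[of m] q(2)[of n] by linarith
  qed
  have "Cauchy q"
  proof (rule metric_CauchyI)
    fix e :: real assume e: "0 < e"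
    obtain N where N: "inverse (real (Suc N)) < e\<^sup>2 / 4"
      using reals_Archimedean[of "e\<^sup>2 / 4"] e by auto
    show "\<exists>M. \<forall>m\<ge>M. \<forall>n\<ge>M. dist (q m) (q n) < e"
    proof (intro exI[of _ N] allI impI)
      fix m n assume "N \<le> m" "N \<le> n"
      then have "inverse (real (Suc m)) \<le> inverse (real (Suc N))"
        "inverse (real (Suc n)) \<le> inverse (real (Suc N))"
        by (auto intro!: le_imp_inverse_le)
      then have "(norm (q m - q n))\<^sup>2 < e\<^sup>2" using mid[of m n] N by linarith
      then show "dist (q m) (q n) < e"
        using e by (simp add: dist_norm power_less_imp_less_base)
    qed
  qed
  then obtain p where p: "q \<longlonglongrightarrow> p" using Cauchy_convergent convergent_def by blast
  have pS: "p \<in> S" using closed_sequentially[OF assms(2)] q(1) p by blast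
  have lim1: "(\<lambda>n. D + inverse (real (Suc n))) \<longlonglongrightarrow> D + 0"
    by (intro tendsto_intros LIMSEQ_inverse_real_of_nat)
  have lim2: "(\<lambda>n. (norm (x - q n))\<^sup>2) \<longlonglongrightarrow> (norm (x - p))\<^sup>2"
    by (intro tendsto_intros p)
  have "(norm (x - p))\<^sup>2 \<le> D + 0"
    by (rule LIMSEQ_le[OF lim2 lim1]) (intro exI[of _ 0] allI impI less_imp_le q(2))
  then have pD: "(norm (x - p))\<^sup>2 \<le> D" by simp
  have "(x - p) \<bullet> s = 0" if s: "s \<in> S" for s
  proof (cases "s = 0")
    case False
    define u where "u = x - p"
    define r where "r = (u \<bullet> s) / (s \<bullet> s)"
    have ss: "s \<bullet> s > 0" using False by simp
    have "p + r *\<^sub>R s \<in> S" using pS s assms(1) by (simp add: subspace_add subspace_mul)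
    from D_le[OF this] pD have "(norm (x - p))\<^sup>2 \<le> (norm (u - r *\<^sub>R s))\<^sup>2"
      unfolding u_def diff_diff_eq by linarith
    also have "\<dots> = (norm u)\<^sup>2 - 2 * r * (u \<bullet> s) + r * r * (s \<bullet> s)"
      unfolding power2_norm_eq_inner
      by (simp add: inner_diff_left inner_diff_right inner_commute)
    also have "r * r * (s \<bullet> s) = r * (u \<bullet> s)" using ss by (simp add: r_def)
    finally have "r * (u \<bullet> s) \<le> 0" unfolding u_def[symmetric] by linarith
    then have "(u \<bullet> s)\<^sup>2 / (s \<bullet> s) \<le> 0" by (simp add: r_def power2_eq_square)
    then show ?thesis using ss by (simp add: divide_le_0_iff u_def)
  qed auto
  with pS show ?thesis using that by blast
qed

section \<open>Commuting bounded self-adjoint operators\<close>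

text \<open>Only the real inner product is used. A complex linear operator is self-adjoint as
  soon as it is symmetric for the real part of the inner product, so the real theory is
  sufficient and keeps complex scalars out of the estimates.\<close>

definition selfadj :: "('h::real_inner \<Rightarrow>\<^sub>L 'h) \<Rightarrow> bool" where
  "selfadj A \<longleftrightarrow> (\<forall>x y. A x \<bullet> y = x \<bullet> A y)"

definition pos_op :: "('h::real_inner \<Rightarrow>\<^sub>L 'h) \<Rightarrow> bool" where
  "pos_op A \<longleftrightarrow> (\<forall>x. 0 \<le> A x \<bullet> x)"

definition commuting :: "('h::real_inner \<Rightarrow>\<^sub>L 'h) \<Rightarrow> ('h \<Rightarrow>\<^sub>L 'h) \<Rightarrow> bool" where
  "commuting A B \<longleftrightarrow> (\<forall>x. A (B x) = B (A x))"

lemma selfadjD: "selfadj A \<Longrightarrow> A x \<bullet> y = x \<bullet> A y"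
  by (simp add: selfadj_def)

lemma pos_opD: "pos_op A \<Longrightarrow> 0 \<le> A x \<bullet> x"
  by (simp add: pos_op_def)

lemma commutingD: "commuting A B \<Longrightarrow> A (B x) = B (A x)"
  by (simp add: commuting_def)

lemma commuting_sym: "commuting A B \<Longrightarrow> commuting B A"
  by (simp add: commuting_def)

lemma selfadj_intros:
  "selfadj id_blinfun"
  "selfadj A \<Longrightarrow> selfadj (c *\<^sub>R A)"
  "selfadj A \<Longrightarrow> selfadj B \<Longrightarrow> selfadj (A + B)"
  "selfadj A \<Longrightarrow> selfadj B \<Longrightarrow> selfadj (A - B)"
  "selfadj A \<Longrightarrow> selfadj B \<Longrightarrow> commuting A B \<Longrightarrow> selfadj (A o\<^sub>L B)"
  by (auto simp: selfadj_def commuting_def blinfun.bilinear_simps inner_simps)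

lemma commuting_intros:
  "commuting id_blinfun C" "commuting C id_blinfun" "commuting C C"
  "commuting A C \<Longrightarrow> commuting (c *\<^sub>R A) C"
  "commuting A C \<Longrightarrow> commuting B C \<Longrightarrow> commuting (A + B) C"
  "commuting A C \<Longrightarrow> commuting B C \<Longrightarrow> commuting (A - B) C"
  "commuting A C \<Longrightarrow> commuting B C \<Longrightarrow> commuting (A o\<^sub>L B) C"
  "commuting C A \<Longrightarrow> commuting C (c *\<^sub>R A)"
  "commuting C A \<Longrightarrow> commuting C B \<Longrightarrow> commuting C (A + B)"
  "commuting C A \<Longrightarrow> commuting C B \<Longrightarrow> commuting C (A - B)"
  "commuting C A \<Longrightarrow> commuting C B \<Longrightarrow> commuting C (A o\<^sub>L B)"
  by (auto simp: commuting_def blinfun.bilinear_simps)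

lemma blinfun_norm_le: "norm A \<le> K \<Longrightarrow> norm (blinfun_apply A x) \<le> K * norm x"
  by (rule order_trans[OF norm_blinfun]) (simp add: mult_right_mono)

text \<open>This is a case of the Cauchy--Schwarz inequality for the form \<open>P x \<bullet> y\<close>; it comes
  from evaluating the form at $x - P x / K$.\<close>

lemma pos_op_norm_sq_le:
  assumes "selfadj P" "pos_op P" "norm P \<le> K" "0 < K"
  shows "(norm (P x))\<^sup>2 \<le> K * (P x \<bullet> x)"
proof -
  let ?y = "P x"
  have 1: "P ?y \<bullet> ?y \<le> K * (norm ?y)\<^sup>2"
  proof -
    have "P ?y \<bullet> ?y \<le> norm (P ?y) * norm ?y" by (rule norm_cauchy_schwarz)
    also have "\<dots> \<le> (K * norm ?y) * norm ?y"
      by (intro mult_right_mono blinfun_norm_le assms) auto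
    finally show ?thesis by (simp add: power2_eq_square)
  qed
  have "0 \<le> P (x - (1/K) *\<^sub>R ?y) \<bullet> (x - (1/K) *\<^sub>R ?y)" by (rule pos_opD[OF assms(2)])
  also have "\<dots> = P x \<bullet> x - 2 / K * (norm ?y)\<^sup>2 + 1 / K\<^sup>2 * (P ?y \<bullet> ?y)"
    using selfadjD[OF assms(1), of ?y x] assms(4) unfolding power2_norm_eq_inner
    by (simp add: blinfun.diff_right blinfun.scaleR_right inner_diff_left inner_diff_right power2_eq_square field_simps)
  also have "1 / K\<^sup>2 * (P ?y \<bullet> ?y) \<le> 1 / K\<^sup>2 * (K * (norm ?y)\<^sup>2)"
    using 1 by (intro mult_left_mono) auto
  also have "\<dots> = 1 / K * (norm ?y)\<^sup>2" using assms(4) by (simp add: power2_eq_square)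
  finally have "1 / K * (norm ?y)\<^sup>2 \<le> P x \<bullet> x" by (simp add: field_simps)
  then show ?thesis using assms(4) by (simp add: field_simps)
qed

text \<open>With \<open>P\<close> scaled to $0 \le P \le 1$, the recursion $P_{n+1} = P_n - P_n^2$ expands
  $P = \sum_n P_n^2$, so that $QP = \sum_n P_n Q P_n$ is a sum of positive operators. This avoids
  square roots.\<close>

lemma pos_op_compose_contraction:
  assumes P: "selfadj P" "pos_op P" "norm P \<le> 1" and Q: "pos_op Q" and PQ: "commuting P Q"
  shows "0 \<le> Q (P x) \<bullet> x"
proof -
  define S where "S n = ((\<lambda>R. R - (R o\<^sub>L R)) ^^ n) P" for n
  have S0: "S 0 = P" and SS: "S (Suc n) = S n - (S n o\<^sub>L S n)" for n
    by (simp_all add: S_def)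
  have inv: "selfadj (S n) \<and> commuting (S n) Q \<and> (\<forall>y. 0 \<le> S n y \<bullet> y \<and> S n y \<bullet> y \<le> y \<bullet> y)" for n
  proof (induction n)
    case 0
    have "P y \<bullet> y \<le> y \<bullet> y" for y
    proof -
      have "P y \<bullet> y \<le> norm (P y) * norm y" by (rule norm_cauchy_schwarz)
      also have "\<dots> \<le> norm y * norm y"
        using blinfun_norm_le[OF P(3), of y] by (intro mult_right_mono) auto
      finally show ?thesis by (simp add: power2_norm_eq_inner[symmetric] power2_eq_square)
    qed
    with P PQ show ?case by (simp add: S0 pos_opD)
  next
    case (Suc n)
    then have sa: "selfadj (S n)" and cm: "commuting (S n) Q"
      and le: "\<And>y. 0 \<le> S n y \<bullet> y" "\<And>y. S n y \<bullet> y \<le> y \<bullet> y" by auto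
    have sa': "selfadj (S (Suc n))" unfolding SS by (intro selfadj_intros commuting_intros sa)
    have cm': "commuting (S (Suc n)) Q" unfolding SS by (intro commuting_intros cm)
    have eq: "S (Suc n) y \<bullet> y = S n y \<bullet> y - S n y \<bullet> S n y" for y
      using selfadjD[OF sa, of "S n y" y] by (simp add: SS blinfun.diff_left inner_diff_left)
    have "0 \<le> S (Suc n) y \<bullet> y" for y
    proof -
      have "S (Suc n) y \<bullet> y
        = (S n y \<bullet> S n y - S n (S n y) \<bullet> S n y) + S n (y - S n y) \<bullet> (y - S n y)"
        unfolding eq using selfadjD[OF sa, of "S n y" y]
        by (simp add: blinfun.diff_right inner_diff_left inner_diff_right)
      then show ?thesis using le(1)[of "y - S n y"] le(2)[of "S n y"] by linarith
    qed
    moreover have "S (Suc n) y \<bullet> y \<le> y \<bullet> y" for y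
      unfolding eq using le(2)[of y] inner_ge_zero[of "S n y"] by linarith
    ultimately show ?case using sa' cm' by blast
  qed
  then have sa: "\<And>n. selfadj (S n)" and cm: "\<And>n. commuting (S n) Q"
      and le: "\<And>n y. 0 \<le> S n y \<bullet> y" by auto
  have expand: "P x = (\<Sum>k<n. S k (S k x)) + S n x" for n
    by (induction n) (auto simp: S0 SS blinfun.bilinear_simps)
  have "(\<Sum>k<n. (norm (S k x))\<^sup>2) \<le> P x \<bullet> x" for n
  proof -
    have "P x \<bullet> x = (\<Sum>k<n. S k (S k x) \<bullet> x) + S n x \<bullet> x"
      by (subst expand[of n]) (simp add: inner_sum_left inner_simps)
    also have "(\<Sum>k<n. S k (S k x) \<bullet> x) = (\<Sum>k<n. (norm (S k x))\<^sup>2)"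
      by (simp add: power2_norm_eq_inner selfadjD[OF sa])
    finally show ?thesis using le[of n x] by simp
  qed
  then have "summable (\<lambda>k. (norm (S k x))\<^sup>2)"
    by (intro summableI_nonneg_bounded[of _ "P x \<bullet> x"]) auto
  then have "(\<lambda>k. (norm (S k x))\<^sup>2) \<longlonglongrightarrow> 0" by (rule summable_LIMSEQ_zero)
  then have "(\<lambda>k. sqrt ((norm (S k x))\<^sup>2)) \<longlonglongrightarrow> sqrt 0" by (intro tendsto_intros)
  then have Sx: "(\<lambda>k. S k x) \<longlonglongrightarrow> 0" by (simp add: tendsto_norm_zero_iff)
  have "Q (S n x) \<bullet> x \<le> Q (P x) \<bullet> x" for n
  proof -
    have "Q (P x) \<bullet> x = (\<Sum>k<n. Q (S k (S k x)) \<bullet> x) + Q (S n x) \<bullet> x"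
      by (subst expand[of n]) (simp add: inner_sum_left inner_simps blinfun.bilinear_simps blinfun.sum_right)
    also have "(\<Sum>k<n. Q (S k (S k x)) \<bullet> x) = (\<Sum>k<n. Q (S k x) \<bullet> S k x)"
      by (simp add: commutingD[OF cm, symmetric] selfadjD[OF sa])
    finally show ?thesis using sum_nonneg[of "{..<n}" "\<lambda>k. Q (S k x) \<bullet> S k x"] pos_opD[OF Q]
      by simp
  qed
  moreover have "(\<lambda>n. Q (S n x) \<bullet> x) \<longlonglongrightarrow> Q 0 \<bullet> x"
    by (intro tendsto_intros Sx)
  ultimately show ?thesis
    using LIMSEQ_le_const2[of "\<lambda>n. Q (S n x) \<bullet> x" "Q 0 \<bullet> x" "Q (P x) \<bullet> x"] by (auto simp: blinfun.zero_right)
qed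

lemma pos_op_compose:
  assumes P: "selfadj P" "pos_op P" and Q: "pos_op Q" and PQ: "commuting P Q"
  shows "pos_op (Q o\<^sub>L P)"
  unfolding pos_op_def
proof
  fix x
  define c where "c = inverse (norm P + 1)"
  have c: "0 < c" by (auto simp: c_def add_nonneg_pos)
  have "norm (c *\<^sub>R P) \<le> 1" by (simp add: c_def divide_simps add_nonneg_pos add_nonneg_eq_0_iff)
  then have "0 \<le> Q ((c *\<^sub>R P) x) \<bullet> x"
    using P Q PQ c
    by (intro pos_op_compose_contraction selfadj_intros commuting_intros)
      (auto simp: pos_op_def blinfun.bilinear_simps)
  then have "0 \<le> c * ((Q o\<^sub>L P) x \<bullet> x)" by (simp add: blinfun.bilinear_simps)
  then show "0 \<le> (Q o\<^sub>L P) x \<bullet> x" using c by (simp add: zero_le_mult_iff)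
qed

text \<open>The bottom of the numerical range of a self-adjoint operator is an approximate eigenvalue.\<close>

lemma approx_eigenvalue:
  fixes F :: "'h::real_inner \<Rightarrow>\<^sub>L 'h"
  assumes F: "selfadj F" and neg: "F x0 \<bullet> x0 < 0"
  obtains l where "l < 0" "\<And>e. 0 < e \<Longrightarrow> \<exists>x. norm x = 1 \<and> norm (F x - l *\<^sub>R x) < e"
proof -
  define V where "V = {F x \<bullet> x |x. norm x = 1}"
  have lb: "- norm F \<le> v" if "v \<in> V" for v
  proof -
    obtain x where x: "v = F x \<bullet> x" "norm x = 1" using \<open>v \<in> V\<close> by (auto simp: V_def)
    have "\<bar>F x \<bullet> x\<bar> \<le> norm (F x) * norm x" by (rule Cauchy_Schwarz_ineq2)
    also have "\<dots> \<le> norm F" using norm_blinfun[of F x] x by simp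
    finally show ?thesis using x by simp
  qed
  have bdd: "bdd_below V" by (rule bdd_belowI) (rule lb)
  have x0: "x0 \<noteq> 0" using neg by auto
  have inV: "F x \<bullet> x / (norm x)\<^sup>2 \<in> V" if "x \<noteq> 0" for x
    using that unfolding V_def
    by (auto intro!: exI[of _ "x /\<^sub>R norm x"] simp: blinfun.bilinear_simps power2_eq_square field_simps)
  define l where "l = Inf V"
  have "l \<le> F x0 \<bullet> x0 / (norm x0)\<^sup>2"
    unfolding l_def by (rule cInf_lower[OF inV[OF x0] bdd])
  also have "\<dots> < 0" using neg x0 by (simp add: divide_neg_pos)
  finally have l: "l < 0" .
  define P where "P = F - l *\<^sub>R id_blinfun"
  have saP: "selfadj P" unfolding P_def by (intro selfadj_intros F)
  have Px: "P x = F x - l *\<^sub>R x" for x by (simp add: P_def blinfun.bilinear_simps)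
  have posP: "pos_op P" unfolding pos_op_def
  proof
    fix x show "0 \<le> P x \<bullet> x"
    proof (cases "x = 0")
      case False
      have "l \<le> F x \<bullet> x / (norm x)\<^sup>2" unfolding l_def by (rule cInf_lower[OF inV[OF False] bdd])
      then show ?thesis using False
        by (simp add: Px inner_simps field_simps power2_norm_eq_inner)
    qed (simp add: blinfun.bilinear_simps)
  qed
  have "\<exists>x. norm x = 1 \<and> norm (F x - l *\<^sub>R x) < e" if e: "0 < e" for e
  proof -
    let ?K = "norm P + 1"
    have K: "0 < ?K" by (simp add: add_nonneg_pos)
    have "Inf V < l + e\<^sup>2 / ?K" using e K by (simp add: l_def)
    then obtain v where "v \<in> V" "v < l + e\<^sup>2 / ?K" using cInf_lessD[of V] inV[OF x0] by blast
    then obtain x where x: "norm x = 1" "F x \<bullet> x < l + e\<^sup>2 / ?K" by (auto simp: V_def)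
    have "P x \<bullet> x < e\<^sup>2 / ?K" using x by (simp add: Px inner_simps power2_norm_eq_inner[symmetric])
    then have "?K * (P x \<bullet> x) < e\<^sup>2" using K by (simp add: field_simps)
    moreover have "(norm (P x))\<^sup>2 \<le> ?K * (P x \<bullet> x)" by (rule pos_op_norm_sq_le[OF saP posP _ K]) simp
    ultimately have "(norm (P x))\<^sup>2 < e\<^sup>2" by linarith
    then have "norm (P x) < e" using e by (simp add: power_less_imp_less_base)
    then show ?thesis using x by (auto simp: Px)
  qed
  with l show ?thesis using that by blast
qed

text \<open>At an approximate eigenvector of \<open>F\<close> with eigenvalue $l < 0$ the form of \<open>F G\<close> would
  be close to $l \langle G x, x \rangle \le l c < 0$.\<close>

lemma pos_op_cancel:
  assumes F: "selfadj F" and G: "selfadj G" "\<And>x. c * (x \<bullet> x) \<le> G x \<bullet> x" "0 < c"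
    and FG: "commuting F G" "pos_op (F o\<^sub>L G)"
  shows "pos_op F"
proof (rule ccontr)
  assume "\<not> pos_op F"
  then obtain x0 where "F x0 \<bullet> x0 < 0" by (auto simp: pos_op_def not_le)
  then obtain l where l: "l < 0" "\<And>e. 0 < e \<Longrightarrow> \<exists>x. norm x = 1 \<and> norm (F x - l *\<^sub>R x) < e"
    using approx_eigenvalue[OF F] by metis
  define e where "e = - l * c / (norm G + 1)"
  have K: "0 < norm G + 1" by (simp add: add_nonneg_pos)
  then have "0 < e" unfolding e_def using l(1) G(3) by (intro divide_pos_pos mult_pos_pos K) auto
  then obtain x where x: "norm x = 1" "norm (F x - l *\<^sub>R x) < e" using l(2) by blast
  have "0 \<le> F (G x) \<bullet> x" using pos_opD[OF FG(2), of x] by simp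
  also have "\<dots> = G x \<bullet> (F x - l *\<^sub>R x) + l * (G x \<bullet> x)"
    by (simp add: selfadjD[OF F] inner_simps)
  also have "\<dots> \<le> norm G * e + l * c"
  proof (rule add_mono)
    have "G x \<bullet> (F x - l *\<^sub>R x) \<le> norm (G x) * norm (F x - l *\<^sub>R x)" by (rule norm_cauchy_schwarz)
    also have "\<dots> \<le> norm G * e"
      using norm_blinfun[of G x] x by (intro mult_mono) auto
    finally show "G x \<bullet> (F x - l *\<^sub>R x) \<le> norm G * e" .
    show "l * (G x \<bullet> x) \<le> l * c"
      using G(2)[of x] l(1) x(1) by (simp add: power2_norm_eq_inner[symmetric] mult_left_mono_neg)
  qed
  also have "\<dots> = - e" using K by (simp add: e_def field_simps)
  finally show False using \<open>0 < e\<close> by simp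
qed

text \<open>Vectors that \<open>N\<close> almost annihilates can be chosen so that \<open>A\<close> is in addition almost scalar on
  them. Modulo \<open>N\<close>, the number \<open>a\<close> found here is the top of the spectrum of \<open>A\<close>: it is the
  infimum of all \<open>r\<close> with $A \le r + kN$ for some \<open>k\<close>. Were $N + (A - a)^2$ bounded below, the
  difference-of-squares estimate for $D + k'N \mp c$, $D = r - A$, would allow to lower \<open>r\<close>
  below \<open>a\<close>.\<close>

lemma joint_approx_eigenvalue:
  fixes N A :: "'h::real_inner \<Rightarrow>\<^sub>L 'h"
  assumes N: "selfadj N" "pos_op N" and A: "selfadj A" and NA: "commuting N A"
    and small: "\<And>e. 0 < e \<Longrightarrow> \<exists>x. norm x = 1 \<and> N x \<bullet> x < e"
  obtains a where "\<And>e. 0 < e \<Longrightarrow> \<exists>x. norm x = 1 \<and> N x \<bullet> x + (norm (A x - a *\<^sub>R x))\<^sup>2 < e"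
proof -
  define H where "H r k = r *\<^sub>R id_blinfun + k *\<^sub>R N - A" for r k
  have Hx: "H r k x = r *\<^sub>R x + k *\<^sub>R N x - A x" for r k x
    by (simp add: H_def blinfun.bilinear_simps)
  define S where "S = {r. \<exists>k\<ge>0. pos_op (H r k)}"
  have absA: "\<bar>A x \<bullet> x\<bar> \<le> norm A * (norm x)\<^sup>2" for x
    using Cauchy_Schwarz_ineq2[of "A x" x] mult_right_mono[OF norm_blinfun[of A x] norm_ge_zero[of x]]
    by (simp add: power2_eq_square mult.assoc)
  have "pos_op (H (norm A) 0)" unfolding pos_op_def
  proof
    fix x show "0 \<le> H (norm A) 0 x \<bullet> x"
      using absA[of x] by (simp add: Hx inner_diff_left power2_norm_eq_inner)
  qed
  then have "norm A \<in> S" by (auto simp: S_def)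
  then have ne: "S \<noteq> {}" by auto
  have lb: "- norm A \<le> r" if "r \<in> S" for r
  proof (rule ccontr)
    assume *: "\<not> - norm A \<le> r"
    obtain k where k: "k \<ge> 0" "pos_op (H r k)" using \<open>r \<in> S\<close> by (auto simp: S_def)
    define e where "e = (- norm A - r) / (k + 1)"
    have e: "0 < e" using * k by (simp add: e_def)
    obtain x where x: "norm x = 1" "N x \<bullet> x < e" using small[OF e] by blast
    have "0 \<le> r + k * (N x \<bullet> x) - A x \<bullet> x"
      using pos_opD[OF k(2), of x] x(1)
      by (simp add: Hx inner_diff_left inner_add_left power2_norm_eq_inner[symmetric])
    also have "\<dots> \<le> r + k * e + norm A"
      using x absA[of x] k(1) mult_left_mono[of "N x \<bullet> x" e k] by simp
    also have "k * e < - norm A - r"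
    proof -
      have "k * e < (k + 1) * e" using e by simp
      also have "\<dots> = - norm A - r" using k(1) by (simp add: e_def)
      finally show ?thesis .
    qed
    finally show False by simp
  qed
  have bdd: "bdd_below S" by (rule bdd_belowI) (rule lb)
  define a where "a = Inf S"
  have "\<exists>x. norm x = 1 \<and> N x \<bullet> x + (norm (A x - a *\<^sub>R x))\<^sup>2 < e" if "0 < e" for e
  proof (rule ccontr)
    assume "\<not> ?thesis"
    then have ge1: "e \<le> N x \<bullet> x + (norm (A x - a *\<^sub>R x))\<^sup>2" if "norm x = 1" for x
      using that by force
    have ge: "e * (norm x)\<^sup>2 \<le> N x \<bullet> x + (norm (A x - a *\<^sub>R x))\<^sup>2" for x
    proof (cases "x = 0")
      case False
      define y where "y = x /\<^sub>R norm x"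
      have xy: "x = norm x *\<^sub>R y" "norm y = 1" using False by (auto simp: y_def)
      define s where "s = norm x"
      have "N x \<bullet> x + (norm (A x - a *\<^sub>R x))\<^sup>2 = s\<^sup>2 * (N y \<bullet> y + (norm (A y - a *\<^sub>R y))\<^sup>2)"
      proof -
        have "A x - a *\<^sub>R x = s *\<^sub>R (A y - a *\<^sub>R y)" "N x \<bullet> x = s\<^sup>2 * (N y \<bullet> y)"
          using xy(1) unfolding s_def[symmetric]
          by (simp_all add: blinfun.bilinear_simps scaleR_diff_right power2_eq_square)
        then show ?thesis by (simp add: power_mult_distrib distrib_left)
      qed
      then show ?thesis using mult_left_mono[OF ge1[OF xy(2)], of "s\<^sup>2"] by (simp add: s_def mult.commute)
    qed (simp add: blinfun.bilinear_simps)
    \<comment> \<open>Replacing \<open>a\<close> by some \<open>r < a + d\<close> costs at most half of the lower bound $e = 4 c^2$, and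
      $d < c$ ensures that $r - c$ lies below \<open>a\<close>.\<close>
    define c where "c = sqrt e / 2"
    have c: "0 < c" "4 * c\<^sup>2 = e" using \<open>0 < e\<close> by (simp_all add: c_def power_divide)
    define M where "M = norm (A - a *\<^sub>R id_blinfun) + 1"
    have M: "0 < M" by (simp add: M_def add_nonneg_pos)
    define d where "d = min (c / 2) (c\<^sup>2 / M)"
    have "d \<le> c\<^sup>2 / M" "d \<le> c / 2"
      unfolding d_def by (rule min.cobounded2, rule min.cobounded1)
    then have d: "0 < d" "d < c" "2 * d * M \<le> 2 * c\<^sup>2"
      using c(1) M by (auto simp: d_def[symmetric] pos_le_divide_eq) (simp add: d_def)
    obtain r where r: "r \<in> S" "r < a + d"
      using cInf_lessD[OF ne, of "a + d"] d(1) by (auto simp: a_def)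
    have ar: "a \<le> r" unfolding a_def by (rule cInf_lower[OF r(1) bdd])
    obtain k where k: "k \<ge> 0" "pos_op (H r k)" using r(1) by (auto simp: S_def)
    define D where "D = r *\<^sub>R id_blinfun - A"
    have Dx: "D x = r *\<^sub>R x - A x" for x by (simp add: D_def blinfun.bilinear_simps)
    have D2: "2 * c\<^sup>2 * (norm x)\<^sup>2 \<le> N x \<bullet> x + (norm (D x))\<^sup>2" for x
    proof -
      define u where "u = A x - a *\<^sub>R x"
      have "u = (A - a *\<^sub>R id_blinfun) x" by (simp add: u_def blinfun.bilinear_simps)
      then have "norm u \<le> M * norm x"
        using norm_blinfun[of "A - a *\<^sub>R id_blinfun" x] by (simp add: M_def algebra_simps add_increasing)
      then have "u \<bullet> x \<le> M * (norm x)\<^sup>2"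
        using norm_cauchy_schwarz[of u x] mult_right_mono[of "norm u" "M * norm x" "norm x"]
        by (simp add: power2_eq_square)
      then have "2 * (r - a) * (u \<bullet> x) \<le> 2 * (r - a) * (M * (norm x)\<^sup>2)"
        using ar by (intro mult_left_mono) auto
      also have "\<dots> \<le> 2 * d * (M * (norm x)\<^sup>2)"
        using r(2) M by (intro mult_right_mono) auto
      also have "\<dots> \<le> 2 * c\<^sup>2 * (norm x)\<^sup>2"
        using mult_right_mono[OF d(3), of "(norm x)\<^sup>2"] by (simp add: mult.assoc)
      finally have 1: "2 * (r - a) * (u \<bullet> x) \<le> 2 * c\<^sup>2 * (norm x)\<^sup>2" .
      have "D x = (r - a) *\<^sub>R x - u" by (simp add: Dx u_def scaleR_diff_left)
      then have "(norm (D x))\<^sup>2 = (norm ((r - a) *\<^sub>R x - u))\<^sup>2" by simp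
      also have "\<dots> = (r - a)\<^sup>2 * (norm x)\<^sup>2 - 2 * (r - a) * (u \<bullet> x) + (norm u)\<^sup>2"
        unfolding power2_norm_eq_inner
        by (simp add: inner_diff_left inner_diff_right inner_commute[of x u] power2_eq_square algebra_simps)
      finally have "(norm u)\<^sup>2 - 2 * c\<^sup>2 * (norm x)\<^sup>2 \<le> (norm (D x))\<^sup>2"
        using 1 mult_nonneg_nonneg[OF zero_le_power2[of "r - a"] zero_le_power2[of "norm x"]] by linarith
      then show ?thesis using ge[of x] c(2)[symmetric] by (simp add: u_def algebra_simps)
    qed
    \<comment> \<open>With this \<open>m\<close> the terms in \<open>N\<close> that are left over at the end form the square of $c - m N$.\<close>
    define m where "m = 1 / (2 * c)"
    have m: "0 < m" "2 * c * m = 1" using c by (auto simp: m_def)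
    define k' where "k' = 2 * k + m"
    have k': "k \<le> k'" "0 \<le> k'" using k m by (auto simp: k'_def)
    have saD: "selfadj D" unfolding D_def by (intro selfadj_intros A)
    have cND: "commuting N D" unfolding D_def by (intro commuting_intros NA)
    define L where "L = D + k' *\<^sub>R N"
    have saL: "selfadj L" unfolding L_def by (intro selfadj_intros saD N)
    have Lx: "L x = D x + k' *\<^sub>R N x" for x by (simp add: L_def blinfun.bilinear_simps)
    have HD: "H r k = D + k *\<^sub>R N" by (simp add: H_def D_def algebra_simps)
    have DN: "0 \<le> D x \<bullet> N x + k * (norm (N x))\<^sup>2" for x
    proof -
      have "pos_op (H r k o\<^sub>L N)"
        by (rule pos_op_compose[OF N k(2)]) (auto simp: HD intro!: commuting_intros cND)
      from pos_opD[OF this, of x] show ?thesis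
        using selfadjD[OF saD, of "N x" x] selfadjD[OF N(1), of "N x" x]
        by (simp add: HD blinfun.bilinear_simps inner_add_left inner_add_right power2_norm_eq_inner inner_commute)
    qed
    have pos: "pos_op (L - c *\<^sub>R id_blinfun)"
    proof (rule pos_op_cancel)
      show "selfadj (L - c *\<^sub>R id_blinfun)" "selfadj (L + c *\<^sub>R id_blinfun)"
        by (intro selfadj_intros saL)+
      show "0 < c" by fact
      show "commuting (L - c *\<^sub>R id_blinfun) (L + c *\<^sub>R id_blinfun)"
        by (intro commuting_intros)
      show "c * (x \<bullet> x) \<le> (L + c *\<^sub>R id_blinfun) x \<bullet> x" for x
      proof -
        have "0 \<le> D x \<bullet> x + k * (N x \<bullet> x)"
          using pos_opD[OF k(2), of x] by (simp add: HD blinfun.bilinear_simps inner_add_left)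
        also have "\<dots> \<le> D x \<bullet> x + k' * (N x \<bullet> x)"
          using k'(1) pos_opD[OF N(2), of x] by (simp add: mult_right_mono)
        finally show ?thesis by (simp add: Lx blinfun.bilinear_simps inner_add_left)
      qed
      show "pos_op ((L - c *\<^sub>R id_blinfun) o\<^sub>L (L + c *\<^sub>R id_blinfun))" unfolding pos_op_def
      proof
        fix x
        have "((L - c *\<^sub>R id_blinfun) o\<^sub>L (L + c *\<^sub>R id_blinfun)) x \<bullet> x = L (L x) \<bullet> x - c\<^sup>2 * (x \<bullet> x)"
          by (simp add: blinfun.bilinear_simps inner_add_left inner_diff_left power2_eq_square algebra_simps)
        also have "L (L x) \<bullet> x = (norm (D x + k' *\<^sub>R N x))\<^sup>2"
          by (simp only: selfadjD[OF saL, of "blinfun_apply L x" x] power2_norm_eq_inner Lx[symmetric])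
        also have "\<dots> = (norm (D x))\<^sup>2 + 2 * k' * (D x \<bullet> N x) + k'\<^sup>2 * (norm (N x))\<^sup>2"
          unfolding power2_norm_eq_inner
          by (simp add: inner_add_left inner_add_right inner_commute[of "N x" "D x"] power2_eq_square algebra_simps)
        finally have e1: "((L - c *\<^sub>R id_blinfun) o\<^sub>L (L + c *\<^sub>R id_blinfun)) x \<bullet> x
          = (norm (D x))\<^sup>2 + 2 * k' * (D x \<bullet> N x) + k'\<^sup>2 * (norm (N x))\<^sup>2 - c\<^sup>2 * (x \<bullet> x)" .
        have i1: "2 * k' * (- k * (norm (N x))\<^sup>2) \<le> 2 * k' * (D x \<bullet> N x)"
          using DN[of x] k'(2) by (intro mult_left_mono) auto
        have i2: "2 * k' * (- k * (norm (N x))\<^sup>2) = - (k'\<^sup>2 * (norm (N x))\<^sup>2) + m\<^sup>2 * (norm (N x))\<^sup>2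
            + 2 * k * m * (norm (N x))\<^sup>2"
          by (simp add: k'_def power2_eq_square algebra_simps)
        have i3: "2 * k * m * (norm (N x))\<^sup>2 \<ge> 0" using k m by simp
        have 1: "(norm (D x))\<^sup>2 + m\<^sup>2 * (norm (N x))\<^sup>2 - c\<^sup>2 * (x \<bullet> x)
          \<le> ((L - c *\<^sub>R id_blinfun) o\<^sub>L (L + c *\<^sub>R id_blinfun)) x \<bullet> x"
          using i1 i3 unfolding e1 i2 by linarith
        have "0 \<le> (norm (c *\<^sub>R x - m *\<^sub>R N x))\<^sup>2" by simp
        also have "\<dots> = c\<^sup>2 * (norm x)\<^sup>2 - (2 * c * m) * (N x \<bullet> x) + m\<^sup>2 * (norm (N x))\<^sup>2"
          unfolding power2_norm_eq_inner
          by (simp add: inner_diff_left inner_diff_right inner_commute[of x "N x"] power2_eq_square algebra_simps)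
        finally have "0 \<le> c\<^sup>2 * (norm x)\<^sup>2 - N x \<bullet> x + m\<^sup>2 * (norm (N x))\<^sup>2" by (simp add: m(2))
        then show "0 \<le> ((L - c *\<^sub>R id_blinfun) o\<^sub>L (L + c *\<^sub>R id_blinfun)) x \<bullet> x"
          using D2[of x] 1 by (simp add: power2_norm_eq_inner[symmetric])
      qed
    qed
    have "L - c *\<^sub>R id_blinfun = H (r - c) k'"
      by (simp add: L_def D_def H_def algebra_simps scaleR_diff_left)
    then have "r - c \<in> S" using pos k'(2) by (auto simp: S_def)
    then have "a \<le> r - c" unfolding a_def by (rule cInf_lower[OF _ bdd])
    then show False using r(2) d(2) by simp
  qed
  then show ?thesis using that by blast
qed

section \<open>Continuous functions of a commuting triple on the Riemann sphere\<close>

text \<open>The point of the sphere that corresponds to \<open>z\<close> has the coordinates \<open>tau z\<close> and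
  $z \cdot$ \<open>tau z\<close>; the point at infinity is the origin.\<close>

definition tau :: "complex \<Rightarrow> real" where
  "tau z = inverse (1 + (cmod z)\<^sup>2)"

lemma tau_pos: "0 < tau z" and tau_le: "tau z \<le> 1"
  by (auto simp: tau_def add_pos_nonneg intro!: inverse_le_1_iff[THEN iffD2])

lemma tau_continuous: "continuous_on S tau"
proof -
  have "1 + (cmod z)\<^sup>2 \<noteq> 0" for z
    by (metis add_pos_nonneg less_irrefl zero_le_power2 zero_less_one)
  then show ?thesis unfolding tau_def[abs_def] by (intro continuous_intros) auto
qed

lemma tau_norm_le: "cmod z * tau z \<le> inverse (cmod z)"
proof (cases "z = 0")
  case False
  then show ?thesis by (simp add: tau_def divide_simps add_pos_nonneg power2_eq_square)
qed simp

lemma tau_at_infinity: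
  "(tau \<longlongrightarrow> 0) at_infinity" "((\<lambda>z. Re z * tau z) \<longlongrightarrow> 0) at_infinity" "((\<lambda>z. Im z * tau z) \<longlongrightarrow> 0) at_infinity"
proof -
  have inv: "((\<lambda>z::complex. inverse (cmod z)) \<longlongrightarrow> 0) at_infinity"
    by (intro tendsto_inverse_0_at_top filterlim_norm_at_top)
  have inf: "eventually (\<lambda>z::complex. 1 \<le> cmod z) at_infinity"
    by (auto simp: eventually_at_infinity)
  show "(tau \<longlongrightarrow> 0) at_infinity"
  proof (rule Lim_null_comparison[OF _ inv])
    show "eventually (\<lambda>z. norm (tau z) \<le> inverse (cmod z)) at_infinity"
      using inf
    proof eventually_elim
      case (elim z)
      have "tau z \<le> cmod z * tau z" using elim tau_pos[of z] by simp
      then show ?case using tau_norm_le[of z] tau_pos[of z] by (simp only: real_norm_def abs_of_pos)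
    qed
  qed
  have "norm (Re z * tau z) \<le> inverse (cmod z)" "norm (Im z * tau z) \<le> inverse (cmod z)" for z
    using order_trans[OF mult_right_mono[OF abs_Re_le_cmod] tau_norm_le]
      order_trans[OF mult_right_mono[OF abs_Im_le_cmod] tau_norm_le] tau_pos[of z]
    by (simp_all add: abs_mult)
  then show "((\<lambda>z. Re z * tau z) \<longlongrightarrow> 0) at_infinity" "((\<lambda>z. Im z * tau z) \<longlongrightarrow> 0) at_infinity"
    by (auto intro!: Lim_null_comparison[OF _ inv] always_eventually)
qed

text \<open>The operators stand for the functions $\mathrm{Re}\, z \cdot \tau$,
  $\mathrm{Im}\, z \cdot \tau$ and $\tau$ of \<open>z\<close>. The dense range of \<open>T\<close> means that the
  point at infinity carries no spectral mass.\<close>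

locale sphere_triple =
  fixes A B T :: "'h::{real_inner,banach} \<Rightarrow>\<^sub>L 'h"
  assumes sa: "selfadj A" "selfadj B" "selfadj T"
    and comm: "commuting A B" "commuting A T" "commuting B T"
    and sphere: "\<And>x. A (A x) + B (B x) = T x - T (T x)"
    and dense: "closure (range T) = UNIV"
begin

text \<open>Polynomial functions of the coordinates, paired with the same polynomials of the
  operators. A relation makes it unnecessary to know in advance that the operator depends
  on the function alone; this follows from \<open>rep_norm_le\<close>.\<close>

inductive rep :: "(complex \<Rightarrow> real) \<Rightarrow> ('h \<Rightarrow>\<^sub>L 'h) \<Rightarrow> bool" where
  const: "rep (\<lambda>z. c) (c *\<^sub>R id_blinfun)"
| re: "rep (\<lambda>z. Re z * tau z) A"
| im: "rep (\<lambda>z. Im z * tau z) B"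
| tau: "rep tau T"
| add: "rep p P \<Longrightarrow> rep q Q \<Longrightarrow> rep (\<lambda>z. p z + q z) (P + Q)"
| mult: "rep p P \<Longrightarrow> rep q Q \<Longrightarrow> rep (\<lambda>z. p z * q z) (P o\<^sub>L Q)"

lemma rep_commuting_outer:
  assumes "rep p P" "commuting C A" "commuting C B" "commuting C T"
  shows "commuting C P"
  using assms by (induction) (auto intro: commuting_intros)

lemma rep_commuting: "rep p P \<Longrightarrow> rep q Q \<Longrightarrow> commuting P Q"
  by (intro rep_commuting_outer[of q Q] commuting_sym[OF rep_commuting_outer[of p P]])
    (auto intro: comm commuting_sym commuting_intros)

lemma rep_selfadj: "rep p P \<Longrightarrow> selfadj P"
  by (induction rule: rep.induct) (auto intro: selfadj_intros sa rep_commuting)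

lemma rep_scale: "rep p P \<Longrightarrow> rep (\<lambda>z. c * p z) (c *\<^sub>R P)"
proof -
  have "(c *\<^sub>R id_blinfun) o\<^sub>L P = c *\<^sub>R P" for P :: "'h \<Rightarrow>\<^sub>L 'h"
    by (rule blinfun_eqI) (simp add: blinfun.bilinear_simps)
  then show "rep p P \<Longrightarrow> ?thesis" using mult[OF const] by metis
qed

lemma rep_diff:
  assumes "rep p P" "rep q Q" shows "rep (\<lambda>z. p z - q z) (P - Q)"
  using add[OF assms(1) rep_scale[OF assms(2), of "-1"]] by simp

text \<open>If \<open>P\<close> is not positive, it has a negative approximate eigenvalue \<open>l\<close>, and by
  \<open>joint_approx_eigenvalue\<close> there are unit vectors that are at the same time approximate
  eigenvectors for the triple. Their eigenvalues form a point of the sphere: either it is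
  the image of some \<open>z\<close>, or the point at infinity. In the first case \<open>l\<close> is the value of
  \<open>p\<close> at \<open>z\<close>, in the second the limit of \<open>p\<close> at infinity; the filter \<open>F\<close> in the proof
  covers both.\<close>

lemma rep_pos:
  assumes rep: "rep p P" and pos: "\<And>z. 0 \<le> p z"
  shows "pos_op P"
proof (rule ccontr)
  assume "\<not> pos_op P"
  then obtain x0 where "P x0 \<bullet> x0 < 0" by (auto simp: pos_op_def not_le)
  then obtain l where l: "l < 0" "\<And>e. 0 < e \<Longrightarrow> \<exists>x. norm x = 1 \<and> norm (P x - l *\<^sub>R x) < e"
    using approx_eigenvalue[OF rep_selfadj[OF rep]] by metis
  define sq where "sq Q c = (Q - c *\<^sub>R id_blinfun) o\<^sub>L (Q - c *\<^sub>R id_blinfun)" for Q :: "'h \<Rightarrow>\<^sub>L 'h" and c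
  have sq_rep: "\<exists>q. rep q (sq Q c)" if "rep q0 Q" for q0 Q c
    unfolding sq_def using rep.mult[OF rep_diff[OF that const] rep_diff[OF that const]] by blast
  have sqx: "sq Q c x \<bullet> x = (norm (Q x - c *\<^sub>R x))\<^sup>2" if "selfadj Q" for Q c x
  proof -
    have "selfadj (Q - c *\<^sub>R id_blinfun)" by (intro selfadj_intros that)
    from selfadjD[OF this, of "blinfun_apply (Q - c *\<^sub>R id_blinfun) x" x] show ?thesis
      by (simp add: sq_def power2_norm_eq_inner blinfun.bilinear_simps)
  qed
  have possq: "pos_op (sq Q c)" if "selfadj Q" for Q c
    by (simp add: pos_op_def sqx[OF that])
  have posadd: "pos_op (Q1 + Q2)" if "pos_op Q1" "pos_op Q2" for Q1 Q2 :: "'h \<Rightarrow>\<^sub>L 'h"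
    using that by (auto simp: pos_op_def blinfun.bilinear_simps inner_add_left)
  have saP: "selfadj P" by (rule rep_selfadj[OF rep])
  have step: "\<exists>a. \<forall>e>0. \<exists>x. norm x = 1 \<and> (N + sq Q a) x \<bullet> x < e"
    if N: "\<exists>n. rep n N" "pos_op N" and Q: "rep q Q" and small: "\<forall>e>0. \<exists>x. norm x = 1 \<and> N x \<bullet> x < e" for N Q q
  proof -
    obtain n where n: "rep n N" using N(1) by blast
    obtain a where "\<And>e. 0 < e \<Longrightarrow> \<exists>x. norm x = 1 \<and> N x \<bullet> x + (norm (Q x - a *\<^sub>R x))\<^sup>2 < e"
      using joint_approx_eigenvalue[OF rep_selfadj[OF n] N(2) rep_selfadj[OF Q]
          rep_commuting[OF n Q]] small by metis
    then show ?thesis using rep_selfadj[OF Q]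
      by (auto simp: blinfun.bilinear_simps inner_add_left sqx)
  qed
  have r0: "\<exists>n. rep n (sq P l)" by (rule sq_rep[OF rep])
  have "\<forall>e>0. \<exists>x. norm x = 1 \<and> sq P l x \<bullet> x < e"
  proof (intro allI impI)
    fix e :: real assume "0 < e"
    then obtain x where "norm x = 1" "norm (P x - l *\<^sub>R x) < sqrt e" using l(2)[of "sqrt e"] by auto
    moreover from this(2) have "(norm (P x - l *\<^sub>R x))\<^sup>2 < e"
      using \<open>0 < e\<close> power_strict_mono[of "norm (P x - l *\<^sub>R x)" "sqrt e" 2] by simp
    ultimately show "\<exists>x. norm x = 1 \<and> sq P l x \<bullet> x < e" using sqx[OF saP] by auto
  qed
  then obtain a where a: "\<forall>e>0. \<exists>x. norm x = 1 \<and> (sq P l + sq A a) x \<bullet> x < e"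
    using step[OF r0 possq[OF saP] re] by blast
  have r1: "\<exists>n. rep n (sq P l + sq A a)" using r0 sq_rep[OF re] rep.add by blast
  obtain b where b: "\<forall>e>0. \<exists>x. norm x = 1 \<and> (sq P l + sq A a + sq B b) x \<bullet> x < e"
    using step[OF r1 posadd[OF possq[OF saP] possq[OF sa(1)]] im a] by blast
  have r2: "\<exists>n. rep n (sq P l + sq A a + sq B b)" using r1 sq_rep[OF im] rep.add by blast
  obtain t where t: "\<forall>e>0. \<exists>x. norm x = 1 \<and> (sq P l + sq A a + sq B b + sq T t) x \<bullet> x < e"
    using step[OF r2 posadd[OF posadd[OF possq[OF saP] possq[OF sa(1)]] possq[OF sa(2)]] tau b] by blast
  have "\<exists>x. norm x = 1 \<and> norm (P x - l *\<^sub>R x) < inverse (real (Suc n)) \<and> norm (A x - a *\<^sub>R x) < inverse (real (Suc n))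
      \<and> norm (B x - b *\<^sub>R x) < inverse (real (Suc n)) \<and> norm (T x - t *\<^sub>R x) < inverse (real (Suc n))" for n
  proof -
    have "0 < (inverse (real (Suc n)))\<^sup>2" by simp
    then obtain x where x: "norm x = 1" "(sq P l + sq A a + sq B b + sq T t) x \<bullet> x < (inverse (real (Suc n)))\<^sup>2"
      using t by blast
    have "(norm (P x - l *\<^sub>R x))\<^sup>2 + (norm (A x - a *\<^sub>R x))\<^sup>2 + (norm (B x - b *\<^sub>R x))\<^sup>2
       + (norm (T x - t *\<^sub>R x))\<^sup>2 < (inverse (real (Suc n)))\<^sup>2"
      using x(2) by (simp add: blinfun.add_left inner_add_left sqx saP sa)
    then have "(norm (P x - l *\<^sub>R x))\<^sup>2 < (inverse (real (Suc n)))\<^sup>2"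
      "(norm (A x - a *\<^sub>R x))\<^sup>2 < (inverse (real (Suc n)))\<^sup>2"
      "(norm (B x - b *\<^sub>R x))\<^sup>2 < (inverse (real (Suc n)))\<^sup>2"
      "(norm (T x - t *\<^sub>R x))\<^sup>2 < (inverse (real (Suc n)))\<^sup>2"
      using zero_le_power2[of "norm (P x - l *\<^sub>R x)"] zero_le_power2[of "norm (A x - a *\<^sub>R x)"]
        zero_le_power2[of "norm (B x - b *\<^sub>R x)"] zero_le_power2[of "norm (T x - t *\<^sub>R x)"] by linarith+
    then show ?thesis using x(1) by (auto intro!: exI[of _ x] power_less_imp_less_base[of _ 2])
  qed
  then obtain x where x: "\<And>n. norm (x n) = 1" and
    xn: "\<And>n. norm (P (x n) - l *\<^sub>R x n) < inverse (real (Suc n))" "\<And>n. norm (A (x n) - a *\<^sub>R x n) < inverse (real (Suc n))"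
     "\<And>n. norm (B (x n) - b *\<^sub>R x n) < inverse (real (Suc n))" "\<And>n. norm (T (x n) - t *\<^sub>R x n) < inverse (real (Suc n))"
    by metis
  define ev where "ev Q c \<longleftrightarrow> (\<lambda>n. blinfun_apply Q (x n) - c *\<^sub>R x n) \<longlonglongrightarrow> 0" for Q c
  have evI: "ev Q c" if "\<And>n. norm (blinfun_apply Q (x n) - c *\<^sub>R x n) < inverse (real (Suc n))" for Q c
    unfolding ev_def
    by (rule Lim_null_comparison[OF _ LIMSEQ_inverse_real_of_nat])
      (auto intro!: always_eventually less_imp_le[OF that] simp del: of_nat_Suc)
  have ev0: "ev P l" "ev A a" "ev B b" "ev T t" by (auto intro!: evI xn)
  have ev_add: "ev (Q1 + Q2) (c1 + c2)" if "ev Q1 c1" "ev Q2 c2" for Q1 Q2 c1 c2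
    using tendsto_add[OF that[unfolded ev_def]] unfolding ev_def
    by (simp add: blinfun.add_left scaleR_add_left algebra_simps)
  have ev_mult: "ev (Q1 o\<^sub>L Q2) (c1 * c2)" if "ev Q1 c1" "ev Q2 c2" for Q1 Q2 c1 c2
  proof -
    have "(\<lambda>n. blinfun_apply Q1 (blinfun_apply Q2 (x n) - c2 *\<^sub>R x n) + c2 *\<^sub>R (blinfun_apply Q1 (x n) - c1 *\<^sub>R x n)) \<longlonglongrightarrow> Q1 0 + c2 *\<^sub>R 0"
      using that unfolding ev_def by (intro tendsto_intros)
    then show ?thesis unfolding ev_def
      by (simp add: blinfun.bilinear_simps scaleR_diff_right mult.commute)
  qed
  have ev_unique: "c1 = c2" if "ev Q c1" "ev Q c2" for Q c1 c2
  proof -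
    have "(\<lambda>n. (blinfun_apply Q (x n) - c1 *\<^sub>R x n) - (blinfun_apply Q (x n) - c2 *\<^sub>R x n)) \<longlonglongrightarrow> 0 - 0"
      using that unfolding ev_def by (intro tendsto_intros)
    then have "(\<lambda>n. (c2 - c1) *\<^sub>R x n) \<longlonglongrightarrow> 0" by (simp add: algebra_simps)
    then have "(\<lambda>n. norm ((c2 - c1) *\<^sub>R x n)) \<longlonglongrightarrow> 0" by (rule tendsto_norm_zero)
    then show ?thesis by (simp add: x LIMSEQ_const_iff)
  qed
  have ev_const: "ev (c *\<^sub>R id_blinfun) c" for c
    by (simp add: ev_def blinfun.bilinear_simps)
  have abt: "a * a + b * b = t + (-1) * (t * t)"
  proof (rule ev_unique)
    show "ev ((A o\<^sub>L A) + (B o\<^sub>L B)) (a * a + b * b)" by (intro ev_add ev_mult ev0)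
    have "(A o\<^sub>L A) + (B o\<^sub>L B) = T + (((-1) *\<^sub>R id_blinfun) o\<^sub>L (T o\<^sub>L T))"
      by (rule blinfun_eqI) (simp add: blinfun.bilinear_simps sphere)
    moreover have "ev (T + (((-1) *\<^sub>R id_blinfun) o\<^sub>L (T o\<^sub>L T))) (t + (-1) * (t * t))"
      by (intro ev_add ev_mult ev0 ev_const)
    ultimately show "ev ((A o\<^sub>L A) + (B o\<^sub>L B)) (t + (-1) * (t * t))" by simp
  qed
  obtain F :: "complex filter" where F: "F \<noteq> bot" "(tau \<longlongrightarrow> t) F" "((\<lambda>z. Re z * tau z) \<longlongrightarrow> a) F"
    "((\<lambda>z. Im z * tau z) \<longlongrightarrow> b) F"
  proof (cases "t = 0")
    case True
    then have "a * a + b * b = 0" using abt by simp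
    then have "a = 0" "b = 0" using sum_squares_eq_zero_iff by blast+
    with True show ?thesis using that[of at_infinity] tau_at_infinity
      by (simp add: trivial_limit_at_infinity)
  next
    case False
    define z0 where "z0 = Complex (a / t) (b / t)"
    have "1 + (cmod z0)\<^sup>2 = (t * t + (a * a + b * b)) / (t * t)"
      using False by (simp add: z0_def cmod_def power2_eq_square field_simps)
    also have "\<dots> = 1 / t" using False by (simp add: abt field_simps)
    finally have tz: "tau z0 = t" by (simp add: tau_def)
    have g: "(g \<longlongrightarrow> g z0) (principal {z0})" for g :: "complex \<Rightarrow> real"
      by (auto simp: tendsto_def eventually_principal)
    have "Re z0 * tau z0 = a" "Im z0 * tau z0 = b" using False unfolding tz by (simp_all add: z0_def)
    then show ?thesis
      using that[of "principal {z0}"] g[of tau] g[of "\<lambda>z. Re z * tau z"] g[of "\<lambda>z. Im z * tau z"] tz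
      by (simp add: principal_eq_bot_iff)
  qed
  have "\<exists>c. (q \<longlongrightarrow> c) F \<and> ev Q c" if "rep q Q" for q Q
    using that
  proof induction
    case (const c) then show ?case using ev_const by (auto intro!: exI[of _ c])
  next
    case (add p P q Q) then show ?case using ev_add by (blast intro: tendsto_add)
  next
    case (mult p P q Q) then show ?case using ev_mult by (blast intro: tendsto_mult)
  qed (use ev0 F in auto)
  then obtain c where c: "(p \<longlongrightarrow> c) F" "ev P c" using rep by blast
  have "c = l" by (rule ev_unique[OF c(2) ev0(1)])
  moreover have "0 \<le> c"
    by (rule tendsto_lowerbound[OF c(1) always_eventually F(1)]) (use pos in auto)
  ultimately show False using l(1) by simp
qed

text \<open>The function $C^2 - p^2$ is nonnegative.\<close>

lemma rep_norm_le:
  assumes rep: "rep p P" and le: "\<And>z. \<bar>p z\<bar> \<le> C"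
  shows "norm P \<le> C"
proof (rule norm_blinfun_bound)
  show C: "0 \<le> C" using le[of 0] by linarith
  fix x
  have "pos_op (C\<^sup>2 *\<^sub>R id_blinfun - (P o\<^sub>L P))"
    by (rule rep_pos[OF rep_diff[OF const mult[OF rep rep]]])
      (use le in \<open>auto simp: power2_eq_square[symmetric] abs_le_square_iff[symmetric] intro: order_trans[OF _ abs_ge_self]\<close>)
  from pos_opD[OF this, of x] have "(norm (P x))\<^sup>2 \<le> (C * norm x)\<^sup>2"
    by (simp add: blinfun.bilinear_simps inner_diff_left selfadjD[OF rep_selfadj[OF rep]]
      power2_norm_eq_inner[symmetric] power_mult_distrib)
  then show "norm (P x) \<le> C * norm x" using C by (simp add: power2_le_iff_abs_le)
qed

end

lemma bcontfun_bound:
  fixes f :: "'a::topological_space \<Rightarrow> 'b::real_normed_vector"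
  assumes "f \<in> bcontfun" obtains C where "0 < C" "\<And>z. norm (f z) \<le> C"
  using assms unfolding bcontfun_def bounded_pos by auto

lemma bcontfun_continuous: "f \<in> bcontfun \<Longrightarrow> continuous_on S f"
  unfolding bcontfun_def by (auto intro: continuous_on_subset)

lemma bcontfun_mult:
  fixes f g :: "'a::topological_space \<Rightarrow> 'b::real_normed_algebra"
  assumes "f \<in> bcontfun" "g \<in> bcontfun"
  shows "(\<lambda>z. f z * g z) \<in> bcontfun"
proof -
  obtain C where C: "0 < C" "\<And>z. norm (f z) \<le> C" using bcontfun_bound[OF assms(1)] by blast
  obtain D where D: "0 < D" "\<And>z. norm (g z) \<le> D" using bcontfun_bound[OF assms(2)] by blast
  have "norm (f z * g z) \<le> C * D" for z
    by (rule order_trans[OF norm_mult_ineq mult_mono]) (use C D in \<open>auto intro: less_imp_le\<close>)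
  moreover have "continuous_on UNIV (\<lambda>z. f z * g z)"
    by (intro continuous_on_mult bcontfun_continuous assms)
  ultimately show ?thesis by (rule bcontfun_normI[rotated])
qed

lemma tau_bcontfun: "tau \<in> bcontfun"
  by (rule bcontfun_normI[of _ 1, OF tau_continuous]) (use tau_pos tau_le in \<open>simp add: abs_of_pos\<close>)

lemma LIMSEQ_eqI:
  fixes X :: "nat \<Rightarrow> 'a::t2_space"
  assumes "X \<longlonglongrightarrow> a" "\<And>n. X n = Y n" "Y \<longlonglongrightarrow> b"
  shows "a = b"
proof -
  have "X = Y" using assms(2) by (rule ext)
  then show ?thesis using LIMSEQ_unique[OF assms(1)] assms(3) by blast
qed

lemma dense_rangeE:
  fixes f :: "'a \<Rightarrow> 'b::real_normed_vector"
  assumes "closure (range f) = UNIV"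
  obtains w where "(\<lambda>n. f (w n)) \<longlonglongrightarrow> v"
proof -
  obtain y where y: "\<And>n. y n \<in> range f" "y \<longlonglongrightarrow> v"
    using assms closure_sequential[of v "range f"] by auto
  then have "\<forall>n. \<exists>w. f w = y n" by (metis rangeE)
  then obtain w where w: "\<And>n. f (w n) = y n" by metis
  show ?thesis by (rule that[of w]) (simp only: w y(2))
qed

lemma blinfun_eq_on_dense_range:
  fixes P Q :: "'a::real_normed_vector \<Rightarrow>\<^sub>L 'b::real_normed_vector"
    and T :: "'c::real_normed_vector \<Rightarrow>\<^sub>L 'a"
  assumes "closure (range T) = UNIV" "P o\<^sub>L T = Q o\<^sub>L T"
  shows "P = Q"
proof (rule blinfun_eqI)
  fix v
  obtain w where w: "(\<lambda>n. T (w n)) \<longlonglongrightarrow> v" using dense_rangeE[OF assms(1)] by blast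
  have "(\<lambda>n. P (T (w n))) \<longlonglongrightarrow> P v" by (intro tendsto_intros w)
  moreover have "P (T (w n)) = Q (T (w n))" for n
    using arg_cong[OF assms(2), of "\<lambda>R. blinfun_apply R (w n)"] by simp
  moreover have "(\<lambda>n. Q (T (w n))) \<longlonglongrightarrow> Q v" by (intro tendsto_intros w)
  ultimately show "P v = Q v" by (rule LIMSEQ_eqI)
qed

text \<open>The factor has to send \<open>T w\<close> to \<open>L w\<close>; the bound says that this is well defined and
  Lipschitz on the range of \<open>T\<close>, so it extends to the closure.\<close>

lemma factor_through_dense_range:
  fixes T L :: "'h::banach \<Rightarrow>\<^sub>L 'h"
  assumes dense: "closure (range T) = UNIV" and le: "\<And>w. norm (L w) \<le> C * norm (T w)" and C: "0 \<le> C"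
  obtains R where "R o\<^sub>L T = L" "norm R \<le> C"
proof -
  define f where "f y = L (SOME w. T w = y)" for y
  have Leq: "L u = L v" if "T u = T v" for u v
    using le[of "u - v"] that by (simp add: blinfun.diff_right)
  have fT: "f (T w) = L w" for w
    unfolding f_def by (rule Leq) (rule someI[of "\<lambda>u. T u = T w"], rule refl)
  have lip: "C-lipschitz_on (range T) f"
  proof (rule lipschitz_onI)
    fix x y assume "x \<in> range T" "y \<in> range T"
    then obtain u v where "x = T u" "y = T v" by auto
    then show "dist (f x) (f y) \<le> C * dist x y"
      using le[of "u - v"] by (simp add: fT dist_norm blinfun.diff_right)
  qed (rule C)
  obtain g where "C-lipschitz_on UNIV g" "\<forall>y\<in>range T. g y = f y"
    using lipschitz_extend_closure[OF lip] unfolding dense by blast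
  then have g: "C-lipschitz_on UNIV g" "\<And>w. g (T w) = L w" by (simp_all add: fT)
  have cont: "isCont g x" for x
    using lipschitz_on_continuous_on[OF g(1)] by (simp add: continuous_on_eq_continuous_at)
  have lim: "(\<lambda>n. g (s n)) \<longlonglongrightarrow> g x" if "s \<longlonglongrightarrow> x" for s x
    using isCont_tendsto_compose[OF cont that] .
  have "bounded_linear g"
  proof (rule bounded_linear_intro)
    fix x y
    obtain u where u: "(\<lambda>n. T (u n)) \<longlonglongrightarrow> x" using dense_rangeE[OF dense] by blast
    obtain v where v: "(\<lambda>n. T (v n)) \<longlonglongrightarrow> y" using dense_rangeE[OF dense] by blast
    have "(\<lambda>n. g (T (u n) + T (v n))) \<longlonglongrightarrow> g (x + y)" by (intro lim tendsto_intros u v)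
    moreover have "g (T (u n) + T (v n)) = g (T (u n)) + g (T (v n))" for n
      by (simp add: g(2) flip: blinfun.add_right)
    moreover have "(\<lambda>n. g (T (u n)) + g (T (v n))) \<longlonglongrightarrow> g x + g y" by (intro tendsto_add lim u v)
    ultimately show "g (x + y) = g x + g y" by (rule LIMSEQ_eqI)
    fix r
    have "(\<lambda>n. g (r *\<^sub>R T (u n))) \<longlonglongrightarrow> g (r *\<^sub>R x)" by (intro lim tendsto_intros u)
    moreover have "g (r *\<^sub>R T (u n)) = r *\<^sub>R g (T (u n))" for n
      by (simp add: g(2) flip: blinfun.scaleR_right)
    moreover have "(\<lambda>n. r *\<^sub>R g (T (u n))) \<longlonglongrightarrow> r *\<^sub>R g x" by (intro tendsto_intros lim u)
    ultimately show "g (r *\<^sub>R x) = r *\<^sub>R g x" by (rule LIMSEQ_eqI)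
    have "g 0 = 0" using g(2)[of 0] by (simp add: blinfun.zero_right)
    then show "norm (g x) \<le> norm x * C"
      using lipschitz_onD[OF g(1), of x 0] by (simp add: dist_norm mult.commute)
  qed
  then have app: "blinfun_apply (Blinfun g) = g" by (rule bounded_linear_Blinfun_apply)
  show ?thesis
  proof (rule that)
    show "Blinfun g o\<^sub>L T = L" by (rule blinfun_eqI) (simp add: app g(2))
    have "g 0 = 0" using g(2)[of 0] by (simp add: blinfun.zero_right)
    then have "norm (g x) \<le> C * norm x" for x
      using lipschitz_onD[OF g(1), of x 0] by (simp add: dist_norm)
    then show "norm (Blinfun g) \<le> C" by (intro norm_blinfun_bound C) (simp add: app)
  qed
qed

context sphere_triple
begin

text \<open>The closure of \<open>rep\<close> under uniform limits. By \<open>cal_unique\<close> the operator is a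
  function of \<open>f\<close>.\<close>

definition cal :: "(complex \<Rightarrow> real) \<Rightarrow> ('h \<Rightarrow>\<^sub>L 'h) \<Rightarrow> bool" where
  "cal f Q \<longleftrightarrow> (\<exists>p P. (\<forall>n. rep (p n) (P n)) \<and> uniform_limit UNIV p f sequentially \<and> P \<longlonglongrightarrow> Q)"

lemma calE:
  assumes "cal f Q"
  obtains p P where "\<And>n. rep (p n) (P n)" "uniform_limit UNIV p f sequentially" "P \<longlonglongrightarrow> Q"
  using assms unfolding cal_def by blast

lemma calI:
  assumes "\<And>n. rep (p n) (P n)" "uniform_limit UNIV p f sequentially" "P \<longlonglongrightarrow> Q"
  shows "cal f Q"
  using assms unfolding cal_def by blast

lemma rep_cal: "rep p P \<Longrightarrow> cal p P"
  by (rule calI[of "\<lambda>_. p" "\<lambda>_. P"]) (auto intro: uniform_limit_const)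

lemma cal_add: "cal f P \<Longrightarrow> cal g Q \<Longrightarrow> cal (\<lambda>z. f z + g z) (P + Q)"
  by (elim calE, rule calI) (rule add tendsto_add uniform_limit_add; assumption)+

lemma cal_diff: "cal f P \<Longrightarrow> cal g Q \<Longrightarrow> cal (\<lambda>z. f z - g z) (P - Q)"
  by (elim calE, rule calI) (rule rep_diff tendsto_diff uniform_limit_minus; assumption)+

lemma cal_mult:
  assumes "cal f P" "cal g Q" "bounded (range f)" "bounded (range g)"
  shows "cal (\<lambda>z. f z * g z) (P o\<^sub>L Q)"
  using assms
  by (elim calE, intro calI)
    (rule mult bounded_bilinear.tendsto[OF bounded_bilinear_blinfun_compose] uniform_lim_mult; assumption)+

lemma cal_scale:
  assumes "cal f P" shows "cal (\<lambda>z. c * f z) (c *\<^sub>R P)"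
proof -
  obtain p Q where *: "\<And>n. rep (p n) (Q n)" "uniform_limit UNIV p f sequentially" "Q \<longlonglongrightarrow> P"
    using assms by (metis calE)
  show ?thesis
    by (rule calI[of "\<lambda>n z. c * p n z" "\<lambda>n. c *\<^sub>R Q n"])
      (intro rep_scale * tendsto_intros bounded_linear.uniform_limit[OF bounded_linear_mult_right *(2)])+
qed

lemma cal_selfadj:
  assumes "cal f Q" shows "selfadj Q"
  unfolding selfadj_def
proof (intro allI)
  fix x y
  obtain p P where *: "\<And>n. rep (p n) (P n)" "P \<longlonglongrightarrow> Q"
    using assms by (metis calE)
  have "(\<lambda>n. P n x \<bullet> y) \<longlonglongrightarrow> Q x \<bullet> y" by (intro tendsto_intros *)
  moreover have "P n x \<bullet> y = x \<bullet> P n y" for n by (rule selfadjD[OF rep_selfadj[OF *(1)]])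
  moreover have "(\<lambda>n. x \<bullet> P n y) \<longlonglongrightarrow> x \<bullet> Q y" by (intro tendsto_intros *)
  ultimately show "Q x \<bullet> y = x \<bullet> Q y" by (rule LIMSEQ_eqI)
qed

lemma cal_commuting_outer:
  assumes "cal f Q" "commuting C A" "commuting C B" "commuting C T"
  shows "commuting C Q"
  unfolding commuting_def
proof
  fix x
  obtain p P where *: "\<And>n. rep (p n) (P n)" "P \<longlonglongrightarrow> Q"
    using assms(1) by (metis calE)
  have "(\<lambda>n. C (P n x)) \<longlonglongrightarrow> C (Q x)" by (intro tendsto_intros *)
  moreover have "C (P n x) = P n (C x)" for n
    by (rule commutingD[OF rep_commuting_outer[OF *(1) assms(2-4)]])
  moreover have "(\<lambda>n. P n (C x)) \<longlonglongrightarrow> Q (C x)" by (intro tendsto_intros *)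
  ultimately show "C (Q x) = Q (C x)" by (rule LIMSEQ_eqI)
qed

lemma cal_pos:
  assumes cal: "cal f Q" and pos: "\<And>z. 0 \<le> f z"
  shows "pos_op Q"
  unfolding pos_op_def
proof
  fix x
  obtain p P where *: "\<And>n. rep (p n) (P n)" "uniform_limit UNIV p f sequentially" "P \<longlonglongrightarrow> Q"
    using cal by (metis calE)
  have "- e * (x \<bullet> x) \<le> Q x \<bullet> x" if e: "0 < e" for e
  proof (rule tendsto_lowerbound)
    show "(\<lambda>n. P n x \<bullet> x) \<longlonglongrightarrow> Q x \<bullet> x" by (intro tendsto_intros *)
    show "eventually (\<lambda>n. - e * (x \<bullet> x) \<le> P n x \<bullet> x) sequentially"
      using uniform_limitD[OF *(2) e]
    proof eventually_elim
      case (elim n)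
      have "0 \<le> p n z + e" for z
        using elim[rule_format, of z] pos[of z] by (simp add: dist_real_def abs_less_iff)
      then have "pos_op (P n + e *\<^sub>R id_blinfun)" by (intro rep_pos[OF add[OF *(1) const]])
      from pos_opD[OF this, of x] show ?case by (simp add: blinfun.bilinear_simps inner_add_left)
    qed
  qed simp
  note * = this
  show "0 \<le> Q x \<bullet> x"
  proof (rule field_le_epsilon)
    fix e :: real assume "0 < e"
    moreover have "0 < x \<bullet> x + 1" by (simp add: add_nonneg_pos)
    ultimately have "0 < e / (x \<bullet> x + 1)" "e / (x \<bullet> x + 1) * (x \<bullet> x) \<le> e"
      by (simp_all add: divide_simps)
    with *[OF this(1)] show "0 \<le> Q x \<bullet> x + e" by linarith
  qed
qed

lemma cal_norm_le:
  assumes cal: "cal f Q" and le: "\<And>z. \<bar>f z\<bar> \<le> C"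
  shows "norm Q \<le> C"
proof (rule field_le_epsilon)
  fix e :: real assume e: "0 < e"
  obtain p P where *: "\<And>n. rep (p n) (P n)" "uniform_limit UNIV p f sequentially" "P \<longlonglongrightarrow> Q"
    using cal by (metis calE)
  show "norm Q \<le> C + e"
  proof (rule tendsto_upperbound)
    show "(\<lambda>n. norm (P n)) \<longlonglongrightarrow> norm Q" by (intro tendsto_intros *)
    show "eventually (\<lambda>n. norm (P n) \<le> C + e) sequentially"
      using uniform_limitD[OF *(2) e]
    proof eventually_elim
      case (elim n)
      have "\<bar>p n z\<bar> \<le> C + e" for z
        using elim[rule_format, of z] le[of z] by (simp add: dist_real_def)
      then show ?case by (intro rep_norm_le[OF *(1)])
    qed
  qed simp
qed

lemma cal_unique:
  assumes "cal f P" "cal f Q" shows "P = Q"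
  using cal_norm_le[OF cal_diff[OF assms], of 0] by simp

text \<open>Uniformly close functions belong to operators that are close in norm
  (\<open>rep_norm_le\<close>), so the operators of a sequence of approximants converge.\<close>

lemma cal_of_approx:
  assumes approx: "\<And>e. 0 < e \<Longrightarrow> \<exists>p P. rep p P \<and> (\<forall>z. \<bar>f z - p z\<bar> \<le> e)"
  obtains Q where "cal f Q"
proof -
  have "\<exists>p P. rep p P \<and> (\<forall>z. \<bar>f z - p z\<bar> \<le> inverse (real (Suc n)))" for n
    by (intro approx) simp
  then obtain p P where p: "\<And>n. rep (p n) (P n)" "\<And>n z. \<bar>f z - p n z\<bar> \<le> inverse (real (Suc n))"
    by metis
  have unif: "uniform_limit UNIV p f sequentially"
  proof (rule uniform_limitI)
    fix e :: real assume e: "0 < e"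
    show "eventually (\<lambda>n. \<forall>z\<in>UNIV. dist (p n z) (f z) < e) sequentially"
      using order_tendstoD(2)[OF LIMSEQ_inverse_real_of_nat e]
    proof eventually_elim
      case (elim n)
      then show ?case using p(2)[of _ n] by (auto simp: dist_real_def abs_minus_commute intro: le_less_trans)
    qed
  qed
  have "Cauchy P"
  proof (rule metric_CauchyI)
    fix e :: real assume e: "0 < e"
    then obtain N where N: "inverse (real (Suc N)) < e / 2" using reals_Archimedean[of "e/2"] by auto
    show "\<exists>M. \<forall>m\<ge>M. \<forall>n\<ge>M. dist (P m) (P n) < e"
    proof (intro exI[of _ N] allI impI)
      fix m n assume mn: "N \<le> m" "N \<le> n"
      have "inverse (real (Suc m)) \<le> inverse (real (Suc N))" "inverse (real (Suc n)) \<le> inverse (real (Suc N))"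
        using mn by (auto intro!: le_imp_inverse_le)
      then have "\<bar>p m z - p n z\<bar> \<le> 2 * inverse (real (Suc N))" for z
        using p(2)[of z m] p(2)[of z n] by linarith
      then have "norm (P m - P n) \<le> 2 * inverse (real (Suc N))"
        by (intro rep_norm_le[OF rep_diff[OF p(1) p(1)]])
      then show "dist (P m) (P n) < e" using N by (simp add: dist_norm)
    qed
  qed
  then obtain Q where "P \<longlonglongrightarrow> Q" using Cauchy_convergent convergent_def by blast
  then show ?thesis using that calI[OF p(1) unif] by blast
qed

lemma real_polynomial_rep:
  assumes "real_polynomial_function (q :: real \<times> complex \<Rightarrow> real)"
  shows "\<exists>Q. rep (\<lambda>z. q (tau z, tau z *\<^sub>R z)) Q"
  using assms
proof induction
  case (linear f)
  interpret f: bounded_linear f by fact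
  have eq: "f (tau z, tau z *\<^sub>R z) = f (1, 0) * tau z + (f (0, 1) * (Re z * tau z) + f (0, \<i>) * (Im z * tau z))" for z
  proof -
    have "(tau z, tau z *\<^sub>R z) = tau z *\<^sub>R (1, 0) + ((Re z * tau z) *\<^sub>R (0, 1) + (Im z * tau z) *\<^sub>R (0, \<i>))"
      by (auto simp: complex_eq_iff)
    then show ?thesis by (simp only: f.add f.scaleR) (simp add: mult.commute)
  qed
  show ?case unfolding eq
    using add[OF rep_scale[OF tau] add[OF rep_scale[OF re] rep_scale[OF im]]] by blast
next
  case (const c) then show ?case using rep.const by blast
next
  case (add f g) then show ?case using rep.add by blast
next
  case (mult f g) then show ?case using rep.mult by blast
qed

text \<open>This is where the Stone--Weierstrass theorem is applied. Multiplication by \<open>tau\<close> makes a bounded continuous function vanish at infinity, so that it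
  becomes a continuous function on the sphere.\<close>

lemma cal_exists:
  assumes g: "g \<in> bcontfun"
  obtains Q where "cal (\<lambda>z. g z * tau z) Q"
proof (rule cal_of_approx)
  fix e :: real assume e: "0 < e"
  obtain C where C: "0 < C" "\<And>z. norm (g z) \<le> C" using bcontfun_bound[OF g] by blast
  define S :: "(real \<times> complex) set" where "S = {p. (cmod (snd p))\<^sup>2 = fst p - (fst p)\<^sup>2}"
  define F where "F = (\<lambda>(t, s). g (s / complex_of_real t) * t)"
  have "closed S"
  proof -
    have "S = (\<lambda>p. (cmod (snd p))\<^sup>2 - (fst p - (fst p)\<^sup>2)) -` {0}" by (auto simp: S_def)
    moreover have "closed \<dots>" by (intro closed_vimage continuous_intros closed_singleton)
    ultimately show ?thesis by simp
  qed
  moreover have "bounded S"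
  proof (rule boundedI)
    fix p assume "p \<in> S"
    then obtain t s where p: "p = (t, s)" "(cmod s)\<^sup>2 = t - t\<^sup>2" by (cases p) (auto simp: S_def)
    have "t * t \<le> t" using zero_le_power2[of "cmod s"] p(2) unfolding power2_eq_square by linarith
    then have "0 \<le> t" using zero_le_square[of t] by linarith
    then have t: "0 \<le> t" "t \<le> 1" using \<open>t * t \<le> t\<close> by (auto simp: mult_le_cancel_left2)
    have "(norm p)\<^sup>2 = t" using p t by (simp add: norm_prod_def)
    then show "norm p \<le> 1" using t by (intro power2_le_imp_le[of "norm p" 1]) auto
  qed
  ultimately have "compact S" by (simp add: compact_eq_bounded_closed)
  moreover have "continuous_on S F"
    unfolding continuous_on_eq_continuous_within
  proof
    fix p assume "p \<in> S"
    obtain t s where p: "p = (t, s)" by force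
    show "continuous (at p within S) F"
    proof (cases "t = 0")
      case True
      have "(F \<longlongrightarrow> 0) (at p within S)"
      proof (rule Lim_null_comparison)
        show "eventually (\<lambda>q. norm (F q) \<le> C * \<bar>fst q\<bar>) (at p within S)"
          using C(2) by (auto simp: F_def abs_mult split: prod.split intro!: always_eventually mult_right_mono)
        have "((\<lambda>q. C * \<bar>fst q\<bar>) \<longlongrightarrow> C * \<bar>fst p\<bar>) (at p within S)" by (intro tendsto_intros)
        then show "((\<lambda>q. C * \<bar>fst q\<bar>) \<longlongrightarrow> 0) (at p within S)" using True p by simp
      qed
      then show ?thesis using True p by (simp add: continuous_within F_def)
    next
      case False
      have gc: "isCont g z" for z using bcontfun_continuous[OF g, of UNIV]
        by (simp add: continuous_on_eq_continuous_at)
      have "continuous (at p within S) (\<lambda>q. g (snd q / complex_of_real (fst q)) * fst q)"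
        using False p by (intro continuous_intros continuous_within_compose3[OF gc]) auto
      then show ?thesis by (simp add: F_def case_prod_unfold)
    qed
  qed
  ultimately obtain q where q: "real_polynomial_function q" "\<And>x. x \<in> S \<Longrightarrow> \<bar>F x - q x\<bar> < e"
    using Stone_Weierstrass_real_polynomial_function[OF _ _ e] by metis
  obtain Q where Q: "rep (\<lambda>z. q (tau z, tau z *\<^sub>R z)) Q" using real_polynomial_rep[OF q(1)] by blast
  have "\<bar>g z * tau z - q (tau z, tau z *\<^sub>R z)\<bar> \<le> e" for z
  proof -
    define d where "d = 1 + (cmod z)\<^sup>2"
    have "d \<noteq> 0" unfolding d_def by (metis add_pos_nonneg less_irrefl zero_le_power2 zero_less_one)
    then have "(d - 1) * (inverse d)\<^sup>2 = inverse d - (inverse d)\<^sup>2"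
      by (simp add: power2_eq_square field_simps)
    then have "(cmod z)\<^sup>2 * (tau z)\<^sup>2 = tau z - (tau z)\<^sup>2"
      by (simp add: d_def tau_def)
    then have "(tau z, tau z *\<^sub>R z) \<in> S" by (simp add: S_def power_mult_distrib mult.commute)
    moreover have "F (tau z, tau z *\<^sub>R z) = g z * tau z"
      using tau_pos[of z] by (simp add: F_def scaleR_conv_of_real)
    ultimately show ?thesis using q(2) less_imp_le by metis
  qed
  then show "\<exists>p P. rep p P \<and> (\<forall>z. \<bar>g z * tau z - p z\<bar> \<le> e)" using Q by blast
qed (rule that)

section \<open>Bounded continuous functions of the triple\<close>

text \<open>The operator \<open>Q\<close> that belongs to \<open>f\<close> is determined on the dense range of \<open>T\<close> by the
  requirement that \<open>Q T\<close> belongs to \<open>f tau\<close>, a function which is continuous at infinity.\<close>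

definition ext :: "(complex \<Rightarrow> real) \<Rightarrow> ('h \<Rightarrow>\<^sub>L 'h) \<Rightarrow> bool" where
  "ext f Q \<longleftrightarrow> f \<in> bcontfun \<and> cal (\<lambda>z. f z * tau z) (Q o\<^sub>L T)"

lemma bounded_times_tau:
  assumes "f \<in> bcontfun" shows "bounded (range (\<lambda>z. f z * tau z))"
  using bcontfun_mult[OF assms tau_bcontfun] by (simp add: bcontfun_def)

lemma ext_unique: "ext f P \<Longrightarrow> ext f Q \<Longrightarrow> P = Q"
  unfolding ext_def by (elim conjE) (rule blinfun_eq_on_dense_range[OF dense cal_unique])

text \<open>The estimate that allows dividing by \<open>T\<close> is the positivity of the function
  $C^2 \tau^2 - (f \tau)^2$.\<close>

lemma ext_exists:
  assumes f: "f \<in> bcontfun" and C: "\<And>z. \<bar>f z\<bar> \<le> C"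
  obtains Q where "ext f Q" "norm Q \<le> C"
proof -
  obtain L where L: "cal (\<lambda>z. f z * tau z) L" using cal_exists[OF f] by blast
  have C0: "0 \<le> C" using C[of 0] by linarith
  have "norm (L w) \<le> C * norm (T w)" for w
  proof -
    have cal: "cal (\<lambda>z. C\<^sup>2 * (tau z * tau z) - (f z * tau z) * (f z * tau z))
        (C\<^sup>2 *\<^sub>R (T o\<^sub>L T) - (L o\<^sub>L L))"
      by (rule cal_diff[OF cal_scale[OF rep_cal[OF rep.mult[OF rep.tau rep.tau]]]
            cal_mult[OF L L bounded_times_tau[OF f] bounded_times_tau[OF f]]])
    have "0 \<le> C\<^sup>2 * (tau z * tau z) - (f z * tau z) * (f z * tau z)" for z
    proof -
      have "(f z)\<^sup>2 \<le> C\<^sup>2" using C[of z] C0 by (simp add: abs_le_square_iff[symmetric])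
      then have "(f z)\<^sup>2 * (tau z * tau z) \<le> C\<^sup>2 * (tau z * tau z)"
        using tau_pos[of z] by (intro mult_right_mono) auto
      then show ?thesis by (simp add: power2_eq_square algebra_simps)
    qed
    from pos_opD[OF cal_pos[OF cal this], of w]
    have "0 \<le> C\<^sup>2 * (T (T w) \<bullet> w) - L (L w) \<bullet> w"
      by (simp only: blinfun.diff_left blinfun.scaleR_left inner_diff_left inner_scaleR_left
          blinfun_apply_blinfun_compose)
    then have "(norm (L w))\<^sup>2 \<le> (C * norm (T w))\<^sup>2"
      unfolding selfadjD[OF cal_selfadj[OF L], of "L w" w] selfadjD[OF sa(3), of "T w" w]
        power_mult_distrib power2_norm_eq_inner by simp
    then show ?thesis by (rule power2_le_imp_le) (simp add: C0)
  qed
  then obtain Q where Q: "Q o\<^sub>L T = L" "norm Q \<le> C"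
    by (rule factor_through_dense_range[OF dense _ C0])
  then have "ext f Q" using L f by (simp add: ext_def)
  then show ?thesis using Q(2) by (rule that)
qed

lemma ext_norm_le: "ext f Q \<Longrightarrow> (\<And>z. \<bar>f z\<bar> \<le> C) \<Longrightarrow> norm Q \<le> C"
proof -
  assume Q: "ext f Q" and C: "\<And>z. \<bar>f z\<bar> \<le> C"
  have "f \<in> bcontfun" using Q by (simp add: ext_def)
  then obtain R where "ext f R" "norm R \<le> C" using C by (rule ext_exists)
  then show ?thesis using ext_unique[OF Q] by simp
qed

lemma ext_add: "ext f P \<Longrightarrow> ext g Q \<Longrightarrow> ext (\<lambda>z. f z + g z) (P + Q)"
proof -
  have "(P + Q) o\<^sub>L T = (P o\<^sub>L T) + (Q o\<^sub>L T)" by (rule blinfun_eqI) (simp add: blinfun.bilinear_simps)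
  then show "ext f P \<Longrightarrow> ext g Q \<Longrightarrow> ?thesis"
    unfolding ext_def using cal_add[of "\<lambda>z. f z * tau z" _ "\<lambda>z. g z * tau z"]
    by (auto simp: plus_cont distrib_right)
qed

lemma ext_scale: "ext f P \<Longrightarrow> ext (\<lambda>z. c * f z) (c *\<^sub>R P)"
proof -
  have "(c *\<^sub>R P) o\<^sub>L T = c *\<^sub>R (P o\<^sub>L T)" by (rule blinfun_eqI) (simp add: blinfun.bilinear_simps)
  then show "ext f P \<Longrightarrow> ?thesis"
    unfolding ext_def using cal_scale[of "\<lambda>z. f z * tau z" _ c] scaleR_cont[of f c]
    by (auto simp: mult.assoc)
qed

lemma coordinate_le_one:
  assumes "\<bar>x\<bar> \<le> cmod z" shows "\<bar>x * tau z\<bar> \<le> 1"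
proof (cases "cmod z \<le> 1")
  case True
  then have "\<bar>x\<bar> * tau z \<le> 1 * 1"
    using assms tau_le[of z] tau_pos[of z] by (intro mult_mono) auto
  then show ?thesis using tau_pos[of z] by (simp add: abs_mult)
next
  case False
  then have "inverse (cmod z) \<le> 1" by (simp add: inverse_le_1_iff)
  then have "\<bar>x\<bar> * tau z \<le> 1"
    using order_trans[OF mult_right_mono[OF assms, of "tau z"] tau_norm_le] tau_pos[of z] by linarith
  then show ?thesis using tau_pos[of z] by (simp add: abs_mult)
qed

lemma rep_bcontfun: "rep p P \<Longrightarrow> p \<in> bcontfun"
proof (induction rule: rep.induct)
  case re
  show ?case using coordinate_le_one[OF abs_Re_le_cmod]
    by (intro bcontfun_normI[of _ 1] continuous_on_mult tau_continuous continuous_intros) auto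
next
  case im
  show ?case using coordinate_le_one[OF abs_Im_le_cmod]
    by (intro bcontfun_normI[of _ 1] continuous_on_mult tau_continuous continuous_intros) auto
qed (auto intro: tau_bcontfun plus_cont bcontfun_mult const_bcontfun)

lemma rep_ext: "rep p P \<Longrightarrow> ext p P"
  unfolding ext_def using rep_bcontfun rep_cal[OF rep.mult[OF _ rep.tau]] by blast

lemma ext_commuting_outer:
  assumes P: "ext f P" and C: "commuting C A" "commuting C B" "commuting C T"
  shows "commuting C P"
proof -
  have "commuting C (P o\<^sub>L T)" using P unfolding ext_def by (blast intro: cal_commuting_outer C)
  then have "(C o\<^sub>L P) o\<^sub>L T = (P o\<^sub>L C) o\<^sub>L T"
    using C(3) by (intro blinfun_eqI) (simp add: commuting_def)
  then have "C o\<^sub>L P = P o\<^sub>L C" by (rule blinfun_eq_on_dense_range[OF dense])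
  then have "(C o\<^sub>L P) x = (P o\<^sub>L C) x" for x by simp
  then show ?thesis by (simp add: commuting_def)
qed

lemma ext_commuting_T: "ext f P \<Longrightarrow> commuting T P"
  by (rule ext_commuting_outer) (auto intro: comm commuting_sym commuting_intros)

text \<open>Only products with \<open>T\<close> are accessible, so both sides are compared after composing
  with \<open>T\<close> twice.\<close>

lemma ext_mult:
  assumes P: "ext f P" and Q: "ext g Q"
  shows "ext (\<lambda>z. f z * g z) (P o\<^sub>L Q)"
proof -
  have f: "f \<in> bcontfun" and g: "g \<in> bcontfun" using P Q by (auto simp: ext_def)
  have fg: "(\<lambda>z. f z * g z) \<in> bcontfun" by (rule bcontfun_mult[OF f g])
  obtain L where L: "cal (\<lambda>z. (f z * g z) * tau z) L" using cal_exists[OF fg] by blast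
  have "cal (\<lambda>z. ((f z * g z) * tau z) * tau z) (L o\<^sub>L T)"
    by (rule cal_mult[OF L rep_cal[OF rep.tau] bounded_times_tau[OF fg]])
      (use tau_bcontfun in \<open>simp add: bcontfun_def\<close>)
  moreover have "cal (\<lambda>z. (f z * tau z) * (g z * tau z)) ((P o\<^sub>L T) o\<^sub>L (Q o\<^sub>L T))"
    by (rule cal_mult) (use P Q in \<open>auto simp: ext_def intro: bounded_times_tau\<close>)
  ultimately have "L o\<^sub>L T = (P o\<^sub>L T) o\<^sub>L (Q o\<^sub>L T)"
    by (intro cal_unique[of "\<lambda>z. ((f z * g z) * tau z) * tau z"]) (simp_all add: mult_ac)
  also have "\<dots> = ((P o\<^sub>L Q) o\<^sub>L T) o\<^sub>L T"
    by (rule blinfun_eqI) (simp add: commutingD[OF ext_commuting_T[OF Q]])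
  finally have "L = (P o\<^sub>L Q) o\<^sub>L T" by (rule blinfun_eq_on_dense_range[OF dense])
  then show ?thesis using L fg by (simp add: ext_def)
qed

lemma ext_selfadj:
  assumes P: "ext f P" shows "selfadj P"
proof -
  have "(P (T u)) \<bullet> (T v) = T u \<bullet> P (T v)" for u v
  proof -
    have "selfadj (P o\<^sub>L T)" using P by (auto simp: ext_def intro: cal_selfadj)
    from selfadjD[OF this, of "T u" v] show ?thesis
      using commutingD[OF ext_commuting_T[OF P]] by (simp add: selfadjD[OF sa(3), symmetric])
  qed
  note TT = this
  show ?thesis unfolding selfadj_def
  proof (intro allI)
    fix x y
    obtain u where u: "(\<lambda>n. T (u n)) \<longlonglongrightarrow> x" using dense_rangeE[OF dense] by blast
    obtain v where v: "(\<lambda>n. T (v n)) \<longlonglongrightarrow> y" using dense_rangeE[OF dense] by blast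
    have "(\<lambda>n. P (T (u n)) \<bullet> T (v n)) \<longlonglongrightarrow> P x \<bullet> y" by (intro tendsto_intros u v)
    moreover note TT
    moreover have "(\<lambda>n. T (u n) \<bullet> P (T (v n))) \<longlonglongrightarrow> x \<bullet> P y" by (intro tendsto_intros u v)
    ultimately show "P x \<bullet> y = x \<bullet> P y" by (rule LIMSEQ_eqI)
  qed
qed

text \<open>Outside a large disc \<open>tau\<close> is small and the functions are bounded; inside it they
  converge uniformly.\<close>

lemma uniform_limit_times_tau:
  assumes C: "\<And>n z. \<bar>f n z\<bar> \<le> C" and K: "\<And>K. compact K \<Longrightarrow> uniform_limit K f g sequentially"
  shows "uniform_limit UNIV (\<lambda>n z. f n z * tau z) (\<lambda>z. g z * tau z) sequentially"
proof (rule uniform_limitI)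
  fix e :: real assume e: "0 < e"
  have gC: "\<bar>g z\<bar> \<le> C" for z
  proof (rule tendsto_upperbound)
    show "(\<lambda>n. \<bar>f n z\<bar>) \<longlonglongrightarrow> \<bar>g z\<bar>"
      using tendsto_uniform_limitI[OF K[of "{z}"]] by (intro tendsto_intros) auto
  qed (use C in auto)
  have "eventually (\<lambda>z. tau z < e / (2 * C + 1)) at_infinity"
    using tau_at_infinity(1) gC[of 0] e by (intro order_tendstoD) auto
  then obtain R where R: "\<And>z. R \<le> cmod z \<Longrightarrow> tau z < e / (2 * C + 1)"
    by (auto simp: eventually_at_infinity)
  have "eventually (\<lambda>n. \<forall>z\<in>cball 0 R. dist (f n z) (g z) < e) sequentially"
    by (intro uniform_limitD[OF K[OF compact_cball] e])
  then show "eventually (\<lambda>n. \<forall>z\<in>UNIV. dist (f n z * tau z) (g z * tau z) < e) sequentially"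
  proof eventually_elim
    case (elim n)
    have "\<bar>f n z - g z\<bar> * tau z < e" for z
    proof (cases "cmod z \<le> R")
      case True
      then have "\<bar>f n z - g z\<bar> < e" using elim by (auto simp: dist_real_def)
      then show ?thesis using mult_left_mono[OF tau_le[of z] abs_ge_zero[of "f n z - g z"]] by simp
    next
      case False
      have C1: "0 < 2 * C + 1" using gC[of 0] by linarith
      have "\<bar>f n z - g z\<bar> \<le> 2 * C + 1" using C[of n z] gC[of z] by linarith
      then have "\<bar>f n z - g z\<bar> * tau z \<le> (2 * C + 1) * tau z"
        using tau_pos[of z] by (intro mult_right_mono) auto
      also have "\<dots> < e" using R[of z] False C1 by (simp add: field_simps)
      finally show ?thesis .
    qed
    then show ?case using tau_pos by (simp add: dist_real_def left_diff_distrib[symmetric] abs_mult abs_of_pos)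
  qed
qed

lemma cal_uniform_limit:
  assumes cal: "\<And>n. cal (f n) (P n)" "cal g Q" and lim: "uniform_limit UNIV f g sequentially"
  shows "P \<longlonglongrightarrow> Q"
proof (rule metric_LIMSEQ_I)
  fix e :: real assume e: "0 < e"
  then have "eventually (\<lambda>n. \<forall>z\<in>UNIV. dist (f n z) (g z) < e/2) sequentially"
    using lim by (intro uniform_limitD) auto
  then have "eventually (\<lambda>n. dist (P n) Q < e) sequentially"
  proof eventually_elim
    case (elim n)
    have "norm (P n - Q) \<le> e / 2"
      by (rule cal_norm_le[OF cal_diff[OF cal]]) (use elim in \<open>auto simp: dist_real_def intro: less_imp_le\<close>)
    then show ?case using e by (simp add: dist_norm)
  qed
  then show "\<exists>no. \<forall>n\<ge>no. dist (P n) Q < e" by (simp add: eventually_sequentially)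
qed

text \<open>On the range of \<open>T\<close> the convergence is \<open>cal_uniform_limit\<close>. The operators are
  uniformly bounded, so it carries over to the closure.\<close>

lemma ext_tendsto:
  assumes P: "\<And>n. ext (f n) (P n)" and Q: "ext g Q" and C: "\<And>n z. \<bar>f n z\<bar> \<le> C"
    and K: "\<And>K. compact K \<Longrightarrow> uniform_limit K f g sequentially"
  shows "(\<lambda>n. P n v) \<longlonglongrightarrow> Q v"
proof (rule metric_LIMSEQ_I)
  fix e :: real assume e: "0 < e"
  have C0: "0 \<le> C" using C[of 0 0] by linarith
  define M where "M = C + norm Q + 1"
  have M: "0 < M" using C0 by (simp add: M_def add_nonneg_pos)
  obtain w where w: "(\<lambda>n. T (w n)) \<longlonglongrightarrow> v" using dense_rangeE[OF dense] by blast
  then obtain k where k: "dist (T (w k)) v < e / (2 * M)"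
    using metric_LIMSEQ_D[OF w, of "e / (2 * M)"] e M by auto
  define u where "u = T (w k)"
  have "(\<lambda>n. P n o\<^sub>L T) \<longlonglongrightarrow> (Q o\<^sub>L T)"
    by (rule cal_uniform_limit[OF _ _ uniform_limit_times_tau[OF C K]]) (use P Q in \<open>auto simp: ext_def\<close>)
  then have "(\<lambda>n. (P n o\<^sub>L T) (w k)) \<longlonglongrightarrow> (Q o\<^sub>L T) (w k)"
    by (rule blinfun.tendsto[OF _ tendsto_const])
  then have "(\<lambda>n. P n u) \<longlonglongrightarrow> Q u" by (simp add: u_def)
  from metric_LIMSEQ_D[OF this, of "e/2"] e
  obtain N where N: "\<And>n. N \<le> n \<Longrightarrow> norm (P n u - Q u) < e / 2"
    by (auto simp: dist_norm)
  show "\<exists>no. \<forall>n\<ge>no. dist (P n v) (Q v) < e"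
  proof (intro exI[of _ N] allI impI)
    fix n assume "N \<le> n"
    have "norm (P n v - Q v) = norm ((P n u - Q u) + (P n - Q) (v - u))"
      by (simp add: blinfun.bilinear_simps)
    also have "\<dots> \<le> norm (P n u - Q u) + norm ((P n - Q) (v - u))" by (rule norm_triangle_ineq)
    also have "norm ((P n - Q) (v - u)) \<le> M * norm (v - u)"
    proof (rule blinfun_norm_le)
      show "norm (P n - Q) \<le> M"
        using norm_triangle_ineq4[of "P n" Q] ext_norm_le[OF P C, of n] by (simp add: M_def)
    qed
    also have "\<dots> \<le> M * (e / (2 * M))"
      using k M unfolding u_def dist_norm norm_minus_commute[of "T (w k)" v]
      by (intro mult_left_mono less_imp_le) auto
    also have "\<dots> = e / 2" using M by simp
    finally show "dist (P n v) (Q v) < e" using N[OF \<open>N \<le> n\<close>] by (simp add: dist_norm)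
  qed
qed

definition fc :: "(complex \<Rightarrow> real) \<Rightarrow> 'h \<Rightarrow>\<^sub>L 'h" where
  "fc f = (THE Q. ext f Q)"

lemma fc_eqI: "ext f Q \<Longrightarrow> fc f = Q"
  unfolding fc_def by (blast intro: ext_unique)

lemma ext_fc: "f \<in> bcontfun \<Longrightarrow> ext f (fc f)"
proof -
  assume f: "f \<in> bcontfun"
  obtain C where C: "\<And>z. norm (f z) \<le> C" using bcontfun_bound[OF f] by blast
  obtain Q where "ext f Q" by (rule ext_exists[OF f]) (rule C[unfolded real_norm_def])
  then show ?thesis using fc_eqI by simp
qed

end

section \<open>Elementary laws of complex Hilbert spaces\<close>

instance complex_hilbert \<subseteq> banach ..

lemma scaleC_zero_left [simp]: "0 *\<^sub>C x = (0::'h::complex_hilbert)"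
  using scaleR_scaleC[of 0 x] by simp

lemma scaleC_one [simp]: "1 *\<^sub>C x = (x::'h::complex_hilbert)"
  using scaleR_scaleC[of 1 x] by simp

lemma scaleC_of_real: "complex_of_real r *\<^sub>C x = r *\<^sub>R (x::'h::complex_hilbert)"
  using scaleR_scaleC[of r x] by simp

lemma scaleC_zero_right [simp]: "a *\<^sub>C 0 = (0::'h::complex_hilbert)"
  using scaleC_add_right[of a "0::'h" 0] by simp

lemma scaleC_scaleR: "a *\<^sub>C (r *\<^sub>R x) = r *\<^sub>R (a *\<^sub>C (x::'h::complex_hilbert))"
  by (simp add: scaleR_scaleC scaleC_scaleC mult.commute)

lemma scaleC_minus_right: "a *\<^sub>C (- x) = - (a *\<^sub>C (x::'h::complex_hilbert))"
  using scaleC_scaleR[of a "-1" x] by simp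

lemma scaleC_minus_left: "(- a) *\<^sub>C x = - (a *\<^sub>C (x::'h::complex_hilbert))"
  using scaleC_add_left[of a "-a" x] by (simp add: eq_neg_iff_add_eq_0 add.commute)

lemma scaleC_diff_right: "a *\<^sub>C (x - y) = a *\<^sub>C x - a *\<^sub>C (y::'h::complex_hilbert)"
  using scaleC_add_right[of a x "-y"] by (simp add: scaleC_minus_right)

lemma scaleC_Re_Im: "c *\<^sub>C x = Re c *\<^sub>R x + Im c *\<^sub>R (\<i> *\<^sub>C (x::'h::complex_hilbert))"
proof -
  have "c = complex_of_real (Re c) + complex_of_real (Im c) * \<i>"
    by (simp add: complex_eq_iff)
  from arg_cong[OF this, of "\<lambda>a. a *\<^sub>C x"] show ?thesis by (simp add: scaleC_add_left scaleC_of_real scaleC_scaleC[symmetric])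
qed

lemma i_i_scaleC [simp]: "\<i> *\<^sub>C (\<i> *\<^sub>C x) = - (x::'h::complex_hilbert)"
  using scaleC_minus_left[of 1 x] by (simp add: scaleC_scaleC)

lemma cinner_add_left: "cinner (x + y) z = cinner x z + cinner y (z::'h::complex_hilbert)"
  using cinner_add_right[of z x y] cinner_commute[of "x + y" z] cinner_commute[of x z] cinner_commute[of y z]
  by simp

lemma cinner_scaleC_left: "cinner (a *\<^sub>C x) y = cnj a * cinner x (y::'h::complex_hilbert)"
  using cinner_scaleC_right[of y a x] cinner_commute[of "a *\<^sub>C x" y] cinner_commute[of x y] by simp

lemma cinner_zero_left [simp]: "cinner 0 x = 0" and cinner_zero_right [simp]: "cinner x (0::'h::complex_hilbert) = 0"
  using cinner_add_left[of "0::'h" 0 x] cinner_add_right[of x "0::'h" 0] by simp_all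

lemma cinner_minus_left: "cinner (- x) y = - cinner x (y::'h::complex_hilbert)"
  using cinner_add_left[of x "-x" y] by (simp add: eq_neg_iff_add_eq_0 add.commute)

lemma cinner_minus_right: "cinner x (- y) = - cinner x (y::'h::complex_hilbert)"
  using cinner_add_right[of x y "-y"] by (simp add: eq_neg_iff_add_eq_0 add.commute)

lemma cinner_diff_left: "cinner (x - y) z = cinner x z - cinner y (z::'h::complex_hilbert)"
  using cinner_add_left[of x "-y" z] by (simp add: cinner_minus_left)

lemma cinner_diff_right: "cinner z (x - y) = cinner z x - cinner z (y::'h::complex_hilbert)"
  using cinner_add_right[of z x "-y"] by (simp add: cinner_minus_right)

lemma cinner_eq_inner: "cinner x y = Complex (x \<bullet> y) (- (x \<bullet> (\<i> *\<^sub>C (y::'h::complex_hilbert))))"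
  by (simp add: inner_eq_Re_cinner cinner_scaleC_right complex_eq_iff)

lemma cinner_self: "cinner x x = complex_of_real ((norm (x::'h::complex_hilbert))\<^sup>2)"
proof -
  have "Im (cinner x x) = 0" using cinner_commute[of x x] by (simp add: complex_eq_iff)
  then show ?thesis by (simp add: complex_eq_iff power2_norm_eq_inner inner_eq_Re_cinner)
qed

lemma inner_i_left: "(\<i> *\<^sub>C x) \<bullet> y = - (x \<bullet> (\<i> *\<^sub>C (y::'h::complex_hilbert)))"
  by (simp add: inner_eq_Re_cinner cinner_scaleC_left cinner_scaleC_right)

lemma norm_scaleC: "norm (a *\<^sub>C x) = cmod a * norm (x::'h::complex_hilbert)"
proof -
  have "complex_of_real ((norm (a *\<^sub>C x))\<^sup>2) = cnj a * a * complex_of_real ((norm x)\<^sup>2)"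
    unfolding cinner_self[symmetric] by (simp add: cinner_scaleC_left cinner_scaleC_right mult_ac)
  also have "cnj a * a = complex_of_real ((cmod a)\<^sup>2)" by (metis complex_norm_square mult.commute)
  also have "complex_of_real ((cmod a)\<^sup>2) * complex_of_real ((norm x)\<^sup>2) = complex_of_real ((cmod a * norm x)\<^sup>2)"
    by (simp add: power_mult_distrib)
  finally have "(norm (a *\<^sub>C x))\<^sup>2 = (cmod a * norm x)\<^sup>2" by (simp only: of_real_eq_iff)
  then show ?thesis by (simp add: power2_eq_iff_nonneg)
qed

lemma bounded_linear_scaleC: "bounded_linear (\<lambda>x::'h::complex_hilbert. a *\<^sub>C x)"
  by (rule bounded_linear_intro[of _ "cmod a"])
    (simp_all add: scaleC_add_right scaleC_scaleR norm_scaleC mult.commute)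

lemma closure_of_subspace:
  fixes V :: "'a::real_normed_vector set"
  assumes V: "subspace V" shows "subspace (closure V)"
proof (rule subspaceI)
  show "0 \<in> closure V" using subspace_0[OF V] closure_subset by blast
next
  fix x y assume "x \<in> closure V" "y \<in> closure V"
  then obtain f g where "\<And>n. f n \<in> V" "f \<longlonglongrightarrow> x" "\<And>n. g n \<in> V" "g \<longlonglongrightarrow> y"
    unfolding closure_sequential by blast
  then have "(\<lambda>n. f n + g n) \<longlonglongrightarrow> x + y" "\<And>n. f n + g n \<in> V"
    by (auto intro: tendsto_add subspace_add[OF V])
  then show "x + y \<in> closure V" unfolding closure_sequential by (intro exI[of _ "\<lambda>n. f n + g n"]) blast
next
  fix c x assume "x \<in> closure V"
  then obtain f where "\<And>n. f n \<in> V" "f \<longlonglongrightarrow> x" unfolding closure_sequential by blast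
  then have "(\<lambda>n. c *\<^sub>R f n) \<longlonglongrightarrow> c *\<^sub>R x" "\<And>n. c *\<^sub>R f n \<in> V"
    by (auto intro: tendsto_scaleR tendsto_const subspace_mul[OF V])
  then show "c *\<^sub>R x \<in> closure V" unfolding closure_sequential by (intro exI[of _ "\<lambda>n. c *\<^sub>R f n"]) blast
qed

section \<open>The bounded operators attached to a normal operator\<close>

text \<open>Since an operator is complex linear, the real part of the inner product suffices to
  recognise its adjoint.\<close>

lemma adj_iff_inner:
  assumes X: "linear_operator X"
  shows "(u, w) \<in> adj X \<longleftrightarrow> (\<forall>(v, x)\<in>X. u \<bullet> x = w \<bullet> v)"
proof
  assume "(u, w) \<in> adj X"
  then show "\<forall>(v, x)\<in>X. u \<bullet> x = w \<bullet> v" by (auto simp: adj_def inner_eq_Re_cinner)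
next
  assume *: "\<forall>(v, x)\<in>X. u \<bullet> x = w \<bullet> v"
  have "cinner u x = cinner w v" if "(v, x) \<in> X" for v x
  proof -
    have "(\<i> *\<^sub>C v, \<i> *\<^sub>C x) \<in> X" using X that by (auto simp: linear_operator_def)
    then show ?thesis using * that unfolding cinner_eq_inner by force
  qed
  then show "(u, w) \<in> adj X" by (auto simp: adj_def)
qed

lemma linear_operator_subspace:
  assumes "linear_operator X" shows "subspace X"
proof (rule subspaceI)
  show "0 \<in> X" using assms by (simp add: linear_operator_def zero_prod_def)
  show "p + q \<in> X" if "p \<in> X" "q \<in> X" for p q using assms that by (simp add: linear_operator_def)
  show "c *\<^sub>R p \<in> X" if "p \<in> X" for c p
    using assms that unfolding linear_operator_def by (cases p) (auto simp: scaleR_scaleC)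
qed

lemma linear_operator_closure_ops:
  assumes "linear_operator X" "(v, x) \<in> X" "(w, y) \<in> X"
  shows "(v + w, x + y) \<in> X" "(v - w, x - y) \<in> X" "(c *\<^sub>C v, c *\<^sub>C x) \<in> X"
  using assms subspace_add[OF linear_operator_subspace[OF assms(1)], of "(v, x)" "(w, y)"]
    subspace_diff[OF linear_operator_subspace[OF assms(1)], of "(v, x)" "(w, y)"]
  by (auto simp: linear_operator_def)

lemma adj_closure_ops:
  assumes "(v, x) \<in> adj X" "(w, y) \<in> adj X"
  shows "(v + w, x + y) \<in> adj X" "(v - w, x - y) \<in> adj X" "(c *\<^sub>C v, c *\<^sub>C x) \<in> adj X"
  using assms by (fastforce simp: adj_def cinner_add_left cinner_diff_left cinner_scaleC_left)+

lemma adj_single_valued: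
  assumes "closure (Domain X) = UNIV" "(u, w) \<in> adj X" "(u, w') \<in> adj X"
  shows "w = w'"
proof -
  have "(w - w') \<bullet> v = 0" if "v \<in> Domain X" for v
  proof -
    obtain x where "(v, x) \<in> X" using \<open>v \<in> Domain X\<close> by auto
    then have "cinner w v = cinner w' v" using assms(2,3) by (force simp: adj_def)
    then show ?thesis by (simp add: inner_eq_Re_cinner cinner_diff_left)
  qed
  then have "Domain X \<subseteq> {v. (w - w') \<bullet> v = 0}" by auto
  then have "closure (Domain X) \<subseteq> {v. (w - w') \<bullet> v = 0}"
    by (rule closure_minimal) (intro closed_Collect_eq continuous_intros)
  then have "(w - w') \<bullet> (w - w') = 0" using assms(1) by blast
  then show ?thesis by simp
qed

locale normal_op =
  fixes X :: "('h::complex_hilbert \<times> 'h) set"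
  assumes normal: "normal_operator X"
begin

lemma lin: "linear_operator X" and dom: "closure (Domain X) = UNIV" and clos: "closed X"
  and XX: "adj X O X = X O adj X"
  using normal by (auto simp: normal_operator_def)

lemma adjD: "(u, w) \<in> adj X \<Longrightarrow> (v, x) \<in> X \<Longrightarrow> u \<bullet> x = w \<bullet> v"
  using adj_iff_inner[OF lin] by auto

text \<open>Projecting \<open>(w, 0)\<close> orthogonally onto the graph of \<open>X\<close> yields the solution of
  $(1 + X^* X) u = w$.\<close>

lemma resolvent_exists: "\<exists>u x. (u, x) \<in> X \<and> (x, w - u) \<in> adj X"
proof -
  obtain p where p: "p \<in> X" "\<And>s. s \<in> X \<Longrightarrow> ((w, 0) - p) \<bullet> s = 0"
    using closed_subspace_projection[OF linear_operator_subspace[OF lin] clos] by metis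
  obtain u x where ux: "p = (u, x)" by force
  have "x \<bullet> y = (w - u) \<bullet> v" if "(v, y) \<in> X" for v y
    using p(2)[OF that] by (simp add: ux inner_prod_def)
  then have "(x, w - u) \<in> adj X" by (auto simp: adj_iff_inner[OF lin])
  with p(1) ux show ?thesis by blast
qed

lemma resolvent_unique:
  assumes "(u, x) \<in> X" "(x, w - u) \<in> adj X" "(u', x') \<in> X" "(x', w - u') \<in> adj X"
  shows "u = u'" "x = x'"
proof -
  have "(u - u', x - x') \<in> X" by (rule linear_operator_closure_ops(2)[OF lin assms(1,3)])
  moreover have "(x - x', (w - u) - (w - u')) \<in> adj X" by (rule adj_closure_ops(2)[OF assms(2,4)])
  ultimately have "(x - x') \<bullet> (x - x') = ((w - u) - (w - u')) \<bullet> (u - u')" using adjD by blast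
  also have "\<dots> = - ((u - u') \<bullet> (u - u'))" by (simp add: inner_diff_left)
  finally have "(x - x') \<bullet> (x - x') = 0 \<and> (u - u') \<bullet> (u - u') = 0"
    using inner_ge_zero[of "x - x'"] inner_ge_zero[of "u - u'"] by linarith
  then show "u = u'" "x = x'" by auto
qed

text \<open>These are $T = (1 + X^* X)^{-1}$ and $S = X T$; the pair is characterised by
  \<open>TS_eqI\<close>.\<close>

definition T where "T w = (SOME u. \<exists>x. (u, x) \<in> X \<and> (x, w - u) \<in> adj X)"
definition S where "S w = (SOME x. (T w, x) \<in> X \<and> (x, w - T w) \<in> adj X)"

lemma TS: "(T w, S w) \<in> X" "(S w, w - T w) \<in> adj X"
proof -
  have "\<exists>x. (T w, x) \<in> X \<and> (x, w - T w) \<in> adj X"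
    unfolding T_def by (rule someI_ex[OF resolvent_exists])
  from someI_ex[OF this] show "(T w, S w) \<in> X" "(S w, w - T w) \<in> adj X"
    unfolding S_def by auto
qed

lemma TS_eqI:
  assumes "(u, x) \<in> X" "(x, w - u) \<in> adj X" shows "T w = u" "S w = x"
  using resolvent_unique[OF TS assms] by auto

lemma TS_add: "T (v + w) = T v + T w" "S (v + w) = S v + S w"
proof -
  have "(v - T v) + (w - T w) = (v + w) - (T v + T w)" by simp
  then have "(S v + S w, (v + w) - (T v + T w)) \<in> adj X" using adj_closure_ops(1)[OF TS(2) TS(2)] by metis
  with linear_operator_closure_ops(1)[OF lin TS(1) TS(1)]
  show "T (v + w) = T v + T w" "S (v + w) = S v + S w" by (rule TS_eqI)+
qed

lemma TS_scaleC: "T (c *\<^sub>C w) = c *\<^sub>C T w" "S (c *\<^sub>C w) = c *\<^sub>C S w"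
proof -
  have "c *\<^sub>C (w - T w) = c *\<^sub>C w - c *\<^sub>C T w" by (simp add: scaleC_diff_right)
  then have "(c *\<^sub>C S w, c *\<^sub>C w - c *\<^sub>C T w) \<in> adj X" using adj_closure_ops(3)[OF TS(2) TS(2)] by metis
  with linear_operator_closure_ops(3)[OF lin TS(1) TS(1)]
  show "T (c *\<^sub>C w) = c *\<^sub>C T w" "S (c *\<^sub>C w) = c *\<^sub>C S w" by (rule TS_eqI)+
qed

lemma T_inner: "v \<bullet> T w = T v \<bullet> T w + S v \<bullet> S w"
  using adjD[OF TS(2) TS(1), of v w] by (simp add: inner_diff_left)

lemma T_selfadj: "T v \<bullet> w = v \<bullet> T w"
  using T_inner[of v w] T_inner[of w v] by (simp add: inner_commute)

lemma norm_T_le: "norm (T w) \<le> norm w" and norm_S_le: "norm (S w) \<le> norm w"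
proof -
  have eq: "w \<bullet> T w = (norm (T w))\<^sup>2 + (norm (S w))\<^sup>2" unfolding power2_norm_eq_inner by (rule T_inner)
  have cs: "w \<bullet> T w \<le> norm w * norm (T w)" by (rule norm_cauchy_schwarz)
  have "norm (T w) * norm (T w) \<le> norm w * norm (T w)"
    using eq cs zero_le_power2[of "norm (S w)"] unfolding power2_eq_square by linarith
  then show 1: "norm (T w) \<le> norm w" by (cases "norm (T w) = 0") (auto simp: mult_le_cancel_right)
  have "norm w * norm (T w) \<le> norm w * norm w" using 1 by (intro mult_left_mono) auto
  then have "(norm (S w))\<^sup>2 \<le> (norm w)\<^sup>2"
    using eq cs zero_le_power2[of "norm (T w)"] unfolding power2_eq_square by linarith
  then show "norm (S w) \<le> norm w" by (rule power2_le_imp_le) simp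
qed

lemma T_bl: "bounded_linear T" and S_bl: "bounded_linear S"
  by (rule bounded_linear_intro[of _ 1]; use norm_T_le norm_S_le in \<open>simp add: TS_add TS_scaleC scaleR_scaleC\<close>)+

text \<open>A vector orthogonal to the range of \<open>T\<close> is annihilated by \<open>T\<close> and \<open>S\<close>, so it is the
  value of $X^*$ at 0.\<close>

lemma dense_range_T: "closure (range T) = UNIV"
proof -
  have sub: "subspace (range T)" by (rule linear_subspace_image[OF bounded_linear.linear[OF T_bl] subspace_UNIV])
  have "w \<in> closure (range T)" for w
  proof -
    obtain p where p: "p \<in> closure (range T)" "\<And>s. s \<in> closure (range T) \<Longrightarrow> (w - p) \<bullet> s = 0"
      using closed_subspace_projection[OF closure_of_subspace[OF sub] closed_closure] by metis
    define r where "r = w - p"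
    have "r \<bullet> T r = 0" unfolding r_def by (rule p(2)) (rule subsetD[OF closure_subset rangeI])
    then have "T r \<bullet> T r = 0 \<and> S r \<bullet> S r = 0"
      using T_inner[of r r] inner_ge_zero[of "T r"] inner_ge_zero[of "S r"] by linarith
    then have "T r = 0" "S r = 0" by auto
    then have "(0, r) \<in> adj X" using TS(2)[of r] by simp
    moreover have "(0, 0) \<in> adj X" by (auto simp: adj_def)
    ultimately have "r = 0" by (rule adj_single_valued[OF dom])
    then show ?thesis using p(1) by (simp add: r_def)
  qed
  then show ?thesis by auto
qed

text \<open>Normality enters here: the element $X^* X u$ of $H$ is also $X X^* u$.\<close>

lemma adjoint_of_S_exists: "\<exists>m. (T w, m) \<in> adj X \<and> (m, w - T w) \<in> X"
proof -
  have "(T w, w - T w) \<in> X O adj X" using TS by blast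
  then have "(T w, w - T w) \<in> adj X O X" unfolding XX .
  then show ?thesis by auto
qed

text \<open>This is $X^* T$, which turns out to be the adjoint of \<open>S\<close> (\<open>S_adjoint\<close>).\<close>

definition S' where "S' w = (SOME m. (T w, m) \<in> adj X \<and> (m, w - T w) \<in> X)"

lemma S': "(T w, S' w) \<in> adj X" "(S' w, w - T w) \<in> X"
  unfolding S'_def using someI_ex[OF adjoint_of_S_exists] by auto

lemma S_adjoint: "S v \<bullet> w = v \<bullet> S' w"
proof -
  have "S v \<bullet> w = T w \<bullet> S v + S v \<bullet> (w - T w)" by (simp add: inner_diff_right inner_commute)
  also have "T w \<bullet> S v = S' w \<bullet> T v" by (rule adjD[OF S'(1) TS(1)])
  also have "S v \<bullet> (w - T w) = (v - T v) \<bullet> S' w" by (rule adjD[OF TS(2) S'(2)])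
  finally show ?thesis by (simp add: inner_diff_left inner_commute[of "S' w"])
qed

lemma inner_eqI: "(\<And>v. v \<bullet> x = v \<bullet> y) \<Longrightarrow> x = (y::'h)"
  by (metis inner_diff_right inner_eq_zero_iff right_minus_eq)

lemma S'_bl: "bounded_linear S'"
proof (rule bounded_linear_intro[of _ 1])
  show "S' (x + y) = S' x + S' y" for x y
    by (rule inner_eqI) (simp add: S_adjoint[symmetric] inner_add_right)
  show "S' (r *\<^sub>R x) = r *\<^sub>R S' x" for r x
    by (rule inner_eqI) (simp add: S_adjoint[symmetric])
  show "norm (S' x) \<le> norm x * 1" for x
  proof -
    have "norm (S' x) * norm (S' x) = S (S' x) \<bullet> x"
      by (simp add: S_adjoint power2_norm_eq_inner[symmetric] power2_eq_square)
    also have "\<dots> \<le> norm (S' x) * norm x"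
      using norm_cauchy_schwarz[of "S (S' x)" x] norm_S_le[of "S' x"]
      by (meson mult_right_mono norm_ge_zero order_trans)
    finally show ?thesis by (cases "norm (S' x) = 0") (auto simp: mult_le_cancel_left)
  qed
qed

lemma S'_i: "S' (\<i> *\<^sub>C w) = \<i> *\<^sub>C S' w"
proof (rule inner_eqI)
  fix v
  have "v \<bullet> S' (\<i> *\<^sub>C w) = S v \<bullet> (\<i> *\<^sub>C w)" by (simp add: S_adjoint)
  also have "\<dots> = - (S (\<i> *\<^sub>C v) \<bullet> w)" by (simp add: TS_scaleC inner_i_left)
  also have "\<dots> = v \<bullet> (\<i> *\<^sub>C S' w)" by (simp add: S_adjoint inner_i_left)
  finally show "v \<bullet> S' (\<i> *\<^sub>C w) = v \<bullet> (\<i> *\<^sub>C S' w)" .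
qed

text \<open>The operator \<open>X\<close> maps $T w - T T w = X^* S T w$ to $S w - S T w$. By normality
  \<open>S (T w)\<close> therefore solves the equation that characterises \<open>T (S w)\<close>.\<close>

lemma TS_commute: "T (S w) = S (T w)"
proof -
  let ?a = "S (T w)" and ?y = "T (T w)"
  have "(?a, T w - ?y) \<in> adj X" by (rule TS(2))
  moreover have "(T w - ?y, S w - ?a) \<in> X" by (rule linear_operator_closure_ops(2)[OF lin TS(1) TS(1)])
  ultimately have "(?a, S w - ?a) \<in> adj X O X" by blast
  then have "(?a, S w - ?a) \<in> X O adj X" unfolding XX .
  then obtain k where "(?a, k) \<in> X" "(k, S w - ?a) \<in> adj X" by auto
  then show ?thesis by (rule TS_eqI)
qed

lemma TS'_commute: "T (S' w) = S' (T w)"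
  by (rule inner_eqI) (simp add: T_selfadj[symmetric] S_adjoint[symmetric] TS_commute)

lemma S'S: "S' (S w) = T w - T (T w)"
proof (rule adj_single_valued[OF dom])
  show "(S (T w), S' (S w)) \<in> adj X" using S'(1)[of "S w"] by (simp add: TS_commute)
  show "(S (T w), T w - T (T w)) \<in> adj X" by (rule TS(2))
qed

lemma SS': "S (S' w) = T w - T (T w)"
proof -
  have "(S' (T w), S (S' w)) \<in> X" using TS(1)[of "S' w"] by (simp add: TS'_commute)
  moreover have "(S' (T w), T w - T (T w)) \<in> X" by (rule S'(2))
  moreover have "single_valued X" using lin by (simp add: linear_operator_def)
  ultimately show ?thesis by (rule single_valuedD[rotated])
qed

text \<open>The real part \<open>Ab\<close> and the imaginary part \<open>Bb\<close> of \<open>S\<close>, and \<open>T\<close>, as bounded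
  operators.\<close>

definition Tb where "Tb = Blinfun T"
definition Ab where "Ab = Blinfun (\<lambda>w. (1/2) *\<^sub>R (S w + S' w))"
definition Bb where "Bb = Blinfun (\<lambda>w. (1/2) *\<^sub>R (\<i> *\<^sub>C (S' w - S w)))"

lemma apply_simps:
  "blinfun_apply Tb w = T w"
  "blinfun_apply Ab w = (1/2) *\<^sub>R (S w + S' w)"
  "blinfun_apply Bb w = (1/2) *\<^sub>R (\<i> *\<^sub>C (S' w - S w))"
proof -
  have "bounded_linear (\<lambda>w. (1/2) *\<^sub>R (S w + S' w))"
    by (intro bounded_linear_scaleR_right[THEN bounded_linear_compose] bounded_linear_add S_bl S'_bl)
  moreover have "bounded_linear (\<lambda>w. (1/2) *\<^sub>R (\<i> *\<^sub>C (S' w - S w)))"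
    by (intro bounded_linear_scaleR_right[THEN bounded_linear_compose]
        bounded_linear_scaleC[THEN bounded_linear_compose] bounded_linear_sub S_bl S'_bl)
  ultimately show "blinfun_apply Tb w = T w"
    "blinfun_apply Ab w = (1/2) *\<^sub>R (S w + S' w)"
    "blinfun_apply Bb w = (1/2) *\<^sub>R (\<i> *\<^sub>C (S' w - S w))"
    by (simp_all add: Tb_def Ab_def Bb_def bounded_linear_Blinfun_apply T_bl S_bl)
qed

lemma lin_simps:
  "T (v - w) = T v - T w" "S (v - w) = S v - S w" "S' (v + w) = S' v + S' w" "S' (v - w) = S' v - S' w"
  "T (r *\<^sub>R v) = r *\<^sub>R T v" "S (r *\<^sub>R v) = r *\<^sub>R S v" "S' (r *\<^sub>R v) = r *\<^sub>R S' v"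
  using linear_diff[OF bounded_linear.linear[OF T_bl]] linear_diff[OF bounded_linear.linear[OF S_bl]]
    linear_diff[OF bounded_linear.linear[OF S'_bl]] linear_add[OF bounded_linear.linear[OF S'_bl]]
    linear_cmul[OF bounded_linear.linear[OF T_bl]] linear_cmul[OF bounded_linear.linear[OF S_bl]]
    linear_cmul[OF bounded_linear.linear[OF S'_bl]] by auto

lemma S'_adjoint: "S' v \<bullet> w = v \<bullet> S w"
  using S_adjoint[of w v] by (simp add: inner_commute)

sublocale sphere_triple Ab Bb Tb
proof
  show "selfadj Tb" by (simp add: selfadj_def apply_simps T_selfadj)
  show "selfadj Ab"
    by (simp add: selfadj_def apply_simps inner_add_left inner_add_right S_adjoint S'_adjoint add.commute)
  show "selfadj Bb"
    by (simp add: selfadj_def apply_simps inner_diff_left inner_diff_right S_adjoint S'_adjoint inner_i_left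
        scaleC_diff_right TS_scaleC S'_i)
  show "commuting Ab Tb" "commuting Bb Tb"
    by (simp_all add: commuting_def apply_simps lin_simps TS_add TS_scaleC TS_commute TS'_commute)
  show "commuting Ab Bb"
    by (simp add: commuting_def apply_simps lin_simps TS_add TS_scaleC S'_i SS' S'S scaleC_scaleR
        scaleC_add_right scaleC_diff_right algebra_simps)
  show "Ab (Ab x) + Bb (Bb x) = Tb x - Tb (Tb x)" for x
  proof -
    have "Ab (Ab x) = (1/4) *\<^sub>R (S (S x) + S' (S' x) + 2 *\<^sub>R (T x - T (T x)))"
      by (simp add: apply_simps lin_simps TS_add SS' S'S scaleR_2 scaleR_add_right)
    moreover have "Bb (Bb x) = (1/4) *\<^sub>R (- S (S x) - S' (S' x) + 2 *\<^sub>R (T x - T (T x)))"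
      by (simp add: apply_simps lin_simps TS_scaleC S'_i SS' S'S scaleR_2 scaleC_scaleR scaleC_diff_right
          scaleR_diff_right scaleR_add_right scaleC_minus_right)
    moreover have "(1/4) *\<^sub>R (a + b + 2 *\<^sub>R d) + (1/4) *\<^sub>R (- a - b + 2 *\<^sub>R d) = d" for a b d :: 'h
      by (simp add: scaleR_add_right scaleR_diff_right flip: scaleR_add_left)
    ultimately show ?thesis by (simp only: apply_simps)
  qed
  show "closure (range Tb) = UNIV" using dense_range_T by (simp add: apply_simps)
qed

lemma fc_rep: "rep p P \<Longrightarrow> fc p = P"
  by (rule fc_eqI[OF rep_ext])

lemma fc_add: "f \<in> bcontfun \<Longrightarrow> g \<in> bcontfun \<Longrightarrow> fc (\<lambda>z. f z + g z) = fc f + fc g"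
  by (intro fc_eqI ext_add ext_fc)

lemma fc_scale: "f \<in> bcontfun \<Longrightarrow> fc (\<lambda>z. c * f z) = c *\<^sub>R fc f"
  by (intro fc_eqI ext_scale ext_fc)

lemma fc_minus: "f \<in> bcontfun \<Longrightarrow> fc (\<lambda>z. - f z) = - fc f"
  using fc_scale[of f "-1"] by simp

lemma fc_diff: "f \<in> bcontfun \<Longrightarrow> g \<in> bcontfun \<Longrightarrow> fc (\<lambda>z. f z - g z) = fc f - fc g"
  using fc_add[of f "\<lambda>z. - g z"] fc_minus[of g] uminus_cont[of g] by simp

lemma fc_mult: "f \<in> bcontfun \<Longrightarrow> g \<in> bcontfun \<Longrightarrow> fc (\<lambda>z. f z * g z) = fc f o\<^sub>L fc g"
  by (intro fc_eqI ext_mult ext_fc)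

end

section \<open>The functional calculus of a normal operator\<close>

lemma bcontfun_Re_Im:
  fixes f :: "complex \<Rightarrow> complex"
  assumes "f \<in> bcontfun"
  shows "(\<lambda>z. Re (f z)) \<in> bcontfun" "(\<lambda>z. Im (f z)) \<in> bcontfun"
proof -
  obtain C where C: "\<And>z. cmod (f z) \<le> C" using bcontfun_bound[OF assms] by blast
  have "continuous_on UNIV f" by (rule bcontfun_continuous[OF assms])
  then show "(\<lambda>z. Re (f z)) \<in> bcontfun" "(\<lambda>z. Im (f z)) \<in> bcontfun"
    using order_trans[OF abs_Re_le_cmod C] order_trans[OF abs_Im_le_cmod C]
    by (auto intro!: bcontfun_normI[of _ C] continuous_intros)
qed

lemma bcontfun_of_real:
  fixes f :: "complex \<Rightarrow> real"
  assumes "f \<in> bcontfun" shows "(\<lambda>z. complex_of_real (f z)) \<in> bcontfun"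
proof -
  obtain C where "\<And>z. norm (f z) \<le> C" using bcontfun_bound[OF assms] by blast
  then have "norm (complex_of_real (f z)) \<le> C" for z by simp
  then show ?thesis by (rule bcontfun_normI[OF continuous_on_of_real[OF bcontfun_continuous[OF assms]]])
qed

text \<open>The product of this function with \<open>tau\<close> is the cut-off factor
  $n \tau / (1 + n \tau)$, which tends to 1 locally uniformly; the function itself stays
  below \<open>n\<close>, so the cut-off remains bounded after division by \<open>tau\<close>.\<close>

definition cutoff :: "nat \<Rightarrow> complex \<Rightarrow> real" where
  "cutoff n z = real n / (1 + real n * tau z)"

lemma cutoff_pos: "0 < 1 + real n * tau z"
  using tau_pos[of z] by (simp add: add_pos_nonneg)

lemma cutoff_bcontfun: "cutoff n \<in> bcontfun"
proof (rule bcontfun_normI[of _ "real n"])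
  have "1 + real n * tau z \<noteq> 0" for z using cutoff_pos[of n z] by simp
  then show "continuous_on UNIV (cutoff n)"
    unfolding cutoff_def[abs_def] by (intro continuous_intros tau_continuous) auto
  show "norm (cutoff n z) \<le> real n" for z
    using cutoff_pos[of n z] tau_pos[of z] mult_left_mono[of 1 "1 + real n * tau z" "real n"]
    by (simp add: cutoff_def pos_divide_le_eq)
qed

lemma cutoff_tau: "cutoff n z * tau z = 1 - 1 / (1 + real n * tau z)"
  using cutoff_pos[of n z] by (simp add: cutoff_def field_simps)

lemma cutoff_tau_bounds: "0 \<le> cutoff n z * tau z" "cutoff n z * tau z \<le> 1"
  using cutoff_pos[of n z] tau_pos[of z] unfolding cutoff_tau by auto

lemma cutoff_uniform_limit:
  fixes g :: "complex \<Rightarrow> complex"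
  assumes g: "g \<in> bcontfun" and K: "compact K"
  shows "uniform_limit K (\<lambda>n z. g z * complex_of_real (cutoff n z * tau z)) g sequentially"
proof (cases "K = {}")
  case False
  obtain C where C: "0 < C" "\<And>z. cmod (g z) \<le> C" using bcontfun_bound[OF g] by blast
  obtain z0 where z0: "\<And>z. z \<in> K \<Longrightarrow> tau z0 \<le> tau z"
    using continuous_attains_inf[OF K False tau_continuous] by blast
  show ?thesis
  proof (rule uniform_limitI)
    fix e :: real assume e: "0 < e"
    have "eventually (\<lambda>n. C / (e * tau z0) < real n) sequentially"
      using filterlim_real_sequentially by (rule filterlim_at_top_dense[THEN iffD1, rule_format])
    then show "eventually (\<lambda>n. \<forall>z\<in>K. dist (g z * complex_of_real (cutoff n z * tau z)) (g z) < e) sequentially"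
    proof eventually_elim
      case (elim n)
      have "dist (g z * complex_of_real (cutoff n z * tau z)) (g z) < e" if "z \<in> K" for z
      proof -
        have "g z * complex_of_real (cutoff n z * tau z) - g z = - (g z * complex_of_real (1 / (1 + real n * tau z)))"
          unfolding cutoff_tau by (simp add: algebra_simps)
        then have "dist (g z * complex_of_real (cutoff n z * tau z)) (g z)
          = cmod (g z) * (1 / (1 + real n * tau z))"
          using cutoff_pos[of n z] unfolding dist_norm by (simp only: norm_minus_cancel norm_mult norm_of_real) simp
        also have "\<dots> \<le> C * (1 / (1 + real n * tau z))"
          using C(2)[of z] cutoff_pos[of n z] by (intro mult_right_mono) auto
        finally have 1: "dist (g z * complex_of_real (cutoff n z * tau z)) (g z) \<le> C / (1 + real n * tau z)"
          by simp
        have "C < e * (real n * tau z0)"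
          using elim e tau_pos[of z0] by (simp add: pos_divide_less_eq mult_ac)
        also have "e * (real n * tau z0) \<le> e * (1 + real n * tau z)"
          using e mult_left_mono[OF z0[OF that], of "real n"] by (intro mult_left_mono) auto
        finally have "C < e * (1 + real n * tau z)" .
        then have "C / (1 + real n * tau z) < e" using cutoff_pos[of n z] by (simp add: pos_divide_less_eq)
        with 1 show ?thesis by linarith
      qed
      then show ?case by blast
    qed
  qed
qed (simp add: uniform_limit_iff)

context normal_op
begin

definition Phi :: "(complex \<Rightarrow> complex) \<Rightarrow> 'h \<Rightarrow> 'h" where
  "Phi f v = fc (\<lambda>z. Re (f z)) v + \<i> *\<^sub>C fc (\<lambda>z. Im (f z)) v"

lemma fc_i:
  assumes "f \<in> bcontfun" shows "fc f (\<i> *\<^sub>C v) = \<i> *\<^sub>C fc f v"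
proof -
  let ?J = "Blinfun (\<lambda>v::'h. \<i> *\<^sub>C v)"
  have J: "blinfun_apply ?J v = \<i> *\<^sub>C v" for v
    by (simp add: bounded_linear_Blinfun_apply bounded_linear_scaleC)
  have "commuting ?J (fc f)"
    by (rule ext_commuting_outer[OF ext_fc[OF assms]])
      (simp_all add: commuting_def J apply_simps TS_scaleC S'_i scaleC_scaleR scaleC_add_right scaleC_diff_right)
  then show ?thesis by (simp add: commuting_def J)
qed

lemma Phi_add:
  assumes "f \<in> bcontfun" "g \<in> bcontfun"
  shows "Phi (\<lambda>z. f z + g z) v = Phi f v + Phi g v"
  by (simp add: Phi_def fc_add bcontfun_Re_Im assms blinfun.add_left scaleC_add_right)

lemma Phi_mult:
  assumes "f \<in> bcontfun" "g \<in> bcontfun"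
  shows "Phi (\<lambda>z. f z * g z) v = Phi f (Phi g v)"
  by (simp add: Phi_def fc_add fc_diff fc_mult bcontfun_mult bcontfun_Re_Im assms blinfun.add_left
      blinfun.diff_left blinfun.add_right fc_i scaleC_add_right)

lemma Phi_bounded_clinear:
  assumes "f \<in> bcontfun" shows "bounded_clinear (Phi f)"
proof -
  have "bounded_linear (\<lambda>v. fc (\<lambda>z. Re (f z)) v + \<i> *\<^sub>C fc (\<lambda>z. Im (f z)) v)"
    by (intro bounded_linear_add bounded_linear_scaleC[THEN bounded_linear_compose] blinfun.bounded_linear_right)
  then have "bounded_linear (Phi f)" unfolding Phi_def[abs_def] .
  moreover have "Phi f (c *\<^sub>C v) = c *\<^sub>C Phi f v" for c v
    unfolding scaleC_Re_Im[of c]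
    by (simp add: Phi_def blinfun.add_right blinfun.scaleR_right fc_i bcontfun_Re_Im assms
        scaleC_add_right scaleC_scaleR scaleR_add_right scaleR_diff_right)
  ultimately show ?thesis by (simp add: bounded_clinear_def)
qed

lemma Phi_const: "Phi (\<lambda>z. c) v = c *\<^sub>C v"
proof -
  have "fc (\<lambda>z. r) = r *\<^sub>R id_blinfun" for r by (rule fc_rep[OF rep.const])
  then show ?thesis by (simp add: Phi_def blinfun.scaleR_left scaleC_Re_Im[of c] scaleC_scaleR)
qed

lemma Phi_cnj:
  assumes "f \<in> bcontfun"
  shows "cinner u (Phi (\<lambda>z. cnj (f z)) v) = cinner (Phi f u) v"
proof -
  have sa': "cinner u (fc g v) = cinner (fc g u) v" if "g \<in> bcontfun" for g
    using selfadjD[OF ext_selfadj[OF ext_fc[OF that]]] that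
    by (simp add: cinner_eq_inner fc_i[symmetric])
  show ?thesis
    by (simp add: Phi_def fc_minus bcontfun_Re_Im assms blinfun.minus_left scaleC_minus_right cinner_add_right
        cinner_add_left cinner_diff_right cinner_scaleC_left cinner_scaleC_right sa')
qed

lemma Phi_tau: "Phi (\<lambda>z. complex_of_real (tau z)) v = T v"
proof -
  have "fc tau = Tb" by (rule fc_rep[OF rep.tau])
  moreover have "fc (\<lambda>z. 0) = 0" using fc_rep[OF rep.const[of 0]] by simp
  ultimately show ?thesis by (simp add: Phi_def apply_simps)
qed

lemma Phi_z_tau: "Phi (\<lambda>z. z * complex_of_real (tau z)) v = S v"
proof -
  have "fc (\<lambda>z. Re z * tau z) = Ab" by (rule fc_rep[OF rep.re])
  moreover have "fc (\<lambda>z. Im z * tau z) = Bb" by (rule fc_rep[OF rep.im])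
  ultimately have "Phi (\<lambda>z. z * complex_of_real (tau z)) v = Ab v + \<i> *\<^sub>C Bb v" by (simp add: Phi_def)
  also have "\<dots> = (1/2) *\<^sub>R (S v + S' v) - (1/2) *\<^sub>R (S' v - S v)"
    by (simp add: apply_simps scaleC_scaleR scaleR_diff_right)
  also have "\<dots> = S v" by (simp add: scaleR_add_right scaleR_diff_right flip: scaleR_add_left)
  finally show ?thesis .
qed

lemma z_tau_bcontfun: "(\<lambda>z. z * complex_of_real (tau z)) \<in> bcontfun"
proof -
  have "(\<lambda>z. complex_of_real (Re z * tau z) + \<i> * complex_of_real (Im z * tau z)) \<in> bcontfun"
    by (rule plus_cont[OF bcontfun_of_real[OF rep_bcontfun[OF rep.re]]
          bcontfun_mult[OF const_bcontfun bcontfun_of_real[OF rep_bcontfun[OF rep.im]]]])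
  also have "(\<lambda>z. complex_of_real (Re z * tau z) + \<i> * complex_of_real (Im z * tau z)) =
    (\<lambda>z. z * complex_of_real (tau z))" by (auto simp: complex_eq_iff)
  finally show ?thesis .
qed

lemma Phi_tendsto:
  assumes f: "\<And>n. f n \<in> bcontfun" and g: "g \<in> bcontfun" and C: "\<And>n z. cmod (f n z) \<le> C"
    and K: "\<And>K. compact K \<Longrightarrow> uniform_limit K f g sequentially"
  shows "(\<lambda>n. Phi (f n) v) \<longlonglongrightarrow> Phi g v"
proof -
  have "(\<lambda>n. fc (\<lambda>z. Re (f n z)) v) \<longlonglongrightarrow> fc (\<lambda>z. Re (g z)) v"
    by (rule ext_tendsto[OF ext_fc ext_fc])
      (auto intro: bcontfun_Re_Im f g order_trans[OF abs_Re_le_cmod C] bounded_linear.uniform_limit[OF bounded_linear_Re K])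
  moreover have "(\<lambda>n. fc (\<lambda>z. Im (f n z)) v) \<longlonglongrightarrow> fc (\<lambda>z. Im (g z)) v"
    by (rule ext_tendsto[OF ext_fc ext_fc])
      (auto intro: bcontfun_Re_Im f g order_trans[OF abs_Im_le_cmod C] bounded_linear.uniform_limit[OF bounded_linear_Im K])
  ultimately show ?thesis unfolding Phi_def
    by (intro tendsto_add bounded_linear.tendsto[OF bounded_linear_scaleC])
qed

text \<open>For a function of the form $f = \tau k$ the vector $f(X) v = T k(X) v$ lies in the
  domain of \<open>X\<close> and is mapped to $S k(X) v$, which is $(z f)(X) v$. The cut-off reduces
  the general case to this one, because \<open>X\<close> is closed.\<close>

lemma Phi_in_X:
  assumes f: "f \<in> bcontfun" and zf: "(\<lambda>z. z * f z) \<in> bcontfun"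
  shows "(Phi f v, Phi (\<lambda>z. z * f z) v) \<in> X"
proof -
  define c where "c n z = complex_of_real (cutoff n z * tau z)" for n z
  have cut: "(\<lambda>z. complex_of_real (cutoff n z)) \<in> bcontfun" for n by (rule bcontfun_of_real[OF cutoff_bcontfun])
  have ct: "(\<lambda>z. complex_of_real (tau z)) \<in> bcontfun" by (rule bcontfun_of_real[OF tau_bcontfun])
  have c: "c n \<in> bcontfun" for n
    unfolding c_def using bcontfun_mult[OF cut ct, of n] by simp
  have lim: "(\<lambda>n. Phi (\<lambda>z. g z * c n z) v) \<longlonglongrightarrow> Phi g v" if g: "g \<in> bcontfun" for g
  proof -
    obtain C where C: "0 < C" "\<And>z. cmod (g z) \<le> C" using bcontfun_bound[OF g] by blast
    have "cmod (g z * c n z) \<le> C * 1" for n z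
      unfolding norm_mult using C cutoff_tau_bounds[of n z]
      by (intro mult_mono) (auto simp: c_def norm_of_real simp del: of_real_mult)
    then show ?thesis using cutoff_uniform_limit[OF g] g c
      by (intro Phi_tendsto[of _ _ "C * 1"]) (auto simp: c_def[abs_def] intro: bcontfun_mult)
  qed
  have "(Phi (\<lambda>z. f z * c n z) v, Phi (\<lambda>z. (z * f z) * c n z) v) \<in> X" for n
  proof -
    let ?k = "\<lambda>z. complex_of_real (cutoff n z) * f z"
    have k: "?k \<in> bcontfun" by (rule bcontfun_mult[OF cut f])
    have "(\<lambda>z. f z * c n z) = (\<lambda>z. complex_of_real (tau z) * ?k z)" by (auto simp: c_def mult_ac)
    moreover have "(\<lambda>z. (z * f z) * c n z) = (\<lambda>z. (z * complex_of_real (tau z)) * ?k z)" by (auto simp: c_def mult_ac)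
    ultimately have "Phi (\<lambda>z. f z * c n z) v = T (Phi ?k v)" "Phi (\<lambda>z. (z * f z) * c n z) v = S (Phi ?k v)"
      using Phi_mult[OF ct k] Phi_mult[OF z_tau_bcontfun k] by (simp_all add: Phi_tau Phi_z_tau)
    then show ?thesis using TS(1) by simp
  qed
  moreover have "(\<lambda>n. (Phi (\<lambda>z. f z * c n z) v, Phi (\<lambda>z. (z * f z) * c n z) v)) \<longlonglongrightarrow> (Phi f v, Phi (\<lambda>z. z * f z) v)"
    by (intro tendsto_Pair lim f zf)
  ultimately show ?thesis by (rule closed_sequentially[OF clos])
qed

lemma is_functional_calculus_Phi: "is_functional_calculus X Phi"
  unfolding is_functional_calculus_def
proof (intro conjI ballI allI impI)
  show "bounded_clinear (Phi f)" if "f \<in> bcontfun" for f by (rule Phi_bounded_clinear[OF that])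
  show "Phi (\<lambda>z. 1) = id" by (rule ext) (simp add: Phi_const)
  show "Phi (\<lambda>z. f z + g z) v = Phi f v + Phi g v" if "f \<in> bcontfun" "g \<in> bcontfun" for f g v
    by (rule Phi_add[OF that])
  show "Phi (\<lambda>z. c * f z) v = c *\<^sub>C Phi f v" if "f \<in> bcontfun" for f c v
    using Phi_mult[OF const_bcontfun that] by (simp add: Phi_const)
  show "Phi (\<lambda>z. f z * g z) = Phi f \<circ> Phi g" if "f \<in> bcontfun" "g \<in> bcontfun" for f g
    using Phi_mult[OF that] by (intro HOL.ext) simp
  show "cinner u (Phi (\<lambda>z. cnj (f z)) v) = cinner (Phi f u) v" if "f \<in> bcontfun" for f u v
    by (rule Phi_cnj[OF that])
  show "(Phi f v, Phi (\<lambda>z. z * f z) v) \<in> X" if "f \<in> bcontfun" "(\<lambda>z. z * f z) \<in> bcontfun" for f v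
    by (rule Phi_in_X[OF that])
  fix f :: "nat \<Rightarrow> complex \<Rightarrow> complex" and g v
  assume *: "(\<forall>n. f n \<in> bcontfun) \<and> g \<in> bcontfun \<and> (\<exists>C. \<forall>n z. cmod (f n z) \<le> C) \<and>
        (\<forall>K. compact K \<longrightarrow> uniform_limit K f g sequentially)"
  then obtain C where "\<And>n z. cmod (f n z) \<le> C" by blast
  then show "(\<lambda>n. Phi (f n) v) \<longlonglongrightarrow> Phi g v" using * by (intro Phi_tendsto) auto
qed

end

theorem is_functional_calculus_fcalc:
  assumes "normal_operator X" shows "is_functional_calculus X (fcalc X)"
proof -
  interpret normal_op X by unfold_locales (rule assms)
  show ?thesis unfolding fcalc_def by (rule someI[of "is_functional_calculus X"], rule is_functional_calculus_Phi)
qed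

section \<open>Square-integrable functions\<close>

definition L2norm :: "'a measure \<Rightarrow> ('a \<Rightarrow> complex) \<Rightarrow> real" where
  "L2norm M f = sqrt (\<integral>x. (cmod (f x))\<^sup>2 \<partial>M)"

lemma L2norm_nonneg [simp]: "0 \<le> L2norm M f"
  by (simp add: L2norm_def)

lemma L2norm_sq: "(L2norm M f)\<^sup>2 = (\<integral>x. (cmod (f x))\<^sup>2 \<partial>M)"
  by (simp add: L2norm_def)

lemma L2_measurable [measurable_dest]: "f \<in> L2 M \<Longrightarrow> f \<in> borel_measurable M"
  and L2_integrable: "f \<in> L2 M \<Longrightarrow> integrable M (\<lambda>x. (cmod (f x))\<^sup>2)"
  by (auto simp: L2_def)

lemma L2_bound:
  assumes "f \<in> L2 M" "g \<in> borel_measurable M" "\<And>x. x \<in> space M \<Longrightarrow> cmod (g x) \<le> cmod (f x)"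
  shows "g \<in> L2 M"
proof -
  have "integrable M (\<lambda>x. (cmod (g x))\<^sup>2)"
    by (rule Bochner_Integration.integrable_bound[OF L2_integrable[OF assms(1)]])
      (use assms in \<open>auto intro!: AE_I2 power_mono\<close>)
  with assms(2) show ?thesis by (simp add: L2_def)
qed

lemma sum_sq_le:
  fixes x y t :: real assumes "0 < t"
  shows "(x + y)\<^sup>2 \<le> (1 + t) * x\<^sup>2 + (1 + 1 / t) * y\<^sup>2"
proof -
  have "0 \<le> (t * x - y)\<^sup>2 / t" using assms by simp
  also have "\<dots> = (1 + t) * x\<^sup>2 + (1 + 1 / t) * y\<^sup>2 - (x + y)\<^sup>2"
    using assms by (simp add: field_simps power2_eq_square)
  finally show ?thesis by simp
qed

lemma cmod_add_sq_le:
  assumes "0 < t"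
  shows "(cmod (a + b))\<^sup>2 \<le> (1 + t) * (cmod a)\<^sup>2 + (1 + 1 / t) * (cmod b)\<^sup>2"
  by (rule order_trans[OF power_mono[OF norm_triangle_ineq norm_ge_zero] sum_sq_le[OF assms]])

lemma L2_add:
  assumes "f \<in> L2 M" "g \<in> L2 M" shows "(\<lambda>x. f x + g x) \<in> L2 M"
proof -
  have [measurable]: "f \<in> borel_measurable M" "g \<in> borel_measurable M" using assms by (auto intro: L2_measurable)
  have "integrable M (\<lambda>x. (1 + 1) * (cmod (f x))\<^sup>2 + (1 + 1 / 1) * (cmod (g x))\<^sup>2)"
    by (intro Bochner_Integration.integrable_add integrable_mult_right L2_integrable assms)
  then have "integrable M (\<lambda>x. (cmod (f x + g x))\<^sup>2)"
    by (rule Bochner_Integration.integrable_bound)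
      (use cmod_add_sq_le[of 1] in \<open>auto intro!: AE_I2 order_trans[OF _ abs_ge_self]\<close>)
  then show ?thesis by (simp add: L2_def)
qed

lemma L2_scale:
  assumes "f \<in> L2 M" shows "(\<lambda>x. c * f x) \<in> L2 M"
  using assms by (auto simp: L2_def norm_mult power_mult_distrib)

lemma L2_diff: "f \<in> L2 M \<Longrightarrow> g \<in> L2 M \<Longrightarrow> (\<lambda>x. f x - g x) \<in> L2 M"
  using L2_add[of f M "\<lambda>x. - g x"] L2_scale[of g M "-1"] by simp

lemma L2_zero: "(\<lambda>x. 0) \<in> L2 M"
  by (simp add: L2_def)

lemma (in finite_measure) L2_bounded:
  assumes "f \<in> borel_measurable M" "\<And>x. x \<in> space M \<Longrightarrow> cmod (f x) \<le> C"
  shows "f \<in> L2 M"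
proof -
  have "integrable M (\<lambda>x. (cmod (f x))\<^sup>2)"
    by (rule integrable_const_bound[of _ "C\<^sup>2"]) (use assms in \<open>auto intro!: AE_I2 power_mono\<close>)
  with assms(1) show ?thesis by (simp add: L2_def)
qed

lemma L2norm_scale: "L2norm M (\<lambda>x. c * f x) = cmod c * L2norm M f"
  by (simp add: L2norm_def norm_mult power_mult_distrib real_sqrt_mult)

lemma L2norm_minus_commute: "L2norm M (\<lambda>x. f x - g x) = L2norm M (\<lambda>x. g x - f x)"
  by (simp add: L2norm_def norm_minus_commute)

text \<open>Minkowski: the weight in \<open>cmod_add_sq_le\<close> is chosen as the ratio of the two norms;
  \<open>e\<close> keeps both of them positive.\<close>

lemma L2norm_add_le:
  assumes f: "f \<in> L2 M" and g: "g \<in> L2 M"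
  shows "L2norm M (\<lambda>x. f x + g x) \<le> L2norm M f + L2norm M g"
proof (rule field_le_epsilon)
  fix e :: real assume e: "0 < e"
  define a b where "a = L2norm M f + e / 2" and "b = L2norm M g + e / 2"
  have ab: "0 < a" "0 < b" using e by (auto simp: a_def b_def intro: add_nonneg_pos)
  have t: "0 < b / a" using ab by simp
  have "(L2norm M (\<lambda>x. f x + g x))\<^sup>2 \<le> (\<integral>x. (1 + b / a) * (cmod (f x))\<^sup>2 + (1 + 1 / (b / a)) * (cmod (g x))\<^sup>2 \<partial>M)"
    unfolding L2norm_sq
    by (intro integral_mono cmod_add_sq_le t L2_integrable L2_add f g Bochner_Integration.integrable_add
        integrable_mult_right)
  also have "\<dots> = (1 + b / a) * (L2norm M f)\<^sup>2 + (1 + 1 / (b / a)) * (L2norm M g)\<^sup>2"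
    using L2_integrable[OF f] L2_integrable[OF g] by (simp add: L2norm_sq)
  also have "\<dots> \<le> (1 + b / a) * a\<^sup>2 + (1 + 1 / (b / a)) * b\<^sup>2"
    using ab e by (intro add_mono mult_left_mono power_mono) (auto simp: a_def b_def)
  also have "\<dots> = (a + b)\<^sup>2" using ab by (simp add: field_simps power2_eq_square)
  finally have "L2norm M (\<lambda>x. f x + g x) \<le> a + b" by (rule power2_le_imp_le) (use ab in simp)
  then show "L2norm M (\<lambda>x. f x + g x) \<le> L2norm M f + L2norm M g + e" by (simp add: a_def b_def)
qed

lemma L2norm_diff_triangle:
  assumes "f \<in> L2 M" "g \<in> L2 M" "h \<in> L2 M"
  shows "L2norm M (\<lambda>x. f x - h x) \<le> L2norm M (\<lambda>x. f x - g x) + L2norm M (\<lambda>x. g x - h x)"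
  using L2norm_add_le[OF L2_diff[OF assms(1,2)] L2_diff[OF assms(2,3)]] by simp

lemma L2norm_reverse_triangle:
  assumes "f \<in> L2 M" "g \<in> L2 M"
  shows "\<bar>L2norm M f - L2norm M g\<bar> \<le> L2norm M (\<lambda>x. f x - g x)"
  using L2norm_add_le[OF L2_diff[OF assms] assms(2)] L2norm_add_le[OF L2_diff[OF assms(2,1)] assms(1)]
    L2norm_minus_commute[of M f g] by simp

lemma L2norm_AE_zero:
  assumes "f \<in> L2 M" "L2norm M f = 0" shows "AE x in M. f x = 0"
  using integral_nonneg_eq_0_iff_AE[OF L2_integrable[OF assms(1)]] assms(2) by (simp add: L2norm_def)

lemma L2_dominated_convergence:
  assumes f: "\<And>n. f n \<in> borel_measurable M" "g \<in> borel_measurable M"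
    and w: "integrable M (\<lambda>x. (w x)\<^sup>2)"
    and lim: "\<And>x. x \<in> space M \<Longrightarrow> (\<lambda>n. f n x) \<longlonglongrightarrow> g x"
    and bound: "\<And>n x. x \<in> space M \<Longrightarrow> cmod (f n x - g x) \<le> w x"
  shows "(\<lambda>n. L2norm M (\<lambda>x. f n x - g x)) \<longlonglongrightarrow> 0"
proof -
  have "(\<lambda>n. \<integral>x. (cmod (f n x - g x))\<^sup>2 \<partial>M) \<longlonglongrightarrow> (\<integral>x. 0 \<partial>M)"
  proof (rule integral_dominated_convergence[where w = "\<lambda>x. (w x)\<^sup>2"])
    show "AE x in M. (\<lambda>n. (cmod (f n x - g x))\<^sup>2) \<longlonglongrightarrow> 0"
    proof (rule AE_I2)
      fix x assume "x \<in> space M"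
      then have "(\<lambda>n. (cmod (f n x - g x))\<^sup>2) \<longlonglongrightarrow> (cmod (g x - g x))\<^sup>2" by (intro tendsto_intros lim)
      then show "(\<lambda>n. (cmod (f n x - g x))\<^sup>2) \<longlonglongrightarrow> 0" by simp
    qed
    show "AE x in M. norm ((cmod (f n x - g x))\<^sup>2) \<le> (w x)\<^sup>2" for n
      using bound[of _ n] by (intro AE_I2) (auto intro!: power_mono)
  qed (use f w in auto)
  then have "(\<lambda>n. sqrt (\<integral>x. (cmod (f n x - g x))\<^sup>2 \<partial>M)) \<longlonglongrightarrow> sqrt 0" by (intro tendsto_real_sqrt) simp
  then show ?thesis by (simp add: L2norm_def)
qed

text \<open>Riesz--Fischer. On a probability space an $L^2$ Cauchy sequence is also $L^1$ Cauchy, so a subsequence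
  converges almost everywhere; Fatou's lemma shows that the whole sequence converges to this limit in $L^2$.\<close>

lemma (in prob_space) L2_complete:
  assumes f: "\<And>n. f n \<in> L2 M"
    and Cauchy: "\<And>e. 0 < e \<Longrightarrow> \<exists>N. \<forall>m\<ge>N. \<forall>n\<ge>N. L2norm M (\<lambda>x. f m x - f n x) < e"
  obtains g where "g \<in> L2 M" "(\<lambda>n. L2norm M (\<lambda>x. f n x - g x)) \<longlonglongrightarrow> 0"
proof -
  have [measurable]: "f n \<in> borel_measurable M" for n by (rule L2_measurable[OF f])
  have L1_le: "integrable M h \<and> (\<integral>x. cmod (h x) \<partial>M) \<le> e + (L2norm M h)\<^sup>2 / e" if h: "h \<in> L2 M" and e: "0 < e" for h e
  proof -
    have [measurable]: "h \<in> borel_measurable M" by (rule L2_measurable[OF h])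
    have le: "cmod (h x) \<le> e + (cmod (h x))\<^sup>2 / e" for x
    proof -
      have "0 \<le> (cmod (h x) - e)\<^sup>2" by simp
      then have "2 * (e * cmod (h x)) \<le> e * e + (cmod (h x))\<^sup>2" by (simp add: power2_eq_square algebra_simps)
      then have "e * cmod (h x) \<le> e * e + (cmod (h x))\<^sup>2"
        using mult_nonneg_nonneg[of e "cmod (h x)"] e by (smt (verit) norm_ge_zero)
      then show ?thesis using e by (simp add: field_simps power2_eq_square)
    qed
    have int: "integrable M (\<lambda>x. e + (cmod (h x))\<^sup>2 / e)"
      by (intro Bochner_Integration.integrable_add integrable_const integrable_divide L2_integrable h)
    then have int_h: "integrable M h"
      by (rule Bochner_Integration.integrable_bound) (use le in \<open>auto intro!: AE_I2 order_trans[OF _ abs_ge_self]\<close>)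
    then have "(\<integral>x. cmod (h x) \<partial>M) \<le> (\<integral>x. e + (cmod (h x))\<^sup>2 / e \<partial>M)"
      by (intro integral_mono int integrable_norm le)
    also have "\<dots> = e + (L2norm M h)\<^sup>2 / e"
      using L2_integrable[OF h] by (simp add: L2norm_sq prob_space)
    finally show ?thesis using int_h by simp
  qed
  have L1_Cauchy: "\<exists>N. \<forall>i\<ge>N. \<forall>j\<ge>N. (LINT x|M. norm (f i x - f j x)) < e" if e: "0 < e" for e
  proof -
    obtain N where N: "\<And>m n. m \<ge> N \<Longrightarrow> n \<ge> N \<Longrightarrow> L2norm M (\<lambda>x. f m x - f n x) < e / 2"
      using Cauchy[of "e / 2"] e by auto
    have "(LINT x|M. norm (f i x - f j x)) < e" if "i \<ge> N" "j \<ge> N" for i j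
    proof -
      have "(LINT x|M. norm (f i x - f j x)) \<le> e / 2 + (L2norm M (\<lambda>x. f i x - f j x))\<^sup>2 / (e / 2)"
        using L1_le[OF L2_diff[OF f f], of "e/2"] e by simp
      also have "(L2norm M (\<lambda>x. f i x - f j x))\<^sup>2 < (e / 2)\<^sup>2"
        using N[OF that] by (intro power_strict_mono) auto
      finally show ?thesis using e by (simp add: power2_eq_square divide_strict_right_mono)
    qed
    then show ?thesis by blast
  qed
  have int_f: "integrable M (f n)" for n using L1_le[OF f[of n], of 1] by simp
  obtain r where r: "strict_mono r" "AE x in M. Cauchy (\<lambda>i. f (r i) x)"
    using cauchy_L1_AE_cauchy_subseq[OF int_f L1_Cauchy] by blast
  define g where "g x = lim (\<lambda>i. f (r i) x)" for x
  have [measurable]: "g \<in> borel_measurable M" unfolding g_def[abs_def] by measurable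
  have conv: "AE x in M. (\<lambda>i. f (r i) x) \<longlonglongrightarrow> g x"
    using r(2) by eventually_elim (simp add: g_def Cauchy_convergent_iff convergent_LIMSEQ_iff)
  have fatou: "f m \<in> L2 M \<and> (\<lambda>x. f m x - g x) \<in> L2 M \<and> L2norm M (\<lambda>x. f m x - g x) \<le> e"
    if e: "0 < e" and N: "\<And>n. n \<ge> N \<Longrightarrow> L2norm M (\<lambda>x. f m x - f n x) < e" for e m N
  proof -
    have "(\<integral>\<^sup>+x. ennreal ((cmod (f m x - g x))\<^sup>2) \<partial>M)
      = (\<integral>\<^sup>+x. liminf (\<lambda>i. ennreal ((cmod (f m x - f (r i) x))\<^sup>2)) \<partial>M)"
    proof (rule nn_integral_cong_AE)
      show "AE x in M. ennreal ((cmod (f m x - g x))\<^sup>2) = liminf (\<lambda>i. ennreal ((cmod (f m x - f (r i) x))\<^sup>2))"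
        using conv
      proof eventually_elim
        case (elim x)
        have "(\<lambda>i. ennreal ((cmod (f m x - f (r i) x))\<^sup>2)) \<longlonglongrightarrow> ennreal ((cmod (f m x - g x))\<^sup>2)"
          by (intro tendsto_ennrealI tendsto_intros elim)
        then show ?case by (intro lim_imp_Liminf[symmetric]) auto
      qed
    qed
    also have "\<dots> \<le> liminf (\<lambda>i. \<integral>\<^sup>+x. ennreal ((cmod (f m x - f (r i) x))\<^sup>2) \<partial>M)"
      by (rule nn_integral_liminf) measurable
    also have "\<dots> \<le> ennreal (e\<^sup>2)"
    proof (rule Liminf_le)
      show "eventually (\<lambda>i. (\<integral>\<^sup>+x. ennreal ((cmod (f m x - f (r i) x))\<^sup>2) \<partial>M) \<le> ennreal (e\<^sup>2)) sequentially"
      proof (rule eventually_sequentiallyI[of N])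
        fix i assume "N \<le> i"
        then have "N \<le> r i" using seq_suble[OF r(1), of i] by simp
        have "(\<integral>\<^sup>+x. ennreal ((cmod (f m x - f (r i) x))\<^sup>2) \<partial>M) = ennreal ((L2norm M (\<lambda>x. f m x - f (r i) x))\<^sup>2)"
          unfolding L2norm_sq using L2_integrable[OF L2_diff[OF f f]] by (intro nn_integral_eq_integral) auto
        also have "\<dots> \<le> ennreal (e\<^sup>2)"
          using N[OF \<open>N \<le> r i\<close>] by (intro ennreal_leI power_mono) auto
        finally show "(\<integral>\<^sup>+x. ennreal ((cmod (f m x - f (r i) x))\<^sup>2) \<partial>M) \<le> ennreal (e\<^sup>2)" .
      qed
    qed auto
    finally have le: "(\<integral>\<^sup>+x. ennreal ((cmod (f m x - g x))\<^sup>2) \<partial>M) \<le> ennreal (e\<^sup>2)" .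
    then have int: "integrable M (\<lambda>x. (cmod (f m x - g x))\<^sup>2)"
      by (intro integrableI_bounded) (auto simp: less_top[symmetric] top_unique intro: le_less_trans)
    then have "ennreal (\<integral>x. (cmod (f m x - g x))\<^sup>2 \<partial>M) \<le> ennreal (e\<^sup>2)"
      using le by (subst nn_integral_eq_integral[symmetric]) auto
    then have "(L2norm M (\<lambda>x. f m x - g x))\<^sup>2 \<le> e\<^sup>2" by (simp add: L2norm_sq)
    then have "L2norm M (\<lambda>x. f m x - g x) \<le> e" by (rule power2_le_imp_le) (use e in simp)
    then show ?thesis using int f by (simp add: L2_def)
  qed
  have ev: "\<exists>N. \<forall>m\<ge>N. (\<lambda>x. f m x - g x) \<in> L2 M \<and> L2norm M (\<lambda>x. f m x - g x) \<le> e" if e: "0 < e" for e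
  proof -
    obtain N where N: "\<forall>m\<ge>N. \<forall>n\<ge>N. L2norm M (\<lambda>x. f m x - f n x) < e" using Cauchy[OF e] by blast
    have "(\<lambda>x. f m x - g x) \<in> L2 M \<and> L2norm M (\<lambda>x. f m x - g x) \<le> e" if "m \<ge> N" for m
      using fatou[OF e, of N m] N that by simp
    then show ?thesis by blast
  qed
  obtain N where "(\<lambda>x. f N x - g x) \<in> L2 M" using ev[of 1] by auto
  from L2_diff[OF f[of N] this] have "g \<in> L2 M" by simp
  moreover have "(\<lambda>n. L2norm M (\<lambda>x. f n x - g x)) \<longlonglongrightarrow> 0"
  proof (rule LIMSEQ_I)
    fix e :: real assume "0 < e"
    then obtain N where N: "\<And>m. m \<ge> N \<Longrightarrow> L2norm M (\<lambda>x. f m x - g x) \<le> e / 2" using ev[of "e/2"] by auto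
    show "\<exists>no. \<forall>n\<ge>no. norm (L2norm M (\<lambda>x. f n x - g x) - 0) < e"
    proof (intro exI[of _ N] allI impI)
      fix n assume "N \<le> n"
      then show "norm (L2norm M (\<lambda>x. f n x - g x) - 0) < e" using N[of n] \<open>0 < e\<close> by simp
    qed
  qed
  ultimately show ?thesis by (rule that)
qed

section \<open>Extending an isometry from a dense set of functions\<close>

lemma LIMSEQ_to_zeroI:
  fixes a :: "nat \<Rightarrow> real"
  assumes "\<And>n. 0 \<le> a n" "\<And>n. a n \<le> b n" "b \<longlonglongrightarrow> 0" shows "a \<longlonglongrightarrow> 0"
  by (rule Lim_null_comparison[OF _ assms(3)]) (use assms in \<open>auto intro!: always_eventually\<close>)

text \<open>The partial isometry is given by its graph \<open>G\<close>. It is single-valued because it preserves norms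
  (\<open>G_diff_norm\<close>), and for the same reason it maps convergent sequences to Cauchy sequences.\<close>

locale dense_isometry = prob_space M for M :: "'a measure" +
  fixes G :: "(('a \<Rightarrow> complex) \<times> 'h::complex_hilbert) set"
  assumes G_L2: "(\<psi>, u) \<in> G \<Longrightarrow> \<psi> \<in> L2 M"
    and G_add: "(\<psi>, u) \<in> G \<Longrightarrow> (\<phi>, v) \<in> G \<Longrightarrow> (\<lambda>x. \<psi> x + \<phi> x, u + v) \<in> G"
    and G_scale: "(\<psi>, u) \<in> G \<Longrightarrow> (\<lambda>x. c * \<psi> x, c *\<^sub>C u) \<in> G"
    and G_norm: "(\<psi>, u) \<in> G \<Longrightarrow> norm u = L2norm M \<psi>"
    and G_dense: "\<psi> \<in> L2 M \<Longrightarrow> 0 < e \<Longrightarrow> \<exists>(\<phi>, u)\<in>G. L2norm M (\<lambda>x. \<phi> x - \<psi> x) < e"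
begin

lemma G_diff_norm:
  assumes "(\<psi>, u) \<in> G" "(\<phi>, v) \<in> G" shows "norm (u - v) = L2norm M (\<lambda>x. \<psi> x - \<phi> x)"
  using G_norm[OF G_add[OF assms(1) G_scale[OF assms(2), of "-1"]]] by (simp add: scaleC_minus_left)

definition lim_graph :: "('a \<Rightarrow> complex) \<Rightarrow> 'h \<Rightarrow> bool" where
  "lim_graph \<psi> u \<longleftrightarrow> (\<exists>\<phi> v. (\<forall>n. (\<phi> n, v n) \<in> G) \<and> (\<lambda>n. L2norm M (\<lambda>x. \<phi> n x - \<psi> x)) \<longlonglongrightarrow> 0 \<and> v \<longlonglongrightarrow> u)"

lemma lim_graphI:
  assumes "\<And>n. (\<phi> n, v n) \<in> G" "(\<lambda>n. L2norm M (\<lambda>x. \<phi> n x - \<psi> x)) \<longlonglongrightarrow> 0" "v \<longlonglongrightarrow> u"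
  shows "lim_graph \<psi> u"
  using assms unfolding lim_graph_def by blast

lemma lim_graph_exists:
  assumes \<psi>: "\<psi> \<in> L2 M" obtains u where "lim_graph \<psi> u"
proof -
  have "\<exists>p. p \<in> G \<and> L2norm M (\<lambda>x. fst p x - \<psi> x) < inverse (real (Suc n))" for n
    using G_dense[OF \<psi>, of "inverse (real (Suc n))"] by force
  then obtain p where p: "\<And>n. p n \<in> G" "\<And>n. L2norm M (\<lambda>x. fst (p n) x - \<psi> x) < inverse (real (Suc n))"
    by metis
  define \<phi> v where "\<phi> n = fst (p n)" and "v n = snd (p n)" for n
  have G: "(\<phi> n, v n) \<in> G" for n using p(1) by (simp add: \<phi>_def v_def)
  have lim: "(\<lambda>n. L2norm M (\<lambda>x. \<phi> n x - \<psi> x)) \<longlonglongrightarrow> 0"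
    by (rule LIMSEQ_to_zeroI[OF _ _ LIMSEQ_inverse_real_of_nat]) (simp_all only: \<phi>_def L2norm_nonneg less_imp_le[OF p(2)])
  have "Cauchy v"
  proof (rule metric_CauchyI)
    fix e :: real assume e: "0 < e"
    then obtain N where N: "\<And>n. n \<ge> N \<Longrightarrow> L2norm M (\<lambda>x. \<phi> n x - \<psi> x) < e / 2"
      using LIMSEQ_D[OF lim, of "e/2"] by auto
    show "\<exists>N. \<forall>m\<ge>N. \<forall>n\<ge>N. dist (v m) (v n) < e"
    proof (intro exI[of _ N] allI impI)
      fix m n assume mn: "N \<le> m" "N \<le> n"
      have "dist (v m) (v n) = L2norm M (\<lambda>x. \<phi> m x - \<phi> n x)" by (simp add: dist_norm G_diff_norm[OF G G])
      also have "\<dots> \<le> L2norm M (\<lambda>x. \<phi> m x - \<psi> x) + L2norm M (\<lambda>x. \<psi> x - \<phi> n x)"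
        by (rule L2norm_diff_triangle[OF G_L2[OF G] \<psi> G_L2[OF G]])
      finally show "dist (v m) (v n) < e"
        using N[OF mn(1)] N[OF mn(2)] L2norm_minus_commute[of M \<psi> "\<phi> n"] by linarith
    qed
  qed
  then obtain u where "v \<longlonglongrightarrow> u" using Cauchy_convergent convergent_def by blast
  then show ?thesis using that lim_graphI[OF G lim] by blast
qed

lemma lim_graph_add:
  assumes "\<psi>1 \<in> L2 M" "\<psi>2 \<in> L2 M" "lim_graph \<psi>1 u1" "lim_graph \<psi>2 u2"
  shows "lim_graph (\<lambda>x. \<psi>1 x + \<psi>2 x) (u1 + u2)"
proof -
  obtain \<phi>1 v1 where 1: "\<And>n. (\<phi>1 n, v1 n) \<in> G" "(\<lambda>n. L2norm M (\<lambda>x. \<phi>1 n x - \<psi>1 x)) \<longlonglongrightarrow> 0" "v1 \<longlonglongrightarrow> u1"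
    using assms(3) by (auto simp: lim_graph_def)
  obtain \<phi>2 v2 where 2: "\<And>n. (\<phi>2 n, v2 n) \<in> G" "(\<lambda>n. L2norm M (\<lambda>x. \<phi>2 n x - \<psi>2 x)) \<longlonglongrightarrow> 0" "v2 \<longlonglongrightarrow> u2"
    using assms(4) by (auto simp: lim_graph_def)
  show ?thesis
  proof (rule lim_graphI[OF G_add[OF 1(1) 2(1)] _ tendsto_add[OF 1(3) 2(3)]])
    have le: "L2norm M (\<lambda>x. (\<phi>1 n x + \<phi>2 n x) - (\<psi>1 x + \<psi>2 x))
      \<le> L2norm M (\<lambda>x. \<phi>1 n x - \<psi>1 x) + L2norm M (\<lambda>x. \<phi>2 n x - \<psi>2 x)" for n
      using L2norm_add_le[OF L2_diff[OF G_L2[OF 1(1)] assms(1)] L2_diff[OF G_L2[OF 2(1)] assms(2)], of n n]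
      by (simp add: algebra_simps)
    show "(\<lambda>n. L2norm M (\<lambda>x. (\<phi>1 n x + \<phi>2 n x) - (\<psi>1 x + \<psi>2 x))) \<longlonglongrightarrow> 0"
      by (rule LIMSEQ_to_zeroI[OF L2norm_nonneg le]) (use tendsto_add[OF 1(2) 2(2)] in simp)
  qed
qed

lemma lim_graph_scale:
  assumes "lim_graph \<psi> u" shows "lim_graph (\<lambda>x. c * \<psi> x) (c *\<^sub>C u)"
proof -
  obtain \<phi> v where 1: "\<And>n. (\<phi> n, v n) \<in> G" "(\<lambda>n. L2norm M (\<lambda>x. \<phi> n x - \<psi> x)) \<longlonglongrightarrow> 0" "v \<longlonglongrightarrow> u"
    using assms by (auto simp: lim_graph_def)
  show ?thesis
  proof (rule lim_graphI[OF G_scale[OF 1(1)] _ bounded_linear.tendsto[OF bounded_linear_scaleC 1(3)]])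
    have "L2norm M (\<lambda>x. c * \<phi> n x - c * \<psi> x) = cmod c * L2norm M (\<lambda>x. \<phi> n x - \<psi> x)" for n
      unfolding right_diff_distrib[symmetric] by (rule L2norm_scale)
    then show "(\<lambda>n. L2norm M (\<lambda>x. c * \<phi> n x - c * \<psi> x)) \<longlonglongrightarrow> 0"
      using tendsto_mult_left[OF 1(2), of "cmod c"] by simp
  qed
qed

lemma lim_graph_norm:
  assumes "\<psi> \<in> L2 M" "lim_graph \<psi> u" shows "norm u = L2norm M \<psi>"
proof -
  obtain \<phi> v where 1: "\<And>n. (\<phi> n, v n) \<in> G" "(\<lambda>n. L2norm M (\<lambda>x. \<phi> n x - \<psi> x)) \<longlonglongrightarrow> 0" "v \<longlonglongrightarrow> u"
    using assms by (auto simp: lim_graph_def)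
  have "(\<lambda>n. \<bar>L2norm M (\<phi> n) - L2norm M \<psi>\<bar>) \<longlonglongrightarrow> 0"
    by (rule LIMSEQ_to_zeroI[OF _ _ 1(2)]) (use L2norm_reverse_triangle[OF G_L2[OF 1(1)] assms(1)] in auto)
  then have "(\<lambda>n. L2norm M (\<phi> n)) \<longlonglongrightarrow> L2norm M \<psi>"
    by (simp add: tendsto_rabs_zero_iff LIM_zero_iff)
  moreover have "(\<lambda>n. L2norm M (\<phi> n)) \<longlonglongrightarrow> norm u"
    using tendsto_norm[OF 1(3)] by (simp add: G_norm[OF 1(1)])
  ultimately show ?thesis using LIMSEQ_unique by blast
qed

lemma lim_graph_unique:
  assumes "\<psi> \<in> L2 M" "lim_graph \<psi> u" "lim_graph \<psi> u'" shows "u = u'"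
proof -
  have "lim_graph (\<lambda>x. \<psi> x + (-1) * \<psi> x) (u + (-1) *\<^sub>C u')"
    by (rule lim_graph_add[OF assms(1) L2_scale[OF assms(1)] assms(2) lim_graph_scale[OF assms(3)]])
  then have "lim_graph (\<lambda>x. 0) (u - u')" by (simp add: scaleC_minus_left)
  from lim_graph_norm[OF L2_zero this] show ?thesis by (simp add: L2norm_def)
qed

definition W :: "('a \<Rightarrow> complex) \<Rightarrow> 'h" where
  "W \<psi> = (THE u. lim_graph \<psi> u)"

lemma W_eqI: "\<psi> \<in> L2 M \<Longrightarrow> lim_graph \<psi> u \<Longrightarrow> W \<psi> = u"
  unfolding W_def by (blast intro: lim_graph_unique)

lemma lim_graph_W: "\<psi> \<in> L2 M \<Longrightarrow> lim_graph \<psi> (W \<psi>)"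
  by (metis W_eqI lim_graph_exists)

lemma W_G:
  assumes "(\<psi>, u) \<in> G" shows "W \<psi> = u"
  by (rule W_eqI[OF G_L2[OF assms] lim_graphI[of "\<lambda>_. \<psi>" "\<lambda>_. u"]]) (use assms in \<open>auto simp: L2norm_def\<close>)

lemma W_isometry: "L2_isometry M W"
  unfolding L2_isometry_def
proof (intro conjI ballI allI)
  show "W (\<lambda>x. \<phi> x + \<psi> x) = W \<phi> + W \<psi>" if "\<phi> \<in> L2 M" "\<psi> \<in> L2 M" for \<phi> \<psi>
    using that by (intro W_eqI lim_graph_add lim_graph_W L2_add)
  show "W (\<lambda>x. c * \<psi> x) = c *\<^sub>C W \<psi>" if "\<psi> \<in> L2 M" for c \<psi>
    using that by (intro W_eqI lim_graph_scale lim_graph_W L2_scale)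
  show "(norm (W \<psi>))\<^sup>2 = (\<integral>x. (cmod (\<psi> x))\<^sup>2 \<partial>M)" if "\<psi> \<in> L2 M" for \<psi>
    using lim_graph_norm[OF that lim_graph_W[OF that]] by (simp add: L2norm_sq)
qed

lemma W_range: "W ` L2 M = closure (snd ` G)"
proof (intro equalityI subsetI)
  fix u assume "u \<in> W ` L2 M"
  then obtain \<psi> where "lim_graph \<psi> u" using lim_graph_W by auto
  then obtain \<phi> v where "\<And>n. (\<phi> n, v n) \<in> G" "v \<longlonglongrightarrow> u" by (auto simp: lim_graph_def)
  then show "u \<in> closure (snd ` G)" unfolding closure_sequential by (metis imageI snd_conv)
next
  fix u assume "u \<in> closure (snd ` G)"
  then obtain v where v: "\<And>n. v n \<in> snd ` G" "v \<longlonglongrightarrow> u" unfolding closure_sequential by blast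
  then have "\<forall>n. \<exists>\<phi>. (\<phi>, v n) \<in> G" by force
  then obtain \<phi> where G: "\<And>n. (\<phi> n, v n) \<in> G" by metis
  have Cau: "\<exists>N. \<forall>m\<ge>N. \<forall>n\<ge>N. L2norm M (\<lambda>x. \<phi> m x - \<phi> n x) < e" if "0 < e" for e
    using metric_CauchyD[OF LIMSEQ_imp_Cauchy[OF v(2)] that] by (simp add: dist_norm G_diff_norm[OF G G])
  obtain \<psi> where \<psi>: "\<psi> \<in> L2 M" "(\<lambda>n. L2norm M (\<lambda>x. \<phi> n x - \<psi> x)) \<longlonglongrightarrow> 0"
    by (rule L2_complete[OF G_L2[OF G] Cau])
  have "W \<psi> = u" by (rule W_eqI[OF \<psi>(1) lim_graphI[OF G \<psi>(2) v(2)]])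
  with \<psi>(1) show "u \<in> W ` L2 M" by blast
qed

end

section \<open>Density of tensor products\<close>

lemma closed_indicator_limit:
  fixes A :: "'a::metric_space set"
  assumes "closed A" "A \<noteq> {}"
  obtains f :: "nat \<Rightarrow> 'a \<Rightarrow> complex"
  where "\<And>n. f n \<in> bcontfun" "\<And>n x. cmod (f n x) \<le> 1" "\<And>x. (\<lambda>n. f n x) \<longlonglongrightarrow> indicator A x"
proof
  define f where "f n x = complex_of_real (max 0 (1 - real n * infdist x A))" for n x
  show b: "cmod (f n x) \<le> 1" for n x using infdist_nonneg[of x A] by (simp add: f_def)
  show "f n \<in> bcontfun" for n
    unfolding f_def[abs_def] using b[of n, unfolded f_def]
    by (intro bcontfun_normI[of _ 1]) (auto intro!: continuous_intros)
  show "(\<lambda>n. f n x) \<longlonglongrightarrow> indicator A x" for x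
  proof (cases "x \<in> A")
    case True then show ?thesis by (simp add: f_def)
  next
    case False
    then have d: "0 < infdist x A" using infdist_pos_not_in_closed assms by blast
    have "eventually (\<lambda>n. 1 / infdist x A < real n) sequentially"
      using filterlim_real_sequentially by (rule filterlim_at_top_dense[THEN iffD1, rule_format])
    then have "eventually (\<lambda>n. f n x = 0) sequentially"
      by eventually_elim (use d in \<open>simp add: f_def field_simps\<close>)
    then show ?thesis using False by (simp add: tendsto_eventually)
  qed
qed

lemma bcontfun_borel:
  fixes f :: "'a::topological_space \<Rightarrow> complex"
  shows "f \<in> bcontfun \<Longrightarrow> f \<in> borel_measurable borel"
  by (rule borel_measurable_continuous_onI) (rule bcontfun_continuous)

text \<open>Scalar multiples of tensors are tensors, so \<open>D\<close> contains the linear span of the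
  tensors.\<close>

locale tensor_dense = prob_space M for M :: "(complex \<times> complex) measure" +
  fixes D :: "(complex \<times> complex \<Rightarrow> complex) set"
  assumes sets_M: "sets M = sets (borel \<Otimes>\<^sub>M borel)"
    and D_tensor: "a \<in> bcontfun \<Longrightarrow> b \<in> bcontfun \<Longrightarrow> (\<lambda>(x, y). a x * b y) \<in> D"
    and D_add: "f \<in> D \<Longrightarrow> g \<in> D \<Longrightarrow> (\<lambda>p. f p + g p) \<in> D"
    and D_L2: "D \<subseteq> L2 M"
begin

definition approx :: "(complex \<times> complex \<Rightarrow> complex) \<Rightarrow> bool" where
  "approx f \<longleftrightarrow> f \<in> L2 M \<and> (\<forall>e>0. \<exists>g\<in>D. L2norm M (\<lambda>p. g p - f p) < e)"

lemma approx_L2: "approx f \<Longrightarrow> f \<in> L2 M"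
  by (simp add: approx_def)

lemma approx_D: "f \<in> D \<Longrightarrow> approx f"
  using D_L2 by (auto simp: approx_def L2norm_def intro!: bexI[of _ f])

lemma approx_tensor: "f \<in> bcontfun \<Longrightarrow> g \<in> bcontfun \<Longrightarrow> approx (\<lambda>(x, y). f x * g y)"
  by (intro approx_D D_tensor)

lemma approx_add:
  assumes "approx f" "approx g" shows "approx (\<lambda>p. f p + g p)"
  unfolding approx_def
proof (intro conjI allI impI)
  show "(\<lambda>p. f p + g p) \<in> L2 M" by (intro L2_add approx_L2 assms)
  fix e :: real assume "0 < e"
  then obtain f' g' where *: "f' \<in> D" "L2norm M (\<lambda>p. f' p - f p) < e / 2" "g' \<in> D" "L2norm M (\<lambda>p. g' p - g p) < e / 2"
    using assms unfolding approx_def by (meson half_gt_zero)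
  have "L2norm M (\<lambda>p. (f' p - f p) + (g' p - g p)) \<le> L2norm M (\<lambda>p. f' p - f p) + L2norm M (\<lambda>p. g' p - g p)"
    by (intro L2norm_add_le L2_diff subsetD[OF D_L2] approx_L2 assms *)
  moreover have "(\<lambda>p. (f' p - f p) + (g' p - g p)) = (\<lambda>p. (f' p + g' p) - (f p + g p))" by auto
  ultimately have "L2norm M (\<lambda>p. (f' p + g' p) - (f p + g p)) < e" using *(2,4) by simp
  then show "\<exists>h\<in>D. L2norm M (\<lambda>p. h p - (f p + g p)) < e"
    by (rule bexI[of _ "\<lambda>p. f' p + g' p"]) (rule D_add[OF *(1,3)])
qed

lemma approx_limit:
  assumes "\<And>n. approx (f n)" "g \<in> L2 M" "(\<lambda>n. L2norm M (\<lambda>p. f n p - g p)) \<longlonglongrightarrow> 0"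
  shows "approx g"
  unfolding approx_def
proof (intro conjI allI impI)
  fix e :: real assume e: "0 < e"
  obtain n where n: "L2norm M (\<lambda>p. f n p - g p) < e / 2"
    using LIMSEQ_D[OF assms(3), of "e / 2"] e by auto
  obtain h where h: "h \<in> D" "L2norm M (\<lambda>p. h p - f n p) < e / 2"
    using assms(1)[of n] e unfolding approx_def by (meson half_gt_zero)
  have "L2norm M (\<lambda>p. h p - g p) \<le> L2norm M (\<lambda>p. h p - f n p) + L2norm M (\<lambda>p. f n p - g p)"
    by (intro L2norm_diff_triangle subsetD[OF D_L2] h(1) approx_L2 assms)
  then show "\<exists>h\<in>D. L2norm M (\<lambda>p. h p - g p) < e" using n h by (intro bexI[of _ h]) auto
qed (rule assms(2))

lemma approx_limit_dominated:
  assumes "\<And>n. approx (f n)" "g \<in> borel_measurable M" "\<And>p. (\<lambda>n. f n p) \<longlonglongrightarrow> g p"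
    "\<And>n p. cmod (f n p) \<le> C" "\<And>p. cmod (g p) \<le> C"
  shows "approx g"
proof (rule approx_limit[OF assms(1)])
  show "g \<in> L2 M" by (rule L2_bounded) (use assms in auto)
  show "(\<lambda>n. L2norm M (\<lambda>p. f n p - g p)) \<longlonglongrightarrow> 0"
  proof (rule L2_dominated_convergence[where w = "\<lambda>_. 2 * C"])
    show "cmod (f n p - g p) \<le> 2 * C" for n p
      using norm_triangle_ineq4[of "f n p" "g p"] assms(4)[of n p] assms(5)[of p] by simp
  qed (use assms approx_L2 L2_measurable in auto)
qed

lemma approx_zero: "approx (\<lambda>p. 0)"
  using approx_tensor[OF const_bcontfun[of 0] const_bcontfun[of 0]] by (simp add: case_prod_unfold)

lemma sets_M_closed: "sets M = sigma_sets UNIV {A \<times> B |A B. closed A \<and> closed B}"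
proof -
  have borel: "sets borel = sigma_sets UNIV {A :: complex set. closed A}"
    by (simp add: borel_eq_closed)
  have "sets (borel \<Otimes>\<^sub>M borel :: (complex \<times> complex) measure) =
    sets (sigma (space borel \<times> space borel) {a \<times> b |a b. a \<in> {A :: complex set. closed A} \<and> b \<in> {A :: complex set. closed A}})"
    by (rule sets_pair_eq[where Ca = "{UNIV}" and Cb = "{UNIV}"]) (simp_all add: borel)
  then show ?thesis by (simp add: sets_M)
qed

text \<open>Products of closed sets generate the product sigma algebra and are closed under
  intersections, so it suffices to treat these and to check complements and disjoint
  unions.\<close>

lemma approx_indicator:
  assumes "A \<in> sets M" shows "approx (\<lambda>p. c * indicator A p)"
proof -
  have "Int_stable {A \<times> B |A B. closed (A::complex set) \<and> closed (B::complex set)}"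
    by (auto simp: Int_stable_def Times_Int_Times) (metis closed_Int)
  moreover have "{A \<times> B |A B. closed (A::complex set) \<and> closed (B::complex set)} \<subseteq> Pow UNIV" by auto
  moreover have "A \<in> sigma_sets UNIV {A \<times> B |A B. closed A \<and> closed B}" using assms by (simp add: sets_M_closed)
  ultimately have "\<forall>c. approx (\<lambda>p. c * indicator A p)"
  proof (induction rule: sigma_sets_induct_disjoint)
    case (basic Z)
    then obtain A B where Z: "Z = A \<times> B" "closed A" "closed B" by auto
    have "approx (\<lambda>p. c * indicator Z p)" for c
    proof (cases "A = {} \<or> B = {}")
      case True then show ?thesis using approx_zero by (auto simp: Z)
    next
      case False
      obtain f where f: "\<And>n. f n \<in> bcontfun" "\<And>n x. cmod (f n x) \<le> 1" "\<And>x. (\<lambda>n. f n x) \<longlonglongrightarrow> indicator A x"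
        using closed_indicator_limit[OF Z(2)] False by metis
      obtain g where g: "\<And>n. g n \<in> bcontfun" "\<And>n x. cmod (g n x) \<le> 1" "\<And>x. (\<lambda>n. g n x) \<longlonglongrightarrow> indicator B x"
        using closed_indicator_limit[OF Z(3)] False by metis
      show ?thesis
      proof (rule approx_limit_dominated[where C = "cmod c"])
        show "approx (\<lambda>(x, y). (c * f n x) * g n y)" for n
          by (intro approx_tensor bcontfun_mult const_bcontfun f g)
        have "A \<times> B \<in> sets M" using Z unfolding sets_M by (intro pair_measureI) auto
        then show "(\<lambda>p. c * indicator Z p) \<in> borel_measurable M" by (simp add: Z)
        show "(\<lambda>n. case p of (x, y) \<Rightarrow> (c * f n x) * g n y) \<longlonglongrightarrow> c * indicator Z p" for p
        proof -
          obtain x y where p: "p = (x, y)" by force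
          have "(\<lambda>n. (c * f n x) * g n y) \<longlonglongrightarrow> (c * indicator A x) * indicator B y" by (intro tendsto_intros f g)
          then show ?thesis by (simp add: p Z indicator_times mult.assoc)
        qed
        show "cmod (case p of (x, y) \<Rightarrow> (c * f n x) * g n y) \<le> cmod c" for n p
          using mult_mono[OF f(2)[of n "fst p"] g(2)[of n "snd p"]] mult_left_mono[of "cmod (f n (fst p)) * cmod (g n (snd p))" 1 "cmod c"]
          by (simp add: case_prod_unfold norm_mult mult.assoc)
        show "cmod (c * indicator Z p) \<le> cmod c" for p by (simp add: norm_mult indicator_def)
      qed
    qed
    then show ?case by blast
  next
    case empty then show ?case using approx_zero by simp
  next
    case (compl Z)
    have "approx (\<lambda>p. c * indicator (UNIV - Z) p)" for c
    proof -
    have "approx (\<lambda>p. (case p of (x, y) \<Rightarrow> c * 1) + (- c) * indicator Z p)"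
      using compl(2) by (intro approx_add approx_tensor const_bcontfun) blast
    also have "(\<lambda>p. (case p of (x, y) \<Rightarrow> c * 1) + (- c) * indicator Z p) = (\<lambda>p. c * indicator (UNIV - Z) p)"
      by (auto simp: indicator_def)
    finally show ?thesis .
    qed
    then show ?case by blast
  next
    case (union Z)
    have Zs: "Z i \<in> sets M" for i using union(2) by (auto simp: sets_M_closed)
    have sum: "(\<Sum>i<n. indicator (Z i) p) = indicator (\<Union>i<n. Z i) p" for n and p :: "complex \<times> complex"
      using union(1) by (intro indicator_UN_disjoint[symmetric]) (auto simp: disjoint_family_on_def)
    have ap: "approx (\<lambda>p. c * (\<Sum>i<n. indicator (Z i) p))" for c n
    proof (induction n)
      case 0 then show ?case using approx_zero by simp
    next
      case (Suc n)
      then show ?case using approx_add[OF Suc union(3)[rule_format, of c n]] by (simp add: distrib_left)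
    qed
    have "approx (\<lambda>p. c * indicator (\<Union>i. Z i) p)" for c
    proof (rule approx_limit_dominated[where C = "cmod c", OF ap])
      show "(\<lambda>p. c * indicator (\<Union>i. Z i) p) \<in> borel_measurable M" using Zs by measurable
      show "(\<lambda>n. c * (\<Sum>i<n. indicator (Z i) p)) \<longlonglongrightarrow> c * indicator (\<Union>i. Z i) p" for p
      proof (intro tendsto_mult tendsto_const)
        have "(\<lambda>n. indicator (\<Union>i<n. Z i) p :: complex) \<longlonglongrightarrow> indicator (\<Union>i. Z i) p"
          by (rule LIMSEQ_indicator_UN)
        then show "(\<lambda>n. \<Sum>i<n. indicator (Z i) p :: complex) \<longlonglongrightarrow> indicator (\<Union>i. Z i) p" by (simp add: sum)
      qed
      show "cmod (c * (\<Sum>i<n. indicator (Z i) p)) \<le> cmod c" for n p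
        unfolding sum by (simp add: norm_mult indicator_def)
      show "cmod (c * indicator (\<Union>i. Z i) p) \<le> cmod c" for p by (simp add: norm_mult indicator_def)
    qed
    then show ?case by blast
  qed
  then show ?thesis by blast
qed

lemma approx_simple:
  assumes s: "simple_function M s" shows "approx s"
proof -
  have sp: "space M = UNIV" using sets_eq_imp_space_eq[OF sets_M] by (simp add: space_pair_measure)
  have fin: "finite (range s)" using s by (simp add: simple_function_def sp)
  have "approx (\<lambda>p. \<Sum>y\<in>Y. y * indicator (s -` {y}) p)" if "finite Y" "Y \<subseteq> range s" for Y
    using that
  proof (induction Y)
    case empty then show ?case using approx_zero by simp
  next
    case (insert y Y)
    have "s -` {y} \<in> sets M" using s insert(4) by (auto simp: simple_function_def sp)
    then show ?case unfolding sum.insert[OF insert(1,2)]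
      by (intro approx_add approx_indicator) (use insert(3,4) in blast)+
  qed
  from this[OF fin] have "approx (\<lambda>p. \<Sum>y\<in>range s. y * indicator (s -` {y}) p)" by simp
  also have "(\<lambda>p. \<Sum>y\<in>range s. y * indicator (s -` {y}) p) = s"
  proof
    fix p
    have "(\<Sum>y\<in>range s. y * indicator (s -` {y}) p) = (\<Sum>y\<in>range s. if y = s p then y else 0)"
      by (intro sum.cong) (auto simp: indicator_def)
    also have "\<dots> = s p" using fin by simp
    finally show "(\<Sum>y\<in>range s. y * indicator (s -` {y}) p) = s p" .
  qed
  finally show ?thesis .
qed

lemma D_dense:
  assumes f: "f \<in> L2 M" and e: "0 < e"
  shows "\<exists>g\<in>D. L2norm M (\<lambda>p. g p - f p) < e"
proof -
  have fm: "f \<in> borel_measurable M" by (rule L2_measurable[OF f])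
  from borel_measurable_implies_sequence_metric[OF fm, of 0]
  obtain s where s: "\<And>i. simple_function M (s i)" "\<And>p. p \<in> space M \<Longrightarrow> (\<lambda>i. s i p) \<longlonglongrightarrow> f p"
    "\<And>i p. p \<in> space M \<Longrightarrow> cmod (s i p) \<le> 2 * cmod (f p)"
    unfolding norm_conv_dist by metis
  have "approx f"
  proof (rule approx_limit[OF approx_simple[OF s(1)] f L2_dominated_convergence[where w = "\<lambda>p. 3 * cmod (f p)"]])
    show "s n \<in> borel_measurable M" for n by (rule borel_measurable_simple_function[OF s(1)])
    show "f \<in> borel_measurable M" by (rule fm)
    show "integrable M (\<lambda>p. (3 * cmod (f p))\<^sup>2)"
      unfolding power_mult_distrib by (intro integrable_mult_right L2_integrable f)
    show "cmod (s n p - f p) \<le> 3 * cmod (f p)" if "p \<in> space M" for n p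
      using norm_triangle_ineq4[of "s n p" "f p"] s(3)[OF that, of n] by simp
  qed (rule s(2))
  then show ?thesis using e by (simp add: approx_def)
qed

end

section \<open>Expectations of words in monotonically independent operators\<close>

context normal_op
begin

lemma calculus: "is_functional_calculus X (fcalc X)"
  by (rule is_functional_calculus_fcalc[OF normal])

lemma calc_bl: "f \<in> bcontfun \<Longrightarrow> bounded_linear (fcalc X f)"
  and calc_scaleC: "f \<in> bcontfun \<Longrightarrow> fcalc X f (c *\<^sub>C v) = c *\<^sub>C fcalc X f v"
  and calc_one: "fcalc X (\<lambda>z. 1) v = v"
  and calc_add: "f \<in> bcontfun \<Longrightarrow> g \<in> bcontfun \<Longrightarrow> fcalc X (\<lambda>z. f z + g z) v = fcalc X f v + fcalc X g v"
  and calc_scale: "f \<in> bcontfun \<Longrightarrow> fcalc X (\<lambda>z. c * f z) v = c *\<^sub>C fcalc X f v"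
  and calc_mult: "f \<in> bcontfun \<Longrightarrow> g \<in> bcontfun \<Longrightarrow> fcalc X (\<lambda>z. f z * g z) v = fcalc X f (fcalc X g v)"
  and calc_cnj: "f \<in> bcontfun \<Longrightarrow> cinner u (fcalc X (\<lambda>z. cnj (f z)) v) = cinner (fcalc X f u) v"
  using calculus unfolding is_functional_calculus_def bounded_clinear_def by simp_all

lemma calc_vadd: "f \<in> bcontfun \<Longrightarrow> fcalc X f (u + v) = fcalc X f u + fcalc X f v"
  by (rule linear_add[OF bounded_linear.linear[OF calc_bl]])

lemma calc_const: "fcalc X (\<lambda>z. c) v = c *\<^sub>C v"
  using calc_scale[OF const_bcontfun[of 1], of c v] by (simp add: calc_one)

lemma calc_centre:
  assumes "f \<in> bcontfun"
  shows "fcalc X f v = fcalc X (\<lambda>z. f z - f 0) v + f 0 *\<^sub>C v"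
  using calc_add[OF minus_cont[OF assms const_bcontfun[of "f 0"]] const_bcontfun[of "f 0"], of v]
  by (simp add: calc_const)

end

lemma bcontfun_cnj: fixes f :: "complex \<Rightarrow> complex" shows "f \<in> bcontfun \<Longrightarrow> (\<lambda>z. cnj (f z)) \<in> bcontfun"
proof -
  assume f: "f \<in> bcontfun"
  obtain C where "\<And>z. cmod (f z) \<le> C" using bcontfun_bound[OF f] by blast
  then have "cmod (cnj (f z)) \<le> C" for z by simp
  then show ?thesis by (rule bcontfun_normI[OF continuous_on_cnj[OF bcontfun_continuous[OF f]]])
qed

lemma prod_index_zip:
  assumes "length Xs = length es"
  shows "(\<Prod>k | k < length es \<and> es ! k = (c::nat). f (Xs ! k)) = prod_list (map f [X. (e, X) \<leftarrow> zip es Xs, e = c])"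
  using assms
proof (induction es Xs rule: list_induct2')
  case (4 e es X Xs)
  have "{k. k < length (e # es) \<and> (e # es) ! k = c} =
      (if e = c then {0} else {}) \<union> Suc ` {k. k < length es \<and> es ! k = c}"
    by (auto simp: less_Suc_eq_0_disj)
  then have "(\<Prod>k | k < length (e # es) \<and> (e # es) ! k = c. f ((X # Xs) ! k)) =
      (\<Prod>k \<in> (if e = c then {0} else {}) \<union> Suc ` {k. k < length es \<and> es ! k = c}. f ((X # Xs) ! k))"
    by simp
  also have "\<dots> = (if e = c then f X else 1) * (\<Prod>k | k < length es \<and> es ! k = c. f (Xs ! k))"
    by (subst prod.union_disjoint) (auto simp: prod.reindex)
  finally show ?case using 4 by simp
qed auto

text \<open>The products over index sets are replaced by products over lists, which the
  simplifier computes when the word is given explicitly.\<close>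

lemma monotone_independent_word:
  fixes es :: "nat list"
  assumes "monotone_independent \<Omega> A1 A2" "set es \<subseteq> {1, 2}" "distinct_adj es"
    "list_all2 (\<lambda>e X. X \<in> (if e = 1 then A1 else A2)) es Xs"
  shows "cinner \<Omega> (op_prod Xs \<Omega>) = cinner \<Omega> (op_prod [X. (e, X) \<leftarrow> zip es Xs, e = 1] \<Omega>) *
    prod_list (map (\<lambda>X. cinner \<Omega> (X \<Omega>)) [X. (e, X) \<leftarrow> zip es Xs, e = 2])"
proof -
  have len: "length Xs = length es" using list_all2_lengthD[OF assms(4)] by simp
  have "\<forall>k<length es. Xs ! k \<in> (if es ! k = 1 then A1 else A2)"
    using list_all2_nthD[OF assms(4)] by blast
  then show ?thesis
    using assms(1)[unfolded monotone_independent_def, rule_format, of es Xs] assms(2,3) len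
    unfolding prod_index_zip[OF len, where f = "\<lambda>X. cinner \<Omega> (X \<Omega>)"] by simp
qed

locale monotone_pair =
  fixes X Y :: "('h::complex_hilbert \<times> 'h) set" and \<Omega> :: 'h and \<mu> \<nu> :: "complex measure"
  assumes nX: "normal_operator X" and nY: "normal_operator Y"
    and mono: "monotone_independent_operators \<Omega> X Y"
    and dX: "is_distribution X \<Omega> \<mu>" and dY: "is_distribution Y \<Omega> \<nu>"
begin

sublocale X: normal_op X by unfold_locales (rule nX)
sublocale Y: normal_op Y by unfold_locales (rule nY)
sublocale mu: prob_space \<mu> using dX by (simp add: is_distribution_def)
sublocale nu: prob_space \<nu> using dY by (simp add: is_distribution_def)
sublocale pair: pair_prob_space \<mu> \<nu> ..

lemma sets_mu: "sets \<mu> = sets borel" and sets_nu: "sets \<nu> = sets borel"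
  using dX dY by (auto simp: is_distribution_def)

lemma muX: "h \<in> bcontfun \<Longrightarrow> cinner \<Omega> (fcalc X h \<Omega>) = (\<integral>z. h z \<partial>\<mu>)"
  and nuY: "h \<in> bcontfun \<Longrightarrow> cinner \<Omega> (fcalc Y h \<Omega>) = (\<integral>z. h z \<partial>\<nu>)"
  using dX dY by (auto simp: is_distribution_def)

lemma integrable_mu: fixes h :: "complex \<Rightarrow> complex" shows "h \<in> bcontfun \<Longrightarrow> integrable \<mu> h"
proof -
  assume h: "h \<in> bcontfun"
  obtain C where "\<And>z. cmod (h z) \<le> C" using bcontfun_bound[OF h] by blast
  then show ?thesis using bcontfun_borel[OF h]
    by (intro mu.integrable_const_bound[of _ C]) (auto simp: measurable_cong_sets[OF sets_mu refl])
qed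

lemma integrable_nu: fixes h :: "complex \<Rightarrow> complex" shows "h \<in> bcontfun \<Longrightarrow> integrable \<nu> h"
proof -
  assume h: "h \<in> bcontfun"
  obtain C where "\<And>z. cmod (h z) \<le> C" using bcontfun_bound[OF h] by blast
  then show ?thesis using bcontfun_borel[OF h]
    by (intro nu.integrable_const_bound[of _ C]) (auto simp: measurable_cong_sets[OF sets_nu refl])
qed

lemma word:
  assumes "set es \<subseteq> {1, 2}" "distinct_adj es"
    "list_all2 (\<lambda>e h. h \<in> bcontfun \<and> h 0 = 0) es hs"
  shows "cinner \<Omega> (op_prod (map2 (\<lambda>e h. fcalc (if e = (1::nat) then X else Y) h) es hs) \<Omega>) =
    cinner \<Omega> (op_prod [fcalc X h. (e, h) \<leftarrow> zip es hs, e = 1] \<Omega>) *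
    prod_list [\<integral>z. h z \<partial>\<nu>. (e, h) \<leftarrow> zip es hs, e = 2]"
proof -
  define Xs where "Xs = map2 (\<lambda>e h. fcalc (if e = (1::nat) then X else Y) h) es hs"
  have len: "length es = length hs" by (rule list_all2_lengthD[OF assms(3)])
  have m: "monotone_independent \<Omega> (alg0 X) (alg0 Y)"
    using mono by (simp add: monotone_independent_operators_def)
  have "list_all2 (\<lambda>e A. A \<in> (if e = 1 then alg0 X else alg0 Y)) es Xs"
    unfolding list_all2_conv_all_nth
  proof (intro conjI allI impI)
    show "length es = length Xs" using len by (simp add: Xs_def)
    fix k assume k: "k < length es"
    then have "hs ! k \<in> bcontfun" "(hs ! k) 0 = 0" using list_all2_nthD[OF assms(3) k] by auto
    then show "Xs ! k \<in> (if es ! k = 1 then alg0 X else alg0 Y)"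
      using k len by (auto simp: Xs_def alg0_def)
  qed
  note monotone_independent_word[OF m assms(1,2) this]
  moreover have "[A. (e, A) \<leftarrow> zip es Xs, e = 1] = [fcalc X h. (e, h) \<leftarrow> zip es hs, e = 1]"
    unfolding Xs_def using len by (induction es hs rule: list_induct2) auto
  moreover have "map (\<lambda>A. cinner \<Omega> (A \<Omega>)) [A. (e, A) \<leftarrow> zip es Xs, e = 2] = [\<integral>z. h z \<partial>\<nu>. (e, h) \<leftarrow> zip es hs, e = 2]"
    unfolding Xs_def using len assms(3) by (induction es hs rule: list_induct2) (auto simp: nuY)
  ultimately show ?thesis by (simp add: Xs_def)
qed

abbreviation F where "F \<equiv> fcalc X"
abbreviation E where "E \<equiv> fcalc Y"

text \<open>A word whose outer letters are arbitrary functions of \<open>X\<close> is expanded into four words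
  of centred letters, by splitting off the values at 0. The middle part \<open>Z\<close> of the word contributes a factor
  \<open>c\<close> from its letters of \<open>Y\<close> and a weight \<open>m\<close> from its letters of \<open>X\<close>.\<close>

lemma expand_outer:
  assumes a: "a \<in> bcontfun" and b: "b \<in> bcontfun" and m: "m \<in> bcontfun"
    and Z: "\<And>u v. Z (u + v) = Z u + Z v" "\<And>c v. Z (c *\<^sub>C v) = c *\<^sub>C Z v"
    and z: "\<And>h k. h \<in> {\<lambda>z. a z - a 0, \<lambda>z. 1} \<Longrightarrow> k \<in> {\<lambda>z. b z - b 0, \<lambda>z. 1} \<Longrightarrow>
      cinner \<Omega> (F h (Z (F k \<Omega>))) = c * (\<integral>z. h z * m z * k z \<partial>\<mu>)"
  shows "cinner \<Omega> (F a (Z (F b \<Omega>))) = c * (\<integral>z. a z * m z * b z \<partial>\<mu>)"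
proof -
  let ?a = "\<lambda>z. a z - a 0" and ?b = "\<lambda>z. b z - b 0"
  have a0: "?a \<in> bcontfun" and b0: "?b \<in> bcontfun" by (intro minus_cont a b const_bcontfun)+
  have I1: "(\<integral>z. a z * m z * k z \<partial>\<mu>) = (\<integral>z. ?a z * m z * k z \<partial>\<mu>) + a 0 * (\<integral>z. 1 * m z * k z \<partial>\<mu>)"
    if k: "k \<in> bcontfun" for k
  proof -
    have "(\<integral>z. a z * m z * k z \<partial>\<mu>) = (\<integral>z. ?a z * m z * k z + a 0 * (1 * m z * k z) \<partial>\<mu>)"
      by (intro Bochner_Integration.integral_cong) (auto simp: algebra_simps)
    also have "\<dots> = (\<integral>z. ?a z * m z * k z \<partial>\<mu>) + (\<integral>z. a 0 * (1 * m z * k z) \<partial>\<mu>)"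
      by (intro Bochner_Integration.integral_add integrable_mu bcontfun_mult a0 m k const_bcontfun)
    finally show ?thesis by simp
  qed
  have I2: "(\<integral>z. h z * m z * b z \<partial>\<mu>) = (\<integral>z. h z * m z * ?b z \<partial>\<mu>) + b 0 * (\<integral>z. h z * m z * 1 \<partial>\<mu>)"
    if h: "h \<in> bcontfun" for h
  proof -
    have "(\<integral>z. h z * m z * b z \<partial>\<mu>) = (\<integral>z. h z * m z * ?b z + b 0 * (h z * m z * 1) \<partial>\<mu>)"
      by (intro Bochner_Integration.integral_cong) (auto simp: algebra_simps)
    also have "\<dots> = (\<integral>z. h z * m z * ?b z \<partial>\<mu>) + (\<integral>z. b 0 * (h z * m z * 1) \<partial>\<mu>)"
      by (intro Bochner_Integration.integral_add integrable_mu bcontfun_mult b0 m h const_bcontfun)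
    finally show ?thesis by simp
  qed
  have T2: "cinner \<Omega> (F h (Z (F b \<Omega>))) = cinner \<Omega> (F h (Z (F ?b \<Omega>))) + b 0 * cinner \<Omega> (F h (Z (F (\<lambda>z. 1) \<Omega>)))"
    if h: "h \<in> bcontfun" for h
    unfolding X.calc_centre[OF b, of \<Omega>] X.calc_one
    by (simp add: Z X.calc_vadd X.calc_scaleC h cinner_add_right cinner_scaleC_right)
  have T1: "cinner \<Omega> (F a w) = cinner \<Omega> (F ?a w) + a 0 * cinner \<Omega> (F (\<lambda>z. 1) w)" for w
    unfolding X.calc_centre[OF a, of w] X.calc_one by (simp add: cinner_add_right cinner_scaleC_right)
  have "cinner \<Omega> (F h (Z (F b \<Omega>))) = c * (\<integral>z. h z * m z * b z \<partial>\<mu>)"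
    if h: "h \<in> {?a, \<lambda>z. 1}" for h
  proof -
    have hb: "h \<in> bcontfun" using h a0 const_bcontfun by auto
    show ?thesis unfolding T2[OF hb] I2[OF hb] using z[OF h, of ?b] z[OF h, of "\<lambda>z. 1"]
      by (simp only: insert_iff simp_thms distrib_left mult.left_commute[of c])
  qed
  then show ?thesis unfolding T1 I1[OF b]
    by (simp only: insert_iff simp_thms distrib_left mult.left_commute[of c])
qed

lemma word_E:
  assumes g: "g \<in> bcontfun" "g 0 = 0"
    and h: "h = (\<lambda>z. 1) \<or> h \<in> bcontfun \<and> h 0 = 0" and k: "k = (\<lambda>z. 1) \<or> k \<in> bcontfun \<and> k 0 = 0"
  shows "cinner \<Omega> (F h (E g (F k \<Omega>))) = (\<integral>z. g z \<partial>\<nu>) * (\<integral>z. h z * 1 * k z \<partial>\<mu>)"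
proof -
  have FF: "cinner \<Omega> (F h (F k \<Omega>)) = (\<integral>z. h z * k z \<partial>\<mu>)" if "h \<in> bcontfun" "k \<in> bcontfun" for h k
    using muX[OF bcontfun_mult[OF that]] by (simp add: X.calc_mult that)
  consider "h = (\<lambda>z. 1)" "k = (\<lambda>z. 1)" | "h = (\<lambda>z. 1)" "k \<in> bcontfun" "k 0 = 0"
    | "h \<in> bcontfun" "h 0 = 0" "k = (\<lambda>z. 1)" | "h \<in> bcontfun" "h 0 = 0" "k \<in> bcontfun" "k 0 = 0"
    using h k by blast
  then show ?thesis
  proof cases
    case 1
    then show ?thesis using nuY[OF g(1)] by (simp add: X.calc_one mu.prob_space)
  next
    case 2
    then show ?thesis using word[of "[2, 1]" "[g, k]"] g muX[OF 2(2)]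
      by (simp add: op_prod_def X.calc_one mult.commute)
  next
    case 3
    then show ?thesis using word[of "[1, 2]" "[h, g]"] g muX[OF 3(1)]
      by (simp add: op_prod_def X.calc_one mult.commute)
  next
    case 4
    then show ?thesis using word[of "[1, 2, 1]" "[h, g, k]"] g FF[OF 4(1,3)]
      by (simp add: op_prod_def mult.commute)
  qed
qed

lemma word_EFE:
  assumes p: "p \<in> bcontfun" "p 0 = 0" and m: "m \<in> bcontfun" "m 0 = 0" and q: "q \<in> bcontfun" "q 0 = 0"
    and h: "h = (\<lambda>z. 1) \<or> h \<in> bcontfun \<and> h 0 = 0" and k: "k = (\<lambda>z. 1) \<or> k \<in> bcontfun \<and> k 0 = 0"
  shows "cinner \<Omega> (F h (E p (F m (E q (F k \<Omega>))))) = ((\<integral>z. p z \<partial>\<nu>) * (\<integral>z. q z \<partial>\<nu>)) * (\<integral>z. h z * m z * k z \<partial>\<mu>)"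
proof -
  have FF: "cinner \<Omega> (F h (F k \<Omega>)) = (\<integral>z. h z * k z \<partial>\<mu>)" if "h \<in> bcontfun" "k \<in> bcontfun" for h k
    using muX[OF bcontfun_mult[OF that]] by (simp add: X.calc_mult that)
  consider "h = (\<lambda>z. 1)" "k = (\<lambda>z. 1)" | "h = (\<lambda>z. 1)" "k \<in> bcontfun" "k 0 = 0"
    | "h \<in> bcontfun" "h 0 = 0" "k = (\<lambda>z. 1)" | "h \<in> bcontfun" "h 0 = 0" "k \<in> bcontfun" "k 0 = 0"
    using h k by blast
  then show ?thesis
  proof cases
    case 1
    then show ?thesis using word[of "[2, 1, 2]" "[p, m, q]"] p q m muX[OF m(1)]
      by (simp add: op_prod_def X.calc_one mult_ac)
  next
    case 2
    then show ?thesis using word[of "[2, 1, 2, 1]" "[p, m, q, k]"] p q m FF[OF m(1) 2(2)]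
      by (simp add: op_prod_def X.calc_one mult_ac)
  next
    case 3
    then show ?thesis using word[of "[1, 2, 1, 2]" "[h, p, m, q]"] p q m FF[OF 3(1) m(1)]
      by (simp add: op_prod_def X.calc_one mult_ac)
  next
    case 4
    have "cinner \<Omega> (F h (F m (F k \<Omega>))) = (\<integral>z. h z * m z * k z \<partial>\<mu>)"
      using muX[OF bcontfun_mult[OF bcontfun_mult[OF 4(1) m(1)] 4(3)]]
      by (simp add: X.calc_mult bcontfun_mult m 4)
    then show ?thesis using 4 word[of "[1, 2, 1, 2, 1]" "[h, p, m, q, k]"] p q m
      by (simp add: op_prod_def mult_ac)
  qed
qed

lemma centred: "f \<in> bcontfun \<Longrightarrow> (\<lambda>z. f z - f 0) \<in> bcontfun" for f :: "complex \<Rightarrow> complex"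
  by (intro minus_cont const_bcontfun)

lemma centred_integral_nu: "g \<in> bcontfun \<Longrightarrow> (\<integral>z. g z \<partial>\<nu>) = (\<integral>z. g z - g 0 \<partial>\<nu>) + g 0" for g :: "complex \<Rightarrow> complex"
  by (simp add: integrable_nu nu.prob_space)

lemma expectation_FEF:
  assumes a: "a \<in> bcontfun" and g: "g \<in> bcontfun" and b: "b \<in> bcontfun"
  shows "cinner \<Omega> (F a (E g (F b \<Omega>))) = (\<integral>z. g z \<partial>\<nu>) * (\<integral>z. a z * b z \<partial>\<mu>)"
proof -
  let ?g = "\<lambda>z. g z - g 0"
  have g0: "?g \<in> bcontfun" by (rule centred[OF g])
  have "cinner \<Omega> (F a (E ?g (F b \<Omega>))) = (\<integral>z. ?g z \<partial>\<nu>) * (\<integral>z. a z * 1 * b z \<partial>\<mu>)"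
  proof (rule expand_outer[OF a b const_bcontfun])
    show "cinner \<Omega> (F h (E ?g (F k \<Omega>))) = (\<integral>z. ?g z \<partial>\<nu>) * (\<integral>z. h z * 1 * k z \<partial>\<mu>)"
      if "h \<in> {\<lambda>z. a z - a 0, \<lambda>z. 1}" "k \<in> {\<lambda>z. b z - b 0, \<lambda>z. 1}" for h k
      by (rule word_E[OF g0]) (use that centred[OF a] centred[OF b] in auto)
  qed (simp_all add: Y.calc_vadd Y.calc_scaleC g0)
  moreover have "cinner \<Omega> (F a (F b \<Omega>)) = (\<integral>z. a z * b z \<partial>\<mu>)"
    using muX[OF bcontfun_mult[OF a b]] by (simp add: X.calc_mult a b)
  moreover have "cinner \<Omega> (F a (E g (F b \<Omega>))) = cinner \<Omega> (F a (E ?g (F b \<Omega>))) + g 0 * cinner \<Omega> (F a (F b \<Omega>))"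
    unfolding Y.calc_centre[OF g, of "F b \<Omega>"]
    by (simp add: X.calc_vadd X.calc_scaleC a cinner_add_right cinner_scaleC_right)
  ultimately show ?thesis unfolding centred_integral_nu[OF g] by (simp add: distrib_right)
qed

text \<open>Splitting off the value at 0 from one letter of \<open>Y\<close> leaves a shorter word, in which
  neighbouring letters of \<open>X\<close> merge and \<open>expectation_FEF\<close> applies.\<close>

lemma expectation_FEFEF:
  assumes a: "a \<in> bcontfun" and p: "p \<in> bcontfun" and m: "m \<in> bcontfun" "m 0 = 0"
    and q: "q \<in> bcontfun" and b: "b \<in> bcontfun"
  shows "cinner \<Omega> (F a (E p (F m (E q (F b \<Omega>))))) =
    (\<integral>z. p z \<partial>\<nu>) * (\<integral>z. q z \<partial>\<nu>) * (\<integral>z. a z * m z * b z \<partial>\<mu>)"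
proof -
  let ?p = "\<lambda>z. p z - p 0" and ?q = "\<lambda>z. q z - q 0"
  let ?I = "\<integral>z. a z * m z * b z \<partial>\<mu>"
  have p0: "?p \<in> bcontfun" and q0: "?q \<in> bcontfun" by (rule centred[OF p] centred[OF q])+
  have "cinner \<Omega> (F a (E ?p (F m (E ?q (F b \<Omega>))))) = ((\<integral>z. ?p z \<partial>\<nu>) * (\<integral>z. ?q z \<partial>\<nu>)) * ?I"
  proof (rule expand_outer[OF a b m(1), where Z = "\<lambda>v. E ?p (F m (E ?q v))"])
    show "cinner \<Omega> (F h (E ?p (F m (E ?q (F k \<Omega>))))) =
        ((\<integral>z. ?p z \<partial>\<nu>) * (\<integral>z. ?q z \<partial>\<nu>)) * (\<integral>z. h z * m z * k z \<partial>\<mu>)"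
      if "h \<in> {\<lambda>z. a z - a 0, \<lambda>z. 1}" "k \<in> {\<lambda>z. b z - b 0, \<lambda>z. 1}" for h k
      by (rule word_EFE[OF p0 _ m q0]) (use that centred[OF a] centred[OF b] in auto)
  qed (simp_all add: Y.calc_vadd Y.calc_scaleC X.calc_vadd X.calc_scaleC p0 q0 m)
  moreover have "cinner \<Omega> (F a (E ?p (F m (F b \<Omega>)))) = (\<integral>z. ?p z \<partial>\<nu>) * ?I"
    using expectation_FEF[OF a p0 bcontfun_mult[OF m(1) b]] by (simp add: X.calc_mult m b mult.assoc)
  moreover have "cinner \<Omega> (F a (F m (E q (F b \<Omega>)))) = (\<integral>z. q z \<partial>\<nu>) * ?I"
    using expectation_FEF[OF bcontfun_mult[OF a m(1)] q b] by (simp add: X.calc_mult a m)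
  moreover have "cinner \<Omega> (F a (E p (F m (E q (F b \<Omega>))))) =
      cinner \<Omega> (F a (E ?p (F m (E q (F b \<Omega>))))) + p 0 * cinner \<Omega> (F a (F m (E q (F b \<Omega>))))"
    unfolding Y.calc_centre[OF p, of "F m (E q (F b \<Omega>))"]
    by (simp add: X.calc_vadd X.calc_scaleC a cinner_add_right cinner_scaleC_right)
  moreover have "cinner \<Omega> (F a (E ?p (F m (E q (F b \<Omega>))))) =
      cinner \<Omega> (F a (E ?p (F m (E ?q (F b \<Omega>))))) + q 0 * cinner \<Omega> (F a (E ?p (F m (F b \<Omega>))))"
    unfolding Y.calc_centre[OF q, of "F b \<Omega>"]
    by (simp add: X.calc_vadd X.calc_scaleC Y.calc_vadd Y.calc_scaleC p0 a m cinner_add_right cinner_scaleC_right)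
  ultimately show ?thesis unfolding centred_integral_nu[OF p] centred_integral_nu[OF q]
    by (simp only: distrib_right distrib_left mult_ac add_ac)
qed

text \<open>After subtracting its mean from \<open>g\<close> the claim is that a vector vanishes. Its squared
  norm is the expectation of a word as in \<open>expectation_FEFEF\<close>, where both letters of \<open>Y\<close>
  have integral 0.\<close>

lemma F_E_F:
  assumes h: "h \<in> bcontfun" "h 0 = 0" and g: "g \<in> bcontfun" and b: "b \<in> bcontfun"
  shows "F h (E g (F b \<Omega>)) = (\<integral>z. g z \<partial>\<nu>) *\<^sub>C F h (F b \<Omega>)"
proof -
  define c where "c = (\<integral>z. g z \<partial>\<nu>)"
  let ?g = "\<lambda>z. g z - c"
  have g0: "?g \<in> bcontfun" by (intro minus_cont const_bcontfun g)
  have int0: "(\<integral>z. ?g z \<partial>\<nu>) = 0" using integrable_nu[OF g] by (simp add: nu.prob_space c_def)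
  define v where "v = F h (E ?g (F b \<Omega>))"
  let ?hh = "\<lambda>z. cnj (h z) * h z"
  have hh: "?hh \<in> bcontfun" by (intro bcontfun_mult bcontfun_cnj h)
  have "cinner v v = cinner \<Omega> (F (\<lambda>z. cnj (b z)) (E (\<lambda>z. cnj (?g z)) (F (\<lambda>z. cnj (h z)) v)))"
    unfolding v_def by (simp only: X.calc_cnj[OF b] Y.calc_cnj[OF g0] X.calc_cnj[OF h(1)])
  also have "F (\<lambda>z. cnj (h z)) v = F ?hh (E ?g (F b \<Omega>))"
    unfolding v_def by (rule X.calc_mult[symmetric]) (intro bcontfun_cnj h)+
  also have "cinner \<Omega> (F (\<lambda>z. cnj (b z)) (E (\<lambda>z. cnj (?g z)) (F ?hh (E ?g (F b \<Omega>))))) = 0"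
    using expectation_FEFEF[OF bcontfun_cnj[OF b] bcontfun_cnj[OF g0] hh _ g0 b] h(2) int0 by simp
  finally have "v = 0" by (simp add: cinner_self)
  moreover have "E g u = E ?g u + c *\<^sub>C u" for u
    using Y.calc_add[OF g0 const_bcontfun[of c], of u] by (simp add: Y.calc_const)
  then have "F h (E g (F b \<Omega>)) = v + c *\<^sub>C F h (F b \<Omega>)"
    by (simp add: v_def X.calc_vadd X.calc_scaleC h)
  ultimately show ?thesis by (simp add: c_def)
qed

end

section \<open>The adjoint of an isometry on square-integrable functions\<close>

lemma L2_inner_integrable:
  assumes "f \<in> L2 M" "g \<in> L2 M" shows "integrable M (\<lambda>x. cnj (f x) * g x)"
proof -
  have [measurable]: "f \<in> borel_measurable M" "g \<in> borel_measurable M" using assms by (auto intro: L2_measurable)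
  have le: "cmod (cnj (f x) * g x) \<le> (cmod (f x))\<^sup>2 + (cmod (g x))\<^sup>2" for x
  proof -
    have "0 \<le> (cmod (f x) - cmod (g x))\<^sup>2" by simp
    then have "2 * (cmod (f x) * cmod (g x)) \<le> (cmod (f x))\<^sup>2 + (cmod (g x))\<^sup>2"
      by (simp add: power2_eq_square algebra_simps)
    moreover have "0 \<le> cmod (f x) * cmod (g x)" by simp
    ultimately have "cmod (f x) * cmod (g x) \<le> (cmod (f x))\<^sup>2 + (cmod (g x))\<^sup>2" by linarith
    then show ?thesis by (simp add: norm_mult)
  qed
  have "integrable M (\<lambda>x. (cmod (f x))\<^sup>2 + (cmod (g x))\<^sup>2)"
    by (intro Bochner_Integration.integrable_add L2_integrable assms)
  then show ?thesis
  proof (rule Bochner_Integration.integrable_bound)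
    have [measurable]: "cnj \<in> borel_measurable borel"
      by (intro borel_measurable_continuous_onI continuous_intros)
    show "(\<lambda>x. cnj (f x) * g x) \<in> borel_measurable M" by measurable
  qed (use le in \<open>auto intro!: AE_I2 order_trans[OF _ abs_ge_self]\<close>)
qed

text \<open>By polarisation.\<close>

lemma L2_isometry_cinner:
  assumes W: "L2_isometry M W" and f: "f \<in> L2 M" and g: "g \<in> L2 M"
  shows "cinner (W f) (W g) = (\<integral>x. cnj (f x) * g x \<partial>M)"
proof -
  let ?d = "cinner (W f) (W g) - (\<integral>x. cnj (f x) * g x \<partial>M)"
  have "Re (c * ?d) = 0" for c
  proof -
    have cg: "(\<lambda>x. c * g x) \<in> L2 M" by (rule L2_scale[OF g])
    have nW: "(norm (W h))\<^sup>2 = (\<integral>x. (cmod (h x))\<^sup>2 \<partial>M)" if "h \<in> L2 M" for h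
      using W that by (simp add: L2_isometry_def)
    have sq: "(norm (u + v))\<^sup>2 = (norm u)\<^sup>2 + (norm v)\<^sup>2 + 2 * Re (cinner u v)" for u v :: "'b"
      by (simp add: power2_norm_eq_inner inner_add_left inner_add_right inner_commute inner_eq_Re_cinner[symmetric])
    have int: "integrable M (\<lambda>x. (cmod (f x))\<^sup>2)" "integrable M (\<lambda>x. (cmod (c * g x))\<^sup>2)"
      "integrable M (\<lambda>x. cnj (f x) * (c * g x))"
      by (intro L2_integrable L2_inner_integrable f cg)+
    have "(norm (W f + W (\<lambda>x. c * g x)))\<^sup>2 = (\<integral>x. (cmod (f x + c * g x))\<^sup>2 \<partial>M)"
      using nW[OF L2_add[OF f cg]] W f cg by (simp add: L2_isometry_def)
    also have "\<dots> = (\<integral>x. (cmod (f x))\<^sup>2 + (cmod (c * g x))\<^sup>2 + 2 * Re (cnj (f x) * (c * g x)) \<partial>M)"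
    proof (intro Bochner_Integration.integral_cong refl)
      show "(cmod (f x + c * g x))\<^sup>2 = (cmod (f x))\<^sup>2 + (cmod (c * g x))\<^sup>2 + 2 * Re (cnj (f x) * (c * g x))" for x
      proof -
        have "(norm (u + v))\<^sup>2 = (norm u)\<^sup>2 + (norm v)\<^sup>2 + 2 * (u \<bullet> v)" for u v :: complex
          unfolding power2_norm_eq_inner by (simp add: inner_add_left inner_add_right inner_commute)
        moreover have "u \<bullet> v = Re (cnj u * v)" for u v by (simp add: inner_complex_def)
        ultimately show ?thesis by simp
      qed
    qed
    also have "\<dots> = (\<integral>x. (cmod (f x))\<^sup>2 \<partial>M) + (\<integral>x. (cmod (c * g x))\<^sup>2 \<partial>M) + 2 * Re (\<integral>x. cnj (f x) * (c * g x) \<partial>M)"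
      using int(1,2) integrable_Re[OF int(3)] integral_Re[OF int(3)]
      by (simp only: Bochner_Integration.integral_add Bochner_Integration.integrable_add
          integrable_mult_right integral_mult_right_zero)
    finally have "Re (cinner (W f) (W (\<lambda>x. c * g x))) = Re (\<integral>x. cnj (f x) * (c * g x) \<partial>M)"
      unfolding sq nW[OF f] nW[OF cg] by simp
    moreover have "W (\<lambda>x. c * g x) = c *\<^sub>C W g" using W g by (simp add: L2_isometry_def)
    moreover have "(\<integral>x. cnj (f x) * (c * g x) \<partial>M) = c * (\<integral>x. cnj (f x) * g x \<partial>M)"
      by (simp add: mult.left_commute[of _ c])
    ultimately show ?thesis by (simp add: cinner_scaleC_right right_diff_distrib)
  qed
  from this[of 1] this[of "\<i>"] show ?thesis by (simp add: complex_eq_iff)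
qed

text \<open>The function \<open>f\<close> satisfies the condition that determines $W^* W f$ up to null sets.\<close>

lemma L2_adjoint_isometry:
  assumes W: "L2_isometry M W" and f: "f \<in> L2 M"
  shows "AE x in M. L2_adjoint M W (W f) x = f x"
proof -
  let ?P = "\<lambda>\<phi>. \<phi> \<in> L2 M \<and> (\<forall>\<eta>\<in>L2 M. (\<integral>x. cnj (\<eta> x) * \<phi> x \<partial>M) = cinner (W \<eta>) (W f))"
  have "?P f" using f L2_isometry_cinner[OF W] by simp
  then have "?P (SOME \<phi>. ?P \<phi>)" by (rule someI[where P = ?P])
  then have P: "?P (L2_adjoint M W (W f))" unfolding L2_adjoint_def .
  define g where "g = L2_adjoint M W (W f)"
  have g: "g \<in> L2 M" using P by (simp add: g_def)
  define d where "d x = g x - f x" for x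
  have d: "d \<in> L2 M" unfolding d_def by (rule L2_diff[OF g f])
  have "(\<integral>x. cnj (d x) * d x \<partial>M) = (\<integral>x. cnj (d x) * g x - cnj (d x) * f x \<partial>M)"
    by (intro Bochner_Integration.integral_cong) (auto simp: d_def algebra_simps)
  also have "\<dots> = 0"
    using P d L2_isometry_cinner[OF W d f] L2_inner_integrable[OF d g] L2_inner_integrable[OF d f]
    by (simp add: g_def)
  finally have "(\<integral>x. complex_of_real ((cmod (d x))\<^sup>2) \<partial>M) = 0"
    by (simp only: complex_norm_square mult.commute)
  then have "L2norm M d = 0" by (simp add: L2norm_def del: of_real_power)
  from L2norm_AE_zero[OF d this] show ?thesis by (simp add: d_def g_def)
qed

text \<open>The variance of \<open>cmod (f x)\<close> is nonnegative.\<close>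

lemma (in prob_space) Jensen_sq:
  assumes f: "f \<in> borel_measurable M" "integrable M (\<lambda>x. (cmod (f x))\<^sup>2)"
  shows "(cmod (\<integral>x. f x \<partial>M))\<^sup>2 \<le> (\<integral>x. (cmod (f x))\<^sup>2 \<partial>M)"
proof -
  have "f \<in> L2 M" using f by (simp add: L2_def)
  from L2_inner_integrable[OF L2_bounded[of "\<lambda>x. 1" 1] this] have int: "integrable M f" by simp
  define m where "m = (\<integral>x. cmod (f x) \<partial>M)"
  have "0 \<le> (\<integral>x. (cmod (f x) - m)\<^sup>2 \<partial>M)" by (intro integral_nonneg_AE) auto
  also have "\<dots> = (\<integral>x. (cmod (f x))\<^sup>2 - 2 * m * cmod (f x) + m\<^sup>2 \<partial>M)"
    by (intro Bochner_Integration.integral_cong) (auto simp: power2_eq_square algebra_simps)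
  also have "\<dots> = (\<integral>x. (cmod (f x))\<^sup>2 \<partial>M) - 2 * m * m + m\<^sup>2"
    using f(2) int by (simp add: m_def prob_space)
  finally have "m\<^sup>2 \<le> (\<integral>x. (cmod (f x))\<^sup>2 \<partial>M)" by (simp add: power2_eq_square)
  moreover have "(cmod (\<integral>x. f x \<partial>M))\<^sup>2 \<le> m\<^sup>2"
    unfolding m_def by (intro power_mono integral_norm_bound) auto
  ultimately show ?thesis by linarith
qed

section \<open>The isometry intertwining both operators with their models\<close>

context monotone_pair
begin

abbreviation M where "M \<equiv> \<mu> \<Otimes>\<^sub>M \<nu>"

lemma sets_M: "sets M = sets (borel \<Otimes>\<^sub>M borel)"
  by (rule sets_pair_measure_cong[OF sets_mu sets_nu])

lemma tensor_integral:
  fixes f g :: "complex \<Rightarrow> complex"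
  assumes f: "f \<in> bcontfun" and g: "g \<in> bcontfun"
  shows "integrable M (\<lambda>(x, y). f x * g y)"
    "(\<integral>p. (case p of (x, y) \<Rightarrow> f x * g y) \<partial>M) = (\<integral>x. f x \<partial>\<mu>) * (\<integral>y. g y \<partial>\<nu>)"
proof -
  obtain C where C: "0 < C" "\<And>z. cmod (f z) \<le> C" using bcontfun_bound[OF f] by blast
  obtain D where D: "0 < D" "\<And>z. cmod (g z) \<le> D" using bcontfun_bound[OF g] by blast
  have [measurable]: "f \<in> borel_measurable \<mu>" "g \<in> borel_measurable \<nu>"
    using bcontfun_borel[OF f] bcontfun_borel[OF g]
    by (simp_all add: measurable_cong_sets[OF sets_mu refl] measurable_cong_sets[OF sets_nu refl])
  have "cmod (f x * g y) \<le> C * D" for x y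
    unfolding norm_mult using C D by (intro mult_mono) (auto intro: less_imp_le)
  then show int: "integrable M (\<lambda>(x, y). f x * g y)"
    by (intro pair.integrable_const_bound[of _ "C * D"]) auto
  have "(\<integral>p. (case p of (x, y) \<Rightarrow> f x * g y) \<partial>M) = (\<integral>x. (\<integral>y. f x * g y \<partial>\<nu>) \<partial>\<mu>)"
    using pair.integral_fst'[of "\<lambda>(x, y). f x * g y"] int by simp
  then show "(\<integral>p. (case p of (x, y) \<Rightarrow> f x * g y) \<partial>M) = (\<integral>x. f x \<partial>\<mu>) * (\<integral>y. g y \<partial>\<nu>)"
    by simp
qed

lemma tensor_L2:
  fixes f g :: "complex \<Rightarrow> complex"
  assumes f: "f \<in> bcontfun" and g: "g \<in> bcontfun"
  shows "(\<lambda>(x, y). f x * g y) \<in> L2 M"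
proof -
  obtain C where C: "0 < C" "\<And>z. cmod (f z) \<le> C" using bcontfun_bound[OF f] by blast
  obtain D where D: "0 < D" "\<And>z. cmod (g z) \<le> D" using bcontfun_bound[OF g] by blast
  have "cmod (f x * g y) \<le> C * D" for x y
    unfolding norm_mult using C D by (intro mult_mono) (auto intro: less_imp_le)
  then show ?thesis using borel_measurable_integrable[OF tensor_integral(1)[OF f g]]
    by (intro pair.L2_bounded[of _ "C * D"]) auto
qed

text \<open>The graph of \<open>W\<close> on the span of the tensors.\<close>

inductive_set G :: "((complex \<times> complex \<Rightarrow> complex) \<times> 'h) set" where
  tensor: "f \<in> bcontfun \<Longrightarrow> g \<in> bcontfun \<Longrightarrow> ((\<lambda>(x, y). f x * g y), E g (F f \<Omega>)) \<in> G"
| add: "(\<psi>, u) \<in> G \<Longrightarrow> (\<phi>, v) \<in> G \<Longrightarrow> (\<lambda>p. \<psi> p + \<phi> p, u + v) \<in> G"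

lemma G_L2: "(\<psi>, u) \<in> G \<Longrightarrow> \<psi> \<in> L2 M"
  by (induction rule: G.induct) (auto intro: tensor_L2 L2_add)

lemma G_scale: "(\<psi>, u) \<in> G \<Longrightarrow> (\<lambda>p. c * \<psi> p, c *\<^sub>C u) \<in> G"
proof (induction rule: G.induct)
  case (tensor f g)
  then have "((\<lambda>(x, y). (c * f x) * g y), E g (F (\<lambda>x. c * f x) \<Omega>)) \<in> G"
    by (intro G.tensor bcontfun_mult const_bcontfun)
  then show ?case using tensor by (simp add: X.calc_scale Y.calc_scaleC case_prod_unfold mult.assoc)
next
  case (add \<psi> u \<phi> v)
  from G.add[OF add(3,4)] show ?case by (simp add: distrib_left scaleC_add_right)
qed

lemma tensor_cinner:
  assumes "f1 \<in> bcontfun" "g1 \<in> bcontfun" "f2 \<in> bcontfun" "g2 \<in> bcontfun"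
  shows "cinner (E g1 (F f1 \<Omega>)) (E g2 (F f2 \<Omega>)) =
    (\<integral>p. cnj (case p of (x, y) \<Rightarrow> f1 x * g1 y) * (case p of (x, y) \<Rightarrow> f2 x * g2 y) \<partial>M)"
proof -
  note b = assms bcontfun_cnj[OF assms(1)] bcontfun_cnj[OF assms(2)]
  have "cinner (E g1 (F f1 \<Omega>)) (E g2 (F f2 \<Omega>)) = cinner \<Omega> (F (\<lambda>z. cnj (f1 z)) (E (\<lambda>z. cnj (g1 z) * g2 z) (F f2 \<Omega>)))"
    by (simp add: X.calc_cnj Y.calc_cnj Y.calc_mult b)
  also have "\<dots> = (\<integral>x. cnj (f1 x) * f2 x \<partial>\<mu>) * (\<integral>y. cnj (g1 y) * g2 y \<partial>\<nu>)"
    by (subst expectation_FEF) (auto intro: b bcontfun_mult)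
  also have "\<dots> = (\<integral>p. (case p of (x, y) \<Rightarrow> (cnj (f1 x) * f2 x) * (cnj (g1 y) * g2 y)) \<partial>M)"
    by (rule tensor_integral(2)[symmetric]) (intro bcontfun_mult b)+
  also have "\<dots> = (\<integral>p. cnj (case p of (x, y) \<Rightarrow> f1 x * g1 y) * (case p of (x, y) \<Rightarrow> f2 x * g2 y) \<partial>M)"
    by (intro Bochner_Integration.integral_cong) (auto simp: mult_ac)
  finally show ?thesis .
qed

lemma G_cinner:
  assumes "(\<psi>, u) \<in> G" "(\<phi>, v) \<in> G"
  shows "cinner u v = (\<integral>p. cnj (\<psi> p) * \<phi> p \<partial>M)"
  using assms
proof (induction arbitrary: \<phi> v rule: G.induct)
  case (tensor f g)
  from tensor(3) show ?case
  proof (induction rule: G.induct)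
    case (tensor f' g') then show ?case using \<open>f \<in> bcontfun\<close> \<open>g \<in> bcontfun\<close> by (intro tensor_cinner)
  next
    case (add \<phi>1 v1 \<phi>2 v2)
    then show ?case
      using L2_inner_integrable[OF tensor_L2[OF \<open>f \<in> bcontfun\<close> \<open>g \<in> bcontfun\<close>] G_L2[OF add(1)]]
        L2_inner_integrable[OF tensor_L2[OF \<open>f \<in> bcontfun\<close> \<open>g \<in> bcontfun\<close>] G_L2[OF add(2)]]
      by (simp add: cinner_add_right distrib_left)
  qed
next
  case (add \<psi>1 u1 \<psi>2 u2)
  then show ?case
    using L2_inner_integrable[OF G_L2[OF add(1)] G_L2[OF add(5)]] L2_inner_integrable[OF G_L2[OF add(2)] G_L2[OF add(5)]]
    by (simp add: cinner_add_left distrib_right)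
qed

lemma G_norm:
  assumes "(\<psi>, u) \<in> G" shows "norm u = L2norm M \<psi>"
proof -
  have "complex_of_real ((norm u)\<^sup>2) = (\<integral>p. cnj (\<psi> p) * \<psi> p \<partial>M)"
    unfolding cinner_self[symmetric] by (rule G_cinner[OF assms assms])
  also have "\<dots> = (\<integral>p. complex_of_real ((cmod (\<psi> p))\<^sup>2) \<partial>M)"
    by (simp only: complex_norm_square mult.commute)
  also have "\<dots> = complex_of_real ((L2norm M \<psi>)\<^sup>2)" by (simp add: L2norm_sq del: of_real_power)
  finally have "(norm u)\<^sup>2 = (L2norm M \<psi>)\<^sup>2" by (simp only: of_real_eq_iff)
  then show ?thesis by (simp add: power2_eq_iff_nonneg)
qed

sublocale D: tensor_dense M "Domain G"
proof (unfold_locales)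
  show "sets M = sets (borel \<Otimes>\<^sub>M borel)" by (rule sets_M)
  show "(\<lambda>(x, y). a x * b y) \<in> Domain G" if "a \<in> bcontfun" "b \<in> bcontfun" for a b
    using G.tensor[OF that] by blast
  show "(\<lambda>p. f p + g p) \<in> Domain G" if "f \<in> Domain G" "g \<in> Domain G" for f g
    using that G.add by blast
  show "Domain G \<subseteq> L2 M" using G_L2 by blast
qed

sublocale dense_isometry M G
proof (unfold_locales)
  show "\<psi> \<in> L2 M" if "(\<psi>, u) \<in> G" for \<psi> u by (rule G_L2[OF that])
  show "(\<lambda>p. \<psi> p + \<phi> p, u + v) \<in> G" if "(\<psi>, u) \<in> G" "(\<phi>, v) \<in> G" for \<psi> u \<phi> v by (rule G.add[OF that])
  show "(\<lambda>p. c * \<psi> p, c *\<^sub>C u) \<in> G" if "(\<psi>, u) \<in> G" for \<psi> u c by (rule G_scale[OF that])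
  show "norm u = L2norm M \<psi>" if "(\<psi>, u) \<in> G" for \<psi> u by (rule G_norm[OF that])
  show "\<exists>(\<phi>, u)\<in>G. L2norm M (\<lambda>p. \<phi> p - \<psi> p) < e" if "\<psi> \<in> L2 M" "0 < e" for \<psi> e
    using D.D_dense[OF that] by fast
qed

text \<open>The operators that \<open>h(Y)\<close> and \<open>h(X)\<close> become on $L^2$.\<close>

definition model_Y :: "(complex \<Rightarrow> complex) \<Rightarrow> (complex \<times> complex \<Rightarrow> complex) \<Rightarrow> complex \<times> complex \<Rightarrow> complex" where
  "model_Y h \<psi> = (\<lambda>(x, y). h y * \<psi> (x, y))"

definition model_X :: "(complex \<Rightarrow> complex) \<Rightarrow> (complex \<times> complex \<Rightarrow> complex) \<Rightarrow> complex \<times> complex \<Rightarrow> complex" where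
  "model_X h \<psi> = (\<lambda>(x, y). (h x - h 0) * (\<integral>y'. \<psi> (x, y') \<partial>\<nu>) + h 0 * \<psi> (x, y))"

lemma G_model_Y:
  assumes h: "h \<in> bcontfun" and "(\<psi>, u) \<in> G"
  shows "(model_Y h \<psi>, E h u) \<in> G"
  using assms(2)
proof (induction rule: G.induct)
  case (tensor f g)
  then have "((\<lambda>(x, y). f x * (h y * g y)), E (\<lambda>y. h y * g y) (F f \<Omega>)) \<in> G"
    by (intro G.tensor bcontfun_mult h)
  then show ?case using tensor h by (simp add: model_Y_def Y.calc_mult case_prod_unfold mult.left_commute)
next
  case (add \<psi> u \<phi> v)
  from G.add[OF add(3,4)] show ?case
    by (simp add: model_Y_def Y.calc_vadd h case_prod_unfold distrib_left)
qed

lemma G_section_integrable: "(\<psi>, u) \<in> G \<Longrightarrow> integrable \<nu> (\<lambda>y. \<psi> (x, y))"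
  by (induction rule: G.induct) (auto intro: integrable_nu)

lemma G_model_X:
  assumes h: "h \<in> bcontfun" and "(\<psi>, u) \<in> G"
  shows "(model_X h \<psi>, F h u) \<in> G"
  using assms(2)
proof (induction rule: G.induct)
  case (tensor f g)
  define c where "c = (\<integral>y. g y \<partial>\<nu>)"
  let ?h = "\<lambda>z. h z - h 0"
  have h0: "?h \<in> bcontfun" by (rule centred[OF h])
  have "((\<lambda>(x, y). (?h x * f x) * c), E (\<lambda>y. c) (F (\<lambda>x. ?h x * f x) \<Omega>)) \<in> G"
    using tensor h0 by (intro G.tensor bcontfun_mult const_bcontfun)
  from G.add[OF this G_scale[OF G.tensor[OF tensor], of "h 0"]]
  have "((\<lambda>p. (case p of (x, y) \<Rightarrow> (?h x * f x) * c) + h 0 * (case p of (x, y) \<Rightarrow> f x * g y)),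
      E (\<lambda>y. c) (F (\<lambda>x. ?h x * f x) \<Omega>) + h 0 *\<^sub>C E g (F f \<Omega>)) \<in> G" .
  moreover have "(\<lambda>p. (case p of (x, y) \<Rightarrow> (?h x * f x) * c) + h 0 * (case p of (x, y) \<Rightarrow> f x * g y)) =
      model_X h (\<lambda>(x, y). f x * g y)"
    by (auto simp: model_X_def c_def mult.assoc)
  moreover have "E (\<lambda>y. c) (F (\<lambda>x. ?h x * f x) \<Omega>) + h 0 *\<^sub>C E g (F f \<Omega>) = F h (E g (F f \<Omega>))"
    using F_E_F[OF h0 _ tensor(2,1)] X.calc_centre[OF h, of "E g (F f \<Omega>)"]
    by (simp add: Y.calc_const X.calc_mult h0 tensor c_def)
  ultimately show ?case by simp
next
  case (add \<psi> u \<phi> v)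
  have "model_X h (\<lambda>p. \<psi> p + \<phi> p) = (\<lambda>p. model_X h \<psi> p + model_X h \<phi> p)"
    by (auto simp: model_X_def G_section_integrable[OF add(1)] G_section_integrable[OF add(2)] algebra_simps)
  then show ?case using G.add[OF add(3,4)] by (simp add: X.calc_vadd h)
qed

text \<open>Both sides are continuous in \<open>\<psi>\<close>, and \<open>G\<close> settles the equation on a dense set.\<close>

lemma W_extend:
  assumes \<psi>: "\<psi> \<in> L2 M" and B: "bounded_linear B"
    and G: "\<And>\<phi> u. (\<phi>, u) \<in> G \<Longrightarrow> (R \<phi>, B u) \<in> G"
    and R: "R \<psi> \<in> L2 M" "\<And>\<phi> u. (\<phi>, u) \<in> G \<Longrightarrow> L2norm M (\<lambda>p. R \<phi> p - R \<psi> p) \<le> C * L2norm M (\<lambda>p. \<phi> p - \<psi> p)"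
  shows "B (W \<psi>) = W (R \<psi>)"
proof -
  obtain \<phi> v where *: "\<And>n. (\<phi> n, v n) \<in> G" "(\<lambda>n. L2norm M (\<lambda>x. \<phi> n x - \<psi> x)) \<longlonglongrightarrow> 0" "v \<longlonglongrightarrow> W \<psi>"
    using lim_graph_W[OF \<psi>] by (auto simp: lim_graph_def)
  have "lim_graph (R \<psi>) (B (W \<psi>))"
  proof (rule lim_graphI[OF G[OF *(1)] _ bounded_linear.tendsto[OF B *(3)]])
    have "(\<lambda>n. C * L2norm M (\<lambda>x. \<phi> n x - \<psi> x)) \<longlonglongrightarrow> 0"
      using tendsto_mult_left[OF *(2), of C] by simp
    then show "(\<lambda>n. L2norm M (\<lambda>x. R (\<phi> n) x - R \<psi> x)) \<longlonglongrightarrow> 0"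
      by (rule LIMSEQ_to_zeroI[rotated 2]) (simp_all add: R(2)[OF *(1)])
  qed
  from W_eqI[OF R(1) this] show ?thesis by simp
qed

lemma L2norm_le_cmult:
  assumes "f \<in> L2 M" "g \<in> borel_measurable M" "\<And>p. cmod (g p) \<le> C * cmod (f p)" "0 \<le> C"
  shows "g \<in> L2 M" "L2norm M g \<le> C * L2norm M f"
proof -
  have Cf: "(\<lambda>p. complex_of_real C * f p) \<in> L2 M" by (rule L2_scale[OF assms(1)])
  show g: "g \<in> L2 M" by (rule L2_bound[OF Cf assms(2)]) (use assms in \<open>simp add: norm_mult\<close>)
  have "(\<integral>p. (cmod (g p))\<^sup>2 \<partial>M) \<le> (\<integral>p. (cmod (complex_of_real C * f p))\<^sup>2 \<partial>M)"
    by (intro integral_mono L2_integrable g Cf power_mono) (use assms in \<open>auto simp: norm_mult\<close>)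
  then have "L2norm M g \<le> L2norm M (\<lambda>p. complex_of_real C * f p)" by (simp add: L2norm_def)
  then show "L2norm M g \<le> C * L2norm M f" using assms(4) by (simp only: L2norm_scale norm_of_real abs_of_nonneg)
qed

lemma bcontfun_borel_mu_nu:
  fixes h :: "complex \<Rightarrow> complex"
  assumes "h \<in> bcontfun" shows "h \<in> borel_measurable \<mu>" "h \<in> borel_measurable \<nu>"
  using bcontfun_borel[OF assms]
  by (simp_all add: measurable_cong_sets[OF sets_mu refl] measurable_cong_sets[OF sets_nu refl])

lemma model_Y_bounded:
  assumes h: "h \<in> bcontfun" "\<And>z. cmod (h z) \<le> C" "0 \<le> C" and \<psi>: "\<psi> \<in> L2 M"
  shows "model_Y h \<psi> \<in> L2 M" "L2norm M (model_Y h \<psi>) \<le> C * L2norm M \<psi>"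
proof -
  have [measurable]: "\<psi> \<in> borel_measurable M" by (rule L2_measurable[OF \<psi>])
  have [measurable]: "h \<in> borel_measurable \<nu>" by (rule bcontfun_borel_mu_nu[OF h(1)])
  have m: "model_Y h \<psi> \<in> borel_measurable M" unfolding model_Y_def by measurable
  have le: "cmod (model_Y h \<psi> p) \<le> C * cmod (\<psi> p)" for p
    using h(2) by (cases p) (simp add: model_Y_def norm_mult mult_right_mono)
  show "model_Y h \<psi> \<in> L2 M" "L2norm M (model_Y h \<psi>) \<le> C * L2norm M \<psi>"
    by (rule L2norm_le_cmult[OF \<psi> m le h(3)])+
qed

text \<open>The conditional expectation given the first coordinate.\<close>

definition avg :: "(complex \<times> complex \<Rightarrow> complex) \<Rightarrow> complex \<times> complex \<Rightarrow> complex" where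
  "avg \<psi> = (\<lambda>(x, y). \<integral>y'. \<psi> (x, y') \<partial>\<nu>)"

lemma section_L2:
  assumes \<psi>: "\<psi> \<in> L2 M"
  shows "AE x in \<mu>. integrable \<nu> (\<lambda>y. (cmod (\<psi> (x, y)))\<^sup>2)"
  using pair.AE_integrable_fst'[OF L2_integrable[OF \<psi>]] by simp

lemma avg_bounded:
  assumes \<psi>: "\<psi> \<in> L2 M"
  shows "avg \<psi> \<in> L2 M" "L2norm M (avg \<psi>) \<le> L2norm M \<psi>"
proof -
  have \<psi>m [measurable]: "\<psi> \<in> borel_measurable M" by (rule L2_measurable[OF \<psi>])
  have am [measurable]: "(\<lambda>x. \<integral>y. \<psi> (x, y) \<partial>\<nu>) \<in> borel_measurable \<mu>" by measurable
  have m: "avg \<psi> \<in> borel_measurable M" unfolding avg_def by measurable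
  have int: "integrable \<mu> (\<lambda>x. \<integral>y. (cmod (\<psi> (x, y)))\<^sup>2 \<partial>\<nu>)"
    by (rule pair.integrable_fst'[OF L2_integrable[OF \<psi>]])
  have le: "AE x in \<mu>. (cmod (\<integral>y. \<psi> (x, y) \<partial>\<nu>))\<^sup>2 \<le> (\<integral>y. (cmod (\<psi> (x, y)))\<^sup>2 \<partial>\<nu>)"
    using section_L2[OF \<psi>] AE_space
  proof eventually_elim
    case (elim x)
    have "(\<lambda>y. \<psi> (x, y)) \<in> borel_measurable \<nu>" using elim(2) by measurable
    then show ?case using elim(1) by (rule nu.Jensen_sq)
  qed
  have int1: "integrable \<mu> (\<lambda>x. (cmod (\<integral>y. \<psi> (x, y) \<partial>\<nu>))\<^sup>2)"
    by (rule Bochner_Integration.integrable_bound[OF int]) (use le in \<open>auto elim!: eventually_mono intro: order_trans[OF _ abs_ge_self]\<close>)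
  have int2: "integrable M (\<lambda>p. (cmod (avg \<psi> p))\<^sup>2)"
  proof -
    have "integrable M (\<lambda>(x, y). (cmod (\<integral>y. \<psi> (x, y) \<partial>\<nu>))\<^sup>2)"
      by (rule pair.Fubini_integrable) (use int1 in \<open>auto simp: nu.prob_space\<close>)
    then show ?thesis by (simp add: avg_def case_prod_unfold)
  qed
  show "avg \<psi> \<in> L2 M" using m int2 by (simp add: L2_def)
  have "(\<integral>p. (cmod (avg \<psi> p))\<^sup>2 \<partial>M) = (\<integral>x. (\<integral>y. (cmod (avg \<psi> (x, y)))\<^sup>2 \<partial>\<nu>) \<partial>\<mu>)"
    by (rule pair.integral_fst'[OF int2, symmetric])
  also have "\<dots> = (\<integral>x. (cmod (\<integral>y. \<psi> (x, y) \<partial>\<nu>))\<^sup>2 \<partial>\<mu>)" by (simp add: avg_def nu.prob_space)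
  also have "\<dots> \<le> (\<integral>x. (\<integral>y. (cmod (\<psi> (x, y)))\<^sup>2 \<partial>\<nu>) \<partial>\<mu>)" by (rule integral_mono_AE[OF int1 int le])
  also have "\<dots> = (\<integral>p. (cmod (\<psi> p))\<^sup>2 \<partial>M)" by (rule pair.integral_fst'[OF L2_integrable[OF \<psi>]])
  finally show "L2norm M (avg \<psi>) \<le> L2norm M \<psi>" by (simp add: L2norm_def)
qed

lemma model_X_apply: "model_X h \<psi> (x, y) = (h x - h 0) * (\<integral>y'. \<psi> (x, y') \<partial>\<nu>) + h 0 * \<psi> (x, y)"
  and model_Y_apply: "model_Y h \<psi> (x, y) = h y * \<psi> (x, y)"
  by (simp_all add: model_X_def model_Y_def)

text \<open>Equality holds only almost everywhere, because the Bochner integral is 0 on the null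
  set of sections that are not integrable.\<close>

lemma avg_diff:
  assumes \<phi>: "\<phi> \<in> L2 M" and \<psi>: "\<psi> \<in> L2 M"
  shows "AE p in M. avg \<phi> p - avg \<psi> p = avg (\<lambda>p. \<phi> p - \<psi> p) p"
proof -
  have int: "integrable M f" if "f \<in> L2 M" for f
    using L2_inner_integrable[OF pair.L2_bounded[of "\<lambda>_. 1" 1] that] by simp
  have "AE x in \<mu>. integrable \<nu> (\<lambda>y. \<phi> (x, y)) \<and> integrable \<nu> (\<lambda>y. \<psi> (x, y))"
    using pair.AE_integrable_fst'[OF int[OF \<phi>]] pair.AE_integrable_fst'[OF int[OF \<psi>]] by eventually_elim simp
  then have "AE x in distr M \<mu> fst. integrable \<nu> (\<lambda>y. \<phi> (x, y)) \<and> integrable \<nu> (\<lambda>y. \<psi> (x, y))"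
    unfolding nu.distr_pair_fst .
  from AE_distrD[OF measurable_fst this] show ?thesis
    by eventually_elim (simp add: avg_def case_prod_unfold)
qed

lemma L2norm_cong_AE:
  assumes "AE p in M. f p = g p" "f \<in> borel_measurable M" "g \<in> borel_measurable M"
  shows "L2norm M f = L2norm M g"
proof -
  have "(\<integral>p. (cmod (f p))\<^sup>2 \<partial>M) = (\<integral>p. (cmod (g p))\<^sup>2 \<partial>M)"
    using assms by (intro integral_cong_AE) auto
  then show ?thesis by (simp add: L2norm_def)
qed

lemma model_X_bounded:
  assumes h: "h \<in> bcontfun" "\<And>z. cmod (h z) \<le> C" and \<psi>: "\<psi> \<in> L2 M"
  shows "model_X h \<psi> \<in> L2 M"
    "\<phi> \<in> L2 M \<Longrightarrow> L2norm M (\<lambda>p. model_X h \<phi> p - model_X h \<psi> p) \<le> 3 * C * L2norm M (\<lambda>p. \<phi> p - \<psi> p)"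
proof -
  have C0: "0 \<le> C" using order_trans[OF norm_ge_zero h(2)] .
  let ?h = "\<lambda>p :: complex \<times> complex. h (fst p) - h 0"
  have [measurable]: "h \<in> borel_measurable \<mu>" by (rule bcontfun_borel_mu_nu[OF h(1)])
  have hb: "cmod (?h p) \<le> 2 * C" for p
    using norm_triangle_ineq4[of "h (fst p)" "h 0"] h(2)[of "fst p"] h(2)[of 0] by simp
  have mult: "(\<lambda>p. ?h p * f p) \<in> L2 M" "L2norm M (\<lambda>p. ?h p * f p) \<le> 2 * C * L2norm M f" if f: "f \<in> L2 M" for f
  proof -
    have [measurable]: "f \<in> borel_measurable M" by (rule L2_measurable[OF f])
    have m: "(\<lambda>p. ?h p * f p) \<in> borel_measurable M" by measurable
    have "cmod (?h p * f p) \<le> 2 * C * cmod (f p)" for p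
      unfolding norm_mult by (rule mult_right_mono[OF hb norm_ge_zero])
    from L2norm_le_cmult[OF f m this] C0
    show "(\<lambda>p. ?h p * f p) \<in> L2 M" "L2norm M (\<lambda>p. ?h p * f p) \<le> 2 * C * L2norm M f" by auto
  qed
  have eq: "model_X h f = (\<lambda>p. ?h p * avg f p + h 0 * f p)" for f
    by (auto simp: model_X_def avg_def)
  show "model_X h \<psi> \<in> L2 M" unfolding eq by (intro L2_add mult L2_scale avg_bounded \<psi>)
  assume \<phi>: "\<phi> \<in> L2 M"
  let ?d = "\<lambda>p. \<phi> p - \<psi> p" and ?a = "\<lambda>p. avg \<phi> p - avg \<psi> p"
  have d: "?d \<in> L2 M" and a: "?a \<in> L2 M" by (intro L2_diff avg_bounded \<phi> \<psi>)+
  have "(\<lambda>p. model_X h \<phi> p - model_X h \<psi> p) = (\<lambda>p. ?h p * ?a p + h 0 * ?d p)"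
    unfolding eq by (auto simp: algebra_simps)
  then have "L2norm M (\<lambda>p. model_X h \<phi> p - model_X h \<psi> p) \<le> L2norm M (\<lambda>p. ?h p * ?a p) + L2norm M (\<lambda>p. h 0 * ?d p)"
    using L2norm_add_le[OF mult(1)[OF a] L2_scale[OF d]] by simp
  also have "\<dots> \<le> 2 * C * L2norm M ?a + C * L2norm M ?d"
    unfolding L2norm_scale by (intro add_mono mult(2)[OF a] mult_right_mono h(2)) simp
  also have "L2norm M ?a = L2norm M (avg ?d)"
    by (rule L2norm_cong_AE[OF avg_diff[OF \<phi> \<psi>] L2_measurable[OF a] L2_measurable[OF avg_bounded(1)[OF d]]])
  also have "2 * C * L2norm M (avg ?d) + C * L2norm M ?d \<le> 2 * C * L2norm M ?d + C * L2norm M ?d"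
    using C0 by (intro add_mono mult_left_mono avg_bounded(2)[OF d]) auto
  finally show "L2norm M (\<lambda>p. model_X h \<phi> p - model_X h \<psi> p) \<le> 3 * C * L2norm M ?d" by simp
qed

lemma W_model_Y:
  assumes h: "h \<in> bcontfun" and \<psi>: "\<psi> \<in> L2 M"
  shows "model_Y h \<psi> \<in> L2 M" "E h (W \<psi>) = W (model_Y h \<psi>)"
proof -
  obtain C where C: "0 < C" "\<And>z. cmod (h z) \<le> C" using bcontfun_bound[OF h] by blast
  note bd = model_Y_bounded[OF h C(2) less_imp_le[OF C(1)]]
  show m: "model_Y h \<psi> \<in> L2 M" by (rule bd(1)[OF \<psi>])
  show "E h (W \<psi>) = W (model_Y h \<psi>)"
  proof (rule W_extend[where R = "model_Y h", OF \<psi> Y.calc_bl[OF h] G_model_Y[OF h] m])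
    fix \<phi> u assume "(\<phi>, u) \<in> G"
    then have "(\<lambda>p. \<phi> p - \<psi> p) \<in> L2 M" by (intro L2_diff G_L2 \<psi>)
    from bd(2)[OF this] show "L2norm M (\<lambda>p. model_Y h \<phi> p - model_Y h \<psi> p) \<le> C * L2norm M (\<lambda>p. \<phi> p - \<psi> p)"
      by (simp add: model_Y_def case_prod_unfold right_diff_distrib)
  qed
qed

lemma W_model_X:
  assumes h: "h \<in> bcontfun" and \<psi>: "\<psi> \<in> L2 M"
  shows "model_X h \<psi> \<in> L2 M" "F h (W \<psi>) = W (model_X h \<psi>)"
proof -
  obtain C where C: "0 < C" "\<And>z. cmod (h z) \<le> C" using bcontfun_bound[OF h] by blast
  note bd = model_X_bounded[OF h C(2)]
  show m: "model_X h \<psi> \<in> L2 M" by (rule bd(1)[OF \<psi>])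
  show "F h (W \<psi>) = W (model_X h \<psi>)"
    by (rule W_extend[where R = "model_X h", OF \<psi> X.calc_bl[OF h] G_model_X[OF h] m bd(2)[OF \<psi> G_L2]])
qed

lemma Omega_in_range: "\<Omega> \<in> W ` L2 M"
proof -
  have "W (\<lambda>(x, y). 1 * 1) = E (\<lambda>z. 1) (F (\<lambda>z. 1) \<Omega>)" by (rule W_G[OF G.tensor[OF const_bcontfun const_bcontfun]])
  then show ?thesis using tensor_L2[OF const_bcontfun[of 1] const_bcontfun[of 1]]
    by (auto simp: X.calc_one Y.calc_one intro!: image_eqI)
qed

lemma alg_maps_range:
  assumes "A \<in> alg_of X Y" "u \<in> W ` L2 M" shows "A u \<in> W ` L2 M"
  using assms unfolding alg_of_def
proof (induction arbitrary: u rule: alg.induct)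
  case (gen A)
  then obtain \<psi> where "\<psi> \<in> L2 M" "u = W \<psi>" by blast
  with gen(1) show ?case using W_model_X W_model_Y by fastforce
next
  case zero
  have "W (\<lambda>p. 0 * 0) = 0 *\<^sub>C W (\<lambda>p. 0)"
    by (rule W_isometry[unfolded L2_isometry_def, THEN conjunct2, THEN conjunct1, rule_format, OF L2_zero])
  then show ?case using L2_zero by (auto intro!: image_eqI)
next
  case (add A B)
  then obtain \<psi> \<phi> where *: "\<psi> \<in> L2 M" "A u = W \<psi>" "\<phi> \<in> L2 M" "B u = W \<phi>" by blast
  then have eq: "W (\<lambda>p. \<psi> p + \<phi> p) = A u + B u" using W_isometry by (simp add: L2_isometry_def)
  from imageI[OF L2_add[OF *(1,3)], of W] show ?case unfolding eq .
next
  case (scale A c)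
  then obtain \<psi> where *: "\<psi> \<in> L2 M" "A u = W \<psi>" by blast
  then have eq: "W (\<lambda>p. c * \<psi> p) = c *\<^sub>C A u" using W_isometry by (simp add: L2_isometry_def)
  from imageI[OF L2_scale[OF *(1), of c], of W] show ?case unfolding eq .
next
  case (mult A B) then show ?case by simp
qed

lemma G_in_alg: "(\<psi>, u) \<in> G \<Longrightarrow> u \<in> (\<lambda>A. A \<Omega>) ` alg_of X Y"
proof (induction rule: G.induct)
  case (tensor f g)
  have "E g \<circ> F f \<in> alg_of X Y" unfolding alg_of_def using tensor by (intro alg.mult alg.gen) auto
  then show ?case by (force intro: rev_image_eqI)
next
  case (add \<psi> u \<phi> v)
  then obtain A B where *: "A \<in> alg_of X Y" "u = A \<Omega>" "B \<in> alg_of X Y" "v = B \<Omega>" by blast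
  then have "(\<lambda>w. A w + B w) \<in> alg_of X Y" unfolding alg_of_def by (intro alg.add)
  then show ?case using * by (force intro: rev_image_eqI)
qed

lemma range_eq_closure_alg: "W ` L2 M = closure ((\<lambda>A. A \<Omega>) ` alg_of X Y)"
proof
  show "W ` L2 M \<subseteq> closure ((\<lambda>A. A \<Omega>) ` alg_of X Y)"
    unfolding W_range by (rule closure_mono) (use G_in_alg in auto)
  have "(\<lambda>A. A \<Omega>) ` alg_of X Y \<subseteq> W ` L2 M" using alg_maps_range Omega_in_range by blast
  moreover have "closed (W ` L2 M)" by (simp add: W_range)
  ultimately show "closure ((\<lambda>A. A \<Omega>) ` alg_of X Y) \<subseteq> W ` L2 M" by (rule closure_minimal)
qed

end

theorem theorem3p5:
  fixes X Y :: "('h::complex_hilbert \<times> 'h) set" and \<Omega> :: 'h and \<mu> \<nu> :: "complex measure"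
  assumes "normal_operator X" and "normal_operator Y"
    and "norm \<Omega> = 1"
    and "monotone_independent_operators \<Omega> X Y"
    and "is_distribution X \<Omega> \<mu>" and "is_distribution Y \<Omega> \<nu>"
  shows "\<exists>W :: (complex \<times> complex \<Rightarrow> complex) \<Rightarrow> 'h.
    L2_isometry (\<mu> \<Otimes>\<^sub>M \<nu>) W \<and>
    (\<forall>\<psi>\<in>L2 (\<mu> \<Otimes>\<^sub>M \<nu>). \<forall>h\<in>bcontfun.
      (AE (x, y) in \<mu> \<Otimes>\<^sub>M \<nu>.
        L2_adjoint (\<mu> \<Otimes>\<^sub>M \<nu>) W (fcalc X h (W \<psi>)) (x, y) =
          (h x - h 0) * (\<integral>y'. \<psi> (x, y') \<partial>\<nu>) + h 0 * \<psi> (x, y)) \<and>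
      (AE (x, y) in \<mu> \<Otimes>\<^sub>M \<nu>.
        L2_adjoint (\<mu> \<Otimes>\<^sub>M \<nu>) W (fcalc Y h (W \<psi>)) (x, y) = h y * \<psi> (x, y))) \<and>
    W ` L2 (\<mu> \<Otimes>\<^sub>M \<nu>) = closure ((\<lambda>A. A \<Omega>) ` alg_of X Y) \<and>
    (closure ((\<lambda>A. A \<Omega>) ` alg_of X Y) = UNIV \<longrightarrow> L2_unitary (\<mu> \<Otimes>\<^sub>M \<nu>) W)"
proof -
  interpret monotone_pair X Y \<Omega> \<mu> \<nu> by unfold_locales (fact assms)+
  show ?thesis
  proof (intro exI[of _ W] conjI ballI impI)
    show "L2_isometry M W" by (rule W_isometry)
    show "W ` L2 M = closure ((\<lambda>A. A \<Omega>) ` alg_of X Y)" by (rule range_eq_closure_alg)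
    show "L2_unitary M W" if "closure ((\<lambda>A. A \<Omega>) ` alg_of X Y) = UNIV"
      unfolding L2_unitary_def using W_isometry range_eq_closure_alg that by simp
    fix \<psi> and h :: "complex \<Rightarrow> complex" assume \<psi>: "\<psi> \<in> L2 M" and h: "h \<in> bcontfun"
    show "AE (x, y) in M. L2_adjoint M W (F h (W \<psi>)) (x, y) =
        (h x - h 0) * (\<integral>y'. \<psi> (x, y') \<partial>\<nu>) + h 0 * \<psi> (x, y)"
      unfolding W_model_X(2)[OF h \<psi>] using L2_adjoint_isometry[OF W_isometry W_model_X(1)[OF h \<psi>]]
      by eventually_elim (auto simp: model_X_apply)
    show "AE (x, y) in M. L2_adjoint M W (E h (W \<psi>)) (x, y) = h y * \<psi> (x, y)"
      unfolding W_model_Y(2)[OF h \<psi>] using L2_adjoint_isometry[OF W_isometry W_model_Y(1)[OF h \<psi>]]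
      by eventually_elim (auto simp: model_Y_apply)
  qed
qed

end
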